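(* Let $E$ be a field of characteristic different from $2$ that is finitely generated of transcendence degree at least one over a subfield. Then $E_{\mathrm{pyth}}$ and $E_{\mathrm{quad}}$ are both hereditarily non-pythagorean.
   Context: A field $K$ is pythagorean if every sum of squares of elements of $K$ is a square in $K$. For a field $E$, inside a fixed algebraic closure of $E$, the pythagorean closure $E_{\mathrm{pyth}}$ is the direct limit (union) of all finite extensions of $E$ obtained by finite chains of quadratic extensions, each given by adjoining a square root of a sum of two squares of the preceding field; the quadratic closure $E_{\mathrm{quad}}$ is the direct limit (union) of all finite extensions of $E$ obtained by finite chains of quadratic extensions, each given by adjoining a square root of an arbitrary element of the preceding field. A field $k$ is hereditarily non-pythagorean if every proper finite extension $F/k$ that is not purely inseparable is non-pythagorean. *)

theory Defs
  imports
    "HOL-Algebra.Algebraic_Closure"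
    "HOL-Algebra.Generated_Fields"
    "HOL-Library.Extended_Nat"
begin

definition ring_characteristic :: "('a, 'm) ring_scheme \<Rightarrow> nat" where
  "ring_characteristic R =
     (if \<exists>n::nat. 0 < n \<and> [n] \<cdot>\<^bsub>R\<^esub> \<one>\<^bsub>R\<^esub> = \<zero>\<^bsub>R\<^esub>
      then LEAST n::nat. 0 < n \<and> [n] \<cdot>\<^bsub>R\<^esub> \<one>\<^bsub>R\<^esub> = \<zero>\<^bsub>R\<^esub>
      else 0)"

definition pythagorean :: "('a, 'm) ring_scheme \<Rightarrow> bool" where
  "pythagorean R \<longleftrightarrow> field R \<and>
     (\<forall>(n::nat) x. x \<in> {..<n} \<rightarrow> carrier R \<longrightarrow>
        (\<exists>y\<in>carrier R. (\<Oplus>\<^bsub>R\<^esub>i\<in>{..<n}. x i \<otimes>\<^bsub>R\<^esub> x i) = y \<otimes>\<^bsub>R\<^esub> y))"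

text \<open>
  \<open>quadratic_tower L rad E F\<close>: inside \<open>L\<close>, the subfield \<open>F\<close> is reached from \<open>E\<close> by a finite chain
  of proper extensions \<open>F' \<subset> F'(c)\<close> with \<open>c\<^sup>2 \<in> rad F'\<close>. In characteristic other than 2 these
  are exactly quadratic extensions.
\<close>

inductive quadratic_tower ::
  "('a, 'm) ring_scheme \<Rightarrow> ('a set \<Rightarrow> 'a set) \<Rightarrow> 'a set \<Rightarrow> 'a set \<Rightarrow> bool"
  for L and rad and E where
  base: "quadratic_tower L rad E E"
| step: "\<lbrakk> quadratic_tower L rad E F; c \<in> carrier L; c \<notin> F; c \<otimes>\<^bsub>L\<^esub> c \<in> rad F \<rbrakk>
          \<Longrightarrow> quadratic_tower L rad E (generate_field L (insert c F))"

definition sums_of_two_squares :: "('a, 'm) ring_scheme \<Rightarrow> 'a set \<Rightarrow> 'a set" where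
  "sums_of_two_squares L F = {a \<otimes>\<^bsub>L\<^esub> a \<oplus>\<^bsub>L\<^esub> b \<otimes>\<^bsub>L\<^esub> b |a b. a \<in> F \<and> b \<in> F}"

definition pyth_closure :: "('a, 'm) ring_scheme \<Rightarrow> 'a set \<Rightarrow> 'a set" where
  "pyth_closure L E = \<Union>{F. quadratic_tower L (sums_of_two_squares L) E F}"

definition quad_closure :: "('a, 'm) ring_scheme \<Rightarrow> 'a set \<Rightarrow> 'a set" where
  "quad_closure L E = \<Union>{F. quadratic_tower L (\<lambda>F. F) E F}"

text \<open>
  The base \<open>max 1 (ring_characteristic F)\<close> is the characteristic exponent, so that in
  characteristic 0 the condition says \<open>K = F\<close>.
\<close>

definition purely_inseparable :: "('a, 'm) ring_scheme \<Rightarrow> 'a set \<Rightarrow> bool" where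
  "purely_inseparable F K \<longleftrightarrow>
     (\<forall>x\<in>carrier F. \<exists>n::nat. x [^]\<^bsub>F\<^esub> (max 1 (ring_characteristic F) ^ n) \<in> K)"

text \<open>
  A finite extension of \<open>K\<close> is an abstract field \<open>F\<close> together with an embedding \<open>h\<close> of \<open>K\<close> into
  \<open>F\<close>. A formula cannot quantify over types, so the type of the elements of \<open>F\<close> is a parameter;
  left as a type variable in a theorem, it makes the statement cover all extensions.
\<close>

definition hereditarily_non_pythagorean :: "'b itself \<Rightarrow> ('a, 'm) ring_scheme \<Rightarrow> bool" where
  "hereditarily_non_pythagorean (_ :: 'b itself) K \<longleftrightarrow> field K \<and>
     (\<forall>(F :: 'b ring) h.
        field F \<and> h \<in> ring_hom K F \<and>
        ring.finite_dimension F (h ` carrier K) (carrier F) \<and>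
        h ` carrier K \<noteq> carrier F \<and>
        \<not> purely_inseparable F (h ` carrier K)
        \<longrightarrow> \<not> pythagorean F)"

definition finitely_generated_over :: "('a, 'm) ring_scheme \<Rightarrow> 'a set \<Rightarrow> 'a set \<Rightarrow> bool" where
  "finitely_generated_over L k E \<longleftrightarrow>
     (\<exists>S. finite S \<and> S \<subseteq> E \<and> E = generate_field L (k \<union> S))"

text \<open>
  No nontrivial polynomial relation over \<open>k\<close> between the elements of the finite set \<open>B\<close>. A
  polynomial in variables indexed by \<open>B\<close> is given by a finite set \<open>M\<close> of exponent vectors
  (functions from \<open>B\<close> to the naturals, extensional so that they represent distinct monomials) and a
  coefficient \<open>c m\<close> for each of them.
\<close>

definition algebraically_independent :: "('a, 'm) ring_scheme \<Rightarrow> 'a set \<Rightarrow> 'a set \<Rightarrow> bool" where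
  "algebraically_independent L k B \<longleftrightarrow> finite B \<and> B \<subseteq> carrier L \<and>
     (\<forall>M c. finite M \<and> M \<subseteq> (B \<rightarrow>\<^sub>E (UNIV :: nat set)) \<and> c \<in> M \<rightarrow> k \<and>
        (\<Oplus>\<^bsub>L\<^esub>m\<in>M. c m \<otimes>\<^bsub>L\<^esub> (\<Otimes>\<^bsub>L\<^esub>b\<in>B. b [^]\<^bsub>L\<^esub> m b)) = \<zero>\<^bsub>L\<^esub>
        \<longrightarrow> (\<forall>m\<in>M. c m = \<zero>\<^bsub>L\<^esub>))"

definition transcendence_degree :: "('a, 'm) ring_scheme \<Rightarrow> 'a set \<Rightarrow> 'a set \<Rightarrow> enat" where
  "transcendence_degree L k E =
     (SUP B\<in>{B. B \<subseteq> E \<and> algebraically_independent L k B}. enat (card B))"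

end

theory Submission
  imports Defs "HOL-Library.More_List" "HOL-Computational_Algebra.Primes"
begin

text \<open>
  Let \<open>K\<close> be the pythagorean closure of \<open>E\<close>, let \<open>i\<close> be a square root of \<open>-1\<close> and suppose that
  a finite, not purely inseparable extension \<open>F\<close> of \<open>K\<close> is pythagorean. Some \<open>\<alpha>\<close> in \<open>F\<close>,
  transcendental over the constants, is moved by a \<open>K\<close>-embedding \<open>\<phi>\<close> of \<open>F\<close> into the algebraic
  closure. For every constant \<open>c\<close>, the element \<open>y = 1 + (\<alpha> - c)\<^sup>2 = (\<alpha> - c + i) (\<alpha> - c - i)\<close> is a
  square in \<open>F\<close>. Descending along the quadratic tower \<open>K / E'\<close>, where \<open>E'\<close> is a finite stage
  containing the structure constants of \<open>F / K\<close>, one obtains \<open>y = e m\<^sup>2\<close> with \<open>e\<close> in \<open>E'\<close> and \<open>m\<close> in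
  the \<open>E'\<close>-span of a fixed basis. Therefore \<open>y \<cdot> \<phi> y = (e m \<phi> m)\<^sup>2\<close> is a square in a field \<open>N\<close> that does
  not depend on \<open>c\<close> and is finitely generated over an algebraically closed field \<open>C\<close> of constants.
  For all but finitely many \<open>d\<close> in \<open>C\<close>, however, there is a place at which \<open>\<alpha> - d\<close> is a uniformizer of
  \<open>N\<close> (up to inseparability), and at the place \<open>d = c - i\<close> the other three factors of
  \<open>y \<cdot> \<phi> y\<close> are units, a contradiction for a suitable \<open>c\<close>.
  The quadratic closure of \<open>E\<close> is the pythagorean closure of \<open>E(i)\<close>, since every element is a
  difference of two squares.
\<close>

section \<open>Linear combinations and polynomial values\<close>

text \<open>The obstacle is that sums of squares really are squares in \<open>K\<close>, which may
  be ramified over infinitely many points. A parity argument works only in a finitely generated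
  field, and this field has to be fixed before \<open>c\<close>, since \<open>c\<close> must avoid
  its finitely many bad points. Descent confines \<open>m\<close> to such a field but leaves a
  factor \<open>e\<close> that depends on \<open>c\<close>. As \<phi> fixes \<open>e\<close>,
  multiplication by the conjugate of \<open>y\<close> turns \<open>e\<close> into a square; this is
  why \<alpha> has to be moved, for otherwise the product would be \<open>y^2\<close>. The summand 1
  in \<open>y\<close> gives two distinct simple zeros once \<open>i\<close> is a constant. Only one
  of the four factors may vanish at the chosen place, which means that \<phi>(\<alpha>) - \<alpha>
  must be neither 0 nor 2i. The element \<open>c\<close> must come from constants inside
  \<open>K\<close>, so that \<phi> fixes it, although the places are parametrized by the larger
  field \<open>C\<close>; hence an infinite field of constants of \<open>K\<close> is required. In
  positive characteristic only Frobenius powers of generators can be controlled; their exponents are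
  odd, so parity survives.\<close>

primrec (in ring) lincomb :: "(nat \<Rightarrow> 'a) \<Rightarrow> (nat \<Rightarrow> 'a) \<Rightarrow> nat \<Rightarrow> 'a" where
  "lincomb f u 0 = \<zero>"
| "lincomb f u (Suc n) = lincomb f u n \<oplus> f n \<otimes> u n"

text \<open>Coefficient sequences are total functions on the naturals of which the first
  \<open>n\<close> values count, so \<open>peval f (Suc n)\<close> is a polynomial of formal degree
  \<open>n\<close> with top coefficient \<open>f n\<close>. Since lemmas assume \<open>f i\<close>
  in a subring for every \<open>i\<close>, sequences are often cut off by \<zero> beyond the range
  in use. The same \<open>lincomb\<close>, with a basis \<open>u\<close> in place of the powers of
  \<open>x\<close>, serves for coordinates.\<close>

abbreviation (in ring) peval :: "(nat \<Rightarrow> 'a) \<Rightarrow> nat \<Rightarrow> 'a \<Rightarrow> 'a" where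
  "peval f n x \<equiv> lincomb f (\<lambda>i. x [^] i) n"

context ring
begin

lemma lincomb_closed [simp, intro]:
  assumes "\<And>i. f i \<in> carrier R" "\<And>i. u i \<in> carrier R"
  shows "lincomb f u n \<in> carrier R"
  using assms by (induct n) auto

lemma lincomb_in_subring:
  assumes "subring A R" "\<And>i. f i \<in> A" "\<And>i. u i \<in> A"
  shows "lincomb f u n \<in> A"
  using assms subringE[OF assms(1)] by (induct n) auto

lemma lincomb_cong:
  assumes "\<And>i. i < n \<Longrightarrow> f i = g i" "\<And>i. i < n \<Longrightarrow> u i = v i"
  shows "lincomb f u n = lincomb g v n"
  using assms by (induct n) auto

lemma lincomb_add:
  assumes "\<And>i. f i \<in> carrier R" "\<And>i. g i \<in> carrier R" "\<And>i. u i \<in> carrier R"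
  shows "lincomb (\<lambda>i. f i \<oplus> g i) u n = lincomb f u n \<oplus> lincomb g u n"
  using assms by (induct n) (auto simp: l_distr a_ac)

lemma lincomb_smult:
  assumes "a \<in> carrier R" "\<And>i. f i \<in> carrier R" "\<And>i. u i \<in> carrier R"
  shows "lincomb (\<lambda>i. a \<otimes> f i) u n = a \<otimes> lincomb f u n"
  using assms by (induct n) (auto simp: r_distr m_assoc)

lemma lincomb_zero:
  assumes "\<And>i. i < n \<Longrightarrow> f i = \<zero>" "\<And>i. u i \<in> carrier R"
  shows "lincomb f u n = \<zero>"
  using assms by (induct n) auto

lemma lincomb_minus:
  assumes "\<And>i. f i \<in> carrier R" "\<And>i. u i \<in> carrier R"
  shows "lincomb (\<lambda>i. \<ominus> f i) u n = \<ominus> lincomb f u n"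
  using assms by (induct n) (auto simp: l_minus minus_add)

text \<open>Interchange of a double sum; it lets a relation for \<open>t\<close> over polynomials in
  \<open>y\<close> be reread as a relation for \<open>y\<close> over polynomials in
  \<open>t\<close>.\<close>

lemma lincomb_swap:
  assumes "\<And>i j. c i j \<in> carrier R" "\<And>i. u i \<in> carrier R" "\<And>j. v j \<in> carrier R"
    and "\<And>i j. u i \<otimes> v j = v j \<otimes> u i"
  shows "lincomb (\<lambda>i. lincomb (c i) v m) u n = lincomb (\<lambda>j. lincomb (\<lambda>i. c i j) u n) v m"
proof (induct n)
  case 0
  then show ?case using assms by (simp add: lincomb_zero)
next
  case (Suc n)
  have "lincomb (c n) v m \<otimes> u n = lincomb (\<lambda>j. c n j \<otimes> u n) v m"
    using assms by (induct m) (auto simp: l_distr m_assoc)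
  then show ?case using assms Suc by (simp add: lincomb_add)
qed

lemma lincomb_extend:
  assumes "n \<le> m" "\<And>i. f i \<in> carrier R" "\<And>i. u i \<in> carrier R" "\<And>i. \<lbrakk> n \<le> i; i < m \<rbrakk> \<Longrightarrow> f i = \<zero>"
  shows "lincomb f u m = lincomb f u n"
  using assms by (induct m rule: dec_induct) auto

text \<open>Library polynomials are lists with the leading coefficient first, hence the
  reversal.\<close>

lemma eval_map_rev:
  assumes "\<And>i. f i \<in> carrier R" "x \<in> carrier R"
  shows "eval (map f (rev [0..<n])) x = peval f n x"
  using assms by (induct n) (auto simp: a_comm)

lemma eval_eq_peval:
  assumes "set p \<subseteq> carrier R" "x \<in> carrier R"
  shows "eval p x = peval (coeff p) (length p) x"
  using eval_map_rev[of "coeff p" x "length p"] coeff_list[of p] assms by simp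

end

context cring
begin

lemma peval_Suc:
  assumes "\<And>i. f i \<in> carrier R" "x \<in> carrier R"
  shows "peval f (Suc n) x = f 0 \<oplus> x \<otimes> peval (\<lambda>i. f (Suc i)) n x"
  using assms by (induct n) (auto simp: r_distr m_ac a_ac)

lemma lincomb_mult_right:
  assumes "a \<in> carrier R" "\<And>i. f i \<in> carrier R" "\<And>i. u i \<in> carrier R"
  shows "lincomb f (\<lambda>i. a \<otimes> u i) n = a \<otimes> lincomb f u n"
  using assms by (induct n) (auto simp: r_distr m_ac)

text \<open>Product rule: with f = f_0 + X g, the derivative of f is g + X g'.\<close>

lemma peval_derivative_Suc:
  assumes f: "\<And>i. f i \<in> carrier R" and x: "x \<in> carrier R"
  shows "peval (\<lambda>i. [Suc i] \<cdot> f (Suc i)) (Suc n) x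
    = peval (\<lambda>i. f (Suc i)) (Suc n) x \<oplus> x \<otimes> peval (\<lambda>i. [Suc i] \<cdot> f (Suc (Suc i))) n x"
proof -
  have "peval (\<lambda>i. [Suc i] \<cdot> f (Suc i)) (Suc n) x
    = peval (\<lambda>i. [i] \<cdot> f (Suc i) \<oplus> f (Suc i)) (Suc n) x"
    by (rule lincomb_cong) (auto simp: add.nat_pow_Suc)
  also have "\<dots> = peval (\<lambda>i. [i] \<cdot> f (Suc i)) (Suc n) x \<oplus> peval (\<lambda>i. f (Suc i)) (Suc n) x"
    using assms by (intro lincomb_add) auto
  also have "peval (\<lambda>i. [i] \<cdot> f (Suc i)) (Suc n) x = x \<otimes> peval (\<lambda>i. [Suc i] \<cdot> f (Suc (Suc i))) n x"
    using assms by (subst peval_Suc) auto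
  finally show ?thesis using assms by (simp add: a_comm)
qed

text \<open>Synthetic division by x - b stays inside the coefficient ring. The value of the quotient
  at \<open>b\<close> is the derivative of \<open>f\<close> there, by which simple roots are
  recognized later; the last clause keeps track of the leading coefficient.\<close>

lemma peval_quotient:
  assumes A: "subring A R" and f: "\<And>i. f i \<in> A" and b: "b \<in> A"
  obtains q where "\<And>i. q i \<in> A"
    and "\<And>x. x \<in> carrier R \<Longrightarrow> peval f (Suc n) x = (x \<ominus> b) \<otimes> peval q n x \<oplus> peval f (Suc n) b"
    and "peval q n b = peval (\<lambda>i. [Suc i] \<cdot> f (Suc i)) n b"
    and "0 < n \<Longrightarrow> q (n - 1) = f n"
proof -
  have "\<exists>q. (\<forall>i. q i \<in> A)
    \<and> (\<forall>x\<in>carrier R. peval f (Suc n) x = (x \<ominus> b) \<otimes> peval q n x \<oplus> peval f (Suc n) b)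
    \<and> peval q n b = peval (\<lambda>i. [Suc i] \<cdot> f (Suc i)) n b \<and> (0 < n \<longrightarrow> q (n - 1) = f n)"
    using f
  proof (induct n arbitrary: f)
    case 0
    have "\<And>i. f i \<in> carrier R" using 0 subringE(1)[OF A] by auto
    then show ?case using 0 b subringE(1,2)[OF A]
      by (intro exI[of _ "\<lambda>_. \<zero>"]) (auto simp: r_neg minus_eq)
  next
    case (Suc n)
    let ?g = "\<lambda>i. f (Suc i)"
    have fc: "\<And>i. f i \<in> carrier R" and bc: "b \<in> carrier R"
      using Suc(2) b subringE(1)[OF A] by auto
    obtain q where q: "\<And>i. q i \<in> A"
      "\<And>x. x \<in> carrier R \<Longrightarrow> peval ?g (Suc n) x = (x \<ominus> b) \<otimes> peval q n x \<oplus> peval ?g (Suc n) b"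
      "peval q n b = peval (\<lambda>i. [Suc i] \<cdot> ?g (Suc i)) n b" "0 < n \<Longrightarrow> q (n - 1) = ?g n"
      using Suc(1)[of ?g] Suc(2) by auto
    have qc: "\<And>i. q i \<in> carrier R" using q(1) subringE(1)[OF A] by auto
    define G where "G = peval ?g (Suc n) b"
    have G: "G \<in> A" unfolding G_def
      by (intro lincomb_in_subring[OF A] Suc(2)) (use b subringE[OF A] in \<open>induct_tac i; auto\<close>)
    have Gc: "G \<in> carrier R" using G subringE(1)[OF A] by auto
    \<comment> \<open>From g(x) = (x - b) q(x) + G with G = g(b) one gets f(x) - f(b) = x g(x) - b G
      = (x - b) (G + x q(x)); \<open>q'\<close> is the coefficient sequence of the last
      factor.\<close>
    define q' where "q' = (\<lambda>i. case i of 0 \<Rightarrow> G | Suc j \<Rightarrow> q j)"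
    have q'A: "\<And>i. q' i \<in> A" unfolding q'_def using q(1) G by (auto split: nat.splits)
    have q'c: "\<And>i. q' i \<in> carrier R" using q'A subringE(1)[OF A] by auto
    have q'v: "peval q' (Suc n) x = G \<oplus> x \<otimes> peval q n x" if "x \<in> carrier R" for x
      using that q'c by (subst peval_Suc) (auto simp: q'_def)
    have 1: "peval f (Suc (Suc n)) x = (x \<ominus> b) \<otimes> peval q' (Suc n) x \<oplus> peval f (Suc (Suc n)) b"
      if x: "x \<in> carrier R" for x
    proof -
      have e: "f0 \<oplus> x \<otimes> ((x \<ominus> b) \<otimes> Q \<oplus> G) = (x \<ominus> b) \<otimes> (G \<oplus> x \<otimes> Q) \<oplus> (f0 \<oplus> b \<otimes> G)"
        if "f0 \<in> carrier R" "Q \<in> carrier R" for f0 Q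
        using that x bc Gc by algebra
      show ?thesis
        unfolding q'v[OF x] peval_Suc[of f x "Suc n", OF fc x] peval_Suc[of f b "Suc n", OF fc bc] q(2)[OF x]
          G_def[symmetric]
        by (rule e) (use fc qc x in auto)
    qed
    have 2: "peval q' (Suc n) b = peval (\<lambda>i. [Suc i] \<cdot> f (Suc i)) (Suc n) b"
      unfolding q'v[OF bc] peval_derivative_Suc[of f b n, OF fc bc] G_def q(3) ..
    have 3: "q' n = f (Suc n)"
      using q(4) fc by (cases n) (auto simp: q'_def G_def)
    show ?case using 1 2 3 q'A by (intro exI[of _ q']) auto
  qed
  then show ?thesis using that by blast
qed

end

section \<open>Algebraic dependence\<close>

text \<open>\<open>A\<close> need not be a field: relations are used over polynomial rings such as
  \<open>simple_extension C \<alpha>\<close>, whose elements factor into linear forms. The bound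
  \<open>i < n\<close> makes the relation nontrivial, as values of \<open>f\<close> from
  \<open>n\<close> on do not enter it.\<close>

definition (in ring) alg_rel :: "'a set \<Rightarrow> 'a \<Rightarrow> bool" where
  "alg_rel A x \<longleftrightarrow> (\<exists>f n. (\<forall>i. f i \<in> A) \<and> (\<exists>i<n. f i \<noteq> \<zero>) \<and> peval f n x = \<zero>)"

lemma (in ring) subring_pow:
  assumes "subring A R" "x \<in> A" shows "x [^] (n::nat) \<in> A"
  using subringE[OF assms(1)] assms(2) by (induct n) auto

lemma (in ring) peval_in_subring:
  assumes "subring A R" "\<And>i. f i \<in> A" "x \<in> A" shows "peval f n x \<in> A"
  using assms subring_pow by (intro lincomb_in_subring) auto

lemma (in ring) alg_relI:
  assumes "\<And>i. f i \<in> A" "i < n" "f i \<noteq> \<zero>" "peval f n x = \<zero>"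
  shows "alg_rel A x"
  using assms unfolding alg_rel_def by blast

lemma (in ring) alg_rel_mono: "\<lbrakk> A \<subseteq> B; alg_rel A x \<rbrakk> \<Longrightarrow> alg_rel B x"
  unfolding alg_rel_def by blast

lemma (in ring) coeff_map_rev: "i < n \<Longrightarrow> coeff (map f (rev [0..<n])) i = f i"
  by (subst coeff_nth) (auto simp: rev_nth)

text \<open>This gives access to the library results on finite dimension and algebraic
  elements.\<close>

lemma (in domain) alg_rel_iff_algebraic:
  assumes A: "subring A R" and x: "x \<in> carrier R"
  shows "alg_rel A x \<longleftrightarrow> (algebraic over A) x"
proof
  assume "alg_rel A x"
  then obtain f n i where f: "\<And>i. f i \<in> A" and i: "i < n" "f i \<noteq> \<zero>" and e: "peval f n x = \<zero>"
    unfolding alg_rel_def by blast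
  have fc: "\<And>i. f i \<in> carrier R" using f subringE(1)[OF A] by auto
  let ?p = "map f (rev [0..<n])"
  have "normalize ?p \<in> carrier (A[X])"
    using normalize_gives_polynomial[of ?p A] f by (auto simp: univ_poly_def)
  moreover have "normalize ?p \<noteq> []"
  proof
    assume "normalize ?p = []"
    then have "coeff ?p i = \<zero>" using normalize_coeff[of ?p] by simp
    then show False using i coeff_map_rev by simp
  qed
  moreover have "eval (normalize ?p) x = \<zero>"
    using eval_normalize[of ?p x] eval_map_rev[of f x n] fc x e by auto
  ultimately show "(algebraic over A) x" by (rule algebraicI)
next
  assume "(algebraic over A) x"
  then obtain p where p: "p \<in> carrier (A[X])" "p \<noteq> []" "eval p x = \<zero>"
    using algebraicE[OF A x] by blast
  have pA: "set p \<subseteq> A" "lead_coeff p \<noteq> \<zero>" using p(1,2) by (auto simp: univ_poly_def polynomial_def)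
  have "coeff p i \<in> A" for i
    using coeff_img_restrict[of p] coeff_length[of p i] pA(1) subringE(2)[OF A]
    by (cases "i < length p") auto
  moreover have "coeff p (degree p) \<noteq> \<zero>" unfolding lead_coeff_simp[OF p(2)] by (rule pA(2))
  moreover have "peval (coeff p) (length p) x = \<zero>"
    using eval_eq_peval[of p x] pA(1) subringE(1)[OF A] x p(3) by auto
  ultimately show "alg_rel A x" using p(2) by (intro alg_relI[where i="degree p"]) auto
qed

section \<open>Maximal subrings and transcendence degree one\<close>

lemma (in ring) exists_maximal_subring:
  assumes "subring A R" "A \<subseteq> K" "Q A"
    and "\<And>C. \<lbrakk> C \<noteq> {}; subset.chain {B. subring B R \<and> A \<subseteq> B \<and> B \<subseteq> K \<and> Q B} C \<rbrakk> \<Longrightarrow> Q (\<Union>C)"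
  obtains D where "subring D R" "A \<subseteq> D" "D \<subseteq> K" "Q D"
    "\<And>B. \<lbrakk> subring B R; D \<subset> B; B \<subseteq> K \<rbrakk> \<Longrightarrow> \<not> Q B"
proof -
  define S where "S = {B. subring B R \<and> A \<subseteq> B \<and> B \<subseteq> K \<and> Q B}"
  have "\<exists>M\<in>S. \<forall>B\<in>S. M \<subseteq> B \<longrightarrow> B = M"
  proof (rule subset_Zorn_nonempty)
    show "S \<noteq> {}" using assms by (auto simp: S_def)
    fix C assume C: "C \<noteq> {}" "subset.chain S C"
    have mem: "\<And>B. B \<in> C \<Longrightarrow> B \<in> S" using C(2) unfolding subset.chain_def by auto
    have sub: "\<And>B. B \<in> C \<Longrightarrow> subring B R" using mem S_def by auto
    have two: "\<exists>B\<in>C. x \<in> B \<and> y \<in> B" if "x \<in> \<Union>C" "y \<in> \<Union>C" for x y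
    proof -
      obtain B1 B2 where B: "B1 \<in> C" "x \<in> B1" "B2 \<in> C" "y \<in> B2" using \<open>x \<in> \<Union>C\<close> \<open>y \<in> \<Union>C\<close> by blast
      have "B1 \<subseteq> B2 \<or> B2 \<subseteq> B1" using C(2) B(1,3) unfolding subset_chain_def by blast
      then show ?thesis using B by blast
    qed
    have "subring (\<Union>C) R"
    proof (rule subringI)
      show "\<Union>C \<subseteq> carrier R" using subringE(1)[OF sub] by blast
      show "\<one> \<in> \<Union>C" using C(1) subringE(3)[OF sub] by blast
      fix h assume "h \<in> \<Union>C" then show "\<ominus> h \<in> \<Union>C" using subringE(5)[OF sub] by blast
    next
      fix x y assume "x \<in> \<Union>C" "y \<in> \<Union>C"
      then obtain B where B: "B \<in> C" "x \<in> B" "y \<in> B" using two by blast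
      then have "subring B R" using sub by blast
      from subringE(6)[OF this, of x y] subringE(7)[OF this, of x y] B show "x \<otimes> y \<in> \<Union>C" "x \<oplus> y \<in> \<Union>C" by blast+
    qed
    moreover have "A \<subseteq> \<Union>C" using C(1) mem unfolding S_def by blast
    moreover have "\<Union>C \<subseteq> K" using mem[unfolded S_def] by blast
    ultimately show "\<Union>C \<in> S" using assms(4)[OF C[unfolded S_def]] unfolding S_def by blast
  qed
  then obtain M where M: "M \<in> S" "\<And>B. B \<in> S \<Longrightarrow> M \<subseteq> B \<Longrightarrow> B = M" by blast
  have "\<not> Q B" if "subring B R" "M \<subset> B" "B \<subseteq> K" for B
    using M(1) M(2)[of B] that unfolding S_def by blast
  then show ?thesis using that M(1) unfolding S_def by blast
qed

text \<open>A relation has finitely many coefficients, so over the union of a chain it already holds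
  over a member, and Zorn's lemma applies. For \<open>t\<close> in \<open>K\<close>, the maximal
  \<open>D\<close> takes the place of a transcendence basis with \<open>t\<close> removed:
  \<open>K\<close> has transcendence degree one over it.\<close>

lemma (in ring) exists_maximal_transcendental_subring:
  assumes "subring A R" "A \<subseteq> K" "\<not> alg_rel A t"
  obtains D where "subring D R" "A \<subseteq> D" "D \<subseteq> K" "\<not> alg_rel D t"
    "\<And>B. \<lbrakk> subring B R; D \<subset> B; B \<subseteq> K \<rbrakk> \<Longrightarrow> alg_rel B t"
proof (rule exists_maximal_subring[of A K "\<lambda>B. \<not> alg_rel B t"])
  fix C assume C: "C \<noteq> {}"
    and ch: "subset.chain {B. subring B R \<and> A \<subseteq> B \<and> B \<subseteq> K \<and> \<not> alg_rel B t} C"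
  show "\<not> alg_rel (\<Union>C) t"
  proof
    assume "alg_rel (\<Union>C) t"
    then obtain f n i where f: "\<And>i. f i \<in> \<Union>C" and i: "i < n" "f i \<noteq> \<zero>" and e: "peval f n t = \<zero>"
      unfolding alg_rel_def by blast
    obtain B where B: "B \<in> C" "f ` {..<n} \<subseteq> B"
      using finite_subset_Union_chain[OF _ _ C ch, of "f ` {..<n}"] f by blast
    have BS: "subring B R" "\<not> alg_rel B t" using B(1) ch unfolding subset.chain_def by auto
    \<comment> \<open>Only the coefficients that enter the sum are known to lie in
      \<open>B\<close>.\<close>
    let ?g = "\<lambda>i. if i < n then f i else \<zero>"
    have "peval ?g n t = peval f n t" by (rule lincomb_cong) auto
    then have "alg_rel B t"
      using i e B(2) subringE(2)[OF BS(1)] by (intro alg_relI[of ?g B i n]) auto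
    then show False using BS(2) by blast
  qed
qed (use assms that in auto)

context field
begin

lemma field_inv:
  assumes "a \<in> carrier R" "a \<noteq> \<zero>"
  shows "inv a \<in> carrier R" "inv a \<noteq> \<zero>" "a \<otimes> inv a = \<one>" "inv a \<otimes> a = \<one>"
proof -
  have u: "a \<in> Units R" using assms field_Units by auto
  show 1: "inv a \<in> carrier R" and 2: "a \<otimes> inv a = \<one>" and "inv a \<otimes> a = \<one>" using u by auto
  show "inv a \<noteq> \<zero>"
  proof
    assume "inv a = \<zero>"
    then show False using 2 assms by simp
  qed
qed

lemma nat_pow_nonzero:
  assumes "a \<in> carrier R" "a \<noteq> \<zero>" shows "a [^] (n::nat) \<noteq> \<zero>"
proof (induct n)
  case (Suc n)
  show ?case
  proof
    assume "a [^] Suc n = \<zero>"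
    then have "a [^] n \<otimes> a = \<zero>" by simp
    then have "a [^] n = \<zero> \<or> a = \<zero>" using assms by (intro integral) auto
    then show False using assms Suc by blast
  qed
qed simp

lemma inv_unique_nonzero:
  assumes "a \<in> carrier R" "b \<in> carrier R" "a \<otimes> b = \<one>" shows "inv a = b"
  by (rule comm_inv_char[OF assms])

text \<open>Elements of A[1/c] are built by Horner's scheme, and each step costs one more factor
  \<open>c\<close>.\<close>

lemma simple_extension_inv_denominator:
  assumes A: "subring A R" and c: "c \<in> A" "c \<noteq> \<zero>" and z: "z \<in> simple_extension A (inv c)"
  shows "\<exists>N. c [^] (N::nat) \<otimes> z \<in> A"
  using z
proof (induct rule: simple_extension.induct)
  case zero
  then show ?case using subringE(1,2)[OF A] c by (intro exI[of _ 0]) auto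
next
  case (lin k1 k2)
  then obtain N :: nat where N: "c [^] N \<otimes> k1 \<in> A" by blast
  have cc: "c \<in> carrier R" "k2 \<in> carrier R" using c lin subringE(1)[OF A] by auto
  have k1: "k1 \<in> carrier R"
    using lin(1) simple_extension_in_carrier[OF subringE(1)[OF A]] field_inv[OF cc(1) c(2)] by blast
  have "c [^] (Suc N) \<otimes> (k1 \<otimes> inv c \<oplus> k2) = (c \<otimes> inv c) \<otimes> (c [^] N \<otimes> k1) \<oplus> c [^] (Suc N) \<otimes> k2"
  proof -
    have "(P \<otimes> c) \<otimes> (k1 \<otimes> d \<oplus> k2) = (c \<otimes> d) \<otimes> (P \<otimes> k1) \<oplus> (P \<otimes> c) \<otimes> k2"
      if "P \<in> carrier R" "d \<in> carrier R" for P d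
      using that cc k1 by algebra
    then show ?thesis using cc field_inv(1)[OF cc(1) c(2)] by simp
  qed
  also have "\<dots> = (c [^] N \<otimes> k1) \<oplus> c [^] (Suc N) \<otimes> k2"
    using cc k1 field_inv[OF cc(1) c(2)] by simp
  also have "\<dots> \<in> A" using N subringE(6,7)[OF A] subring_pow[OF A c(1), of "Suc N"] lin by simp
  finally show ?case by blast
qed

lemma clear_denominators:
  fixes f :: "nat \<Rightarrow> 'a"
  assumes A: "subring A R" and c: "c \<in> A" and f: "\<And>i. f i \<in> carrier R" "\<And>i. \<exists>N. c [^] (N::nat) \<otimes> f i \<in> A"
  shows "\<exists>N. \<forall>i<n. c [^] (N::nat) \<otimes> f i \<in> A"
proof (induct n)
  case (Suc n)
  then obtain N where N: "\<forall>i<n. c [^] (N::nat) \<otimes> f i \<in> A" by blast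
  obtain M where M: "c [^] (M::nat) \<otimes> f n \<in> A" using f by blast
  have cc: "c \<in> carrier R" using c subringE(1)[OF A] by auto
  have "c [^] (M + N) \<otimes> f i \<in> A" if "i < Suc n" for i
  proof (cases "i = n")
    case True
    have "c [^] (M + N) = c [^] N \<otimes> c [^] M" using cc by (simp add: nat_pow_mult add.commute)
    then have "c [^] (M + N) \<otimes> f i = c [^] N \<otimes> (c [^] M \<otimes> f i)"
      using cc f(1) by (simp add: m_assoc)
    then show ?thesis using M True subring_pow[OF A c] subringE(6)[OF A] by simp
  next
    case False
    have "c [^] (M + N) = c [^] M \<otimes> c [^] N" using cc by (simp add: nat_pow_mult)
    then have "c [^] (M + N) \<otimes> f i = c [^] M \<otimes> (c [^] N \<otimes> f i)"
      using cc f(1) by (simp add: m_assoc)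
    then show ?thesis using N that False subring_pow[OF A c] subringE(6)[OF A] by simp
  qed
  then show ?case by blast
qed simp

text \<open>Denominators can be cleared, so inverting an element of \<open>A\<close> creates no new
  relations; this is what forces a maximal \<open>D\<close> to be closed under inverses.\<close>

lemma alg_rel_simple_extension_inv:
  assumes A: "subring A R" and c: "c \<in> A" "c \<noteq> \<zero>" and t: "t \<in> carrier R"
    and "alg_rel (simple_extension A (inv c)) t"
  shows "alg_rel A t"
proof -
  obtain f n i where f: "\<And>i. f i \<in> simple_extension A (inv c)" and i: "i < n" "f i \<noteq> \<zero>"
    and e: "peval f n t = \<zero>"
    using assms(5) unfolding alg_rel_def by blast
  have cc: "c \<in> carrier R" using c subringE(1)[OF A] by auto
  have fc: "\<And>i. f i \<in> carrier R"
    using f simple_extension_in_carrier[OF subringE(1)[OF A]] field_inv[OF cc c(2)] by blast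
  have "\<And>i. \<exists>N. c [^] (N::nat) \<otimes> f i \<in> A"
    by (rule simple_extension_inv_denominator[OF A c f])
  from clear_denominators[of A c f n, OF A c(1) fc this]
  obtain N where N: "\<forall>i<n. c [^] (N::nat) \<otimes> f i \<in> A" by blast
  let ?g = "\<lambda>i. if i < n then c [^] N \<otimes> f i else \<zero>"
  have "peval ?g n t = peval (\<lambda>i. c [^] N \<otimes> f i) n t" by (rule lincomb_cong) auto
  also have "\<dots> = \<zero>" using e cc fc t by (simp add: lincomb_smult)
  finally have "peval ?g n t = \<zero>" .
  moreover have "c [^] N \<otimes> f i \<noteq> \<zero>"
    using integral[of "c [^] N" "f i"] nat_pow_nonzero[OF cc c(2), of N] cc fc[of i] i(2) by blast
  then have "?g i \<noteq> \<zero>" using i(1) by simp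
  moreover have "\<And>i. ?g i \<in> A" using N subringE(2)[OF A] by simp
  ultimately show ?thesis using i(1) by (intro alg_relI[of ?g A i n])
qed

text \<open>The maximality makes \<open>D\<close> behave like a field over which the transcendence degree is one.\<close>

lemma maximal_transcendental_subfield:
  assumes D: "subring D R" "D \<subseteq> K" and K: "subfield K R" and t: "t \<in> carrier R" "\<not> alg_rel D t"
    and max: "\<And>B. \<lbrakk> subring B R; D \<subset> B; B \<subseteq> K \<rbrakk> \<Longrightarrow> alg_rel B t"
  shows "subfield D R"
proof (rule subfieldI'[OF D(1)])
  fix c assume c: "c \<in> D - {\<zero>}"
  have cc: "c \<in> carrier R" using c subringE(1)[OF D(1)] by auto
  have ic: "inv c \<in> K" using subfield_m_inv[OF K, of c] c D(2) by auto
  let ?B = "simple_extension D (inv c)"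
  have B: "subring ?B R" "D \<subseteq> ?B" "inv c \<in> ?B"
    using simple_extension_is_subring[OF D(1)] simple_extension_incl[OF subringE(1)[OF D(1)]]
      simple_extension_mem[OF D(1)] field_inv[OF cc] c by auto
  have BK: "?B \<subseteq> K" using simple_extension_subring_incl[OF subfieldE(1)[OF K] D(2) ic] .
  show "inv c \<in> D"
  proof (rule ccontr)
    assume "inv c \<notin> D"
    then have "alg_rel ?B t" using max[OF B(1)] B(2,3) BK by blast
    then show False using alg_rel_simple_extension_inv[OF D(1)] c t by blast
  qed
qed

text \<open>If \<open>y\<close> were outside \<open>D\<close>, then by maximality \<open>t\<close>
  would be algebraic over D(y), which is finite over \<open>D\<close>, and hence over
  \<open>D\<close> itself.\<close>

lemma maximal_transcendental_closed:
  assumes D: "subfield D R" "D \<subseteq> K" and K: "subfield K R" and t: "t \<in> carrier R" "\<not> alg_rel D t"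
    and max: "\<And>B. \<lbrakk> subring B R; D \<subset> B; B \<subseteq> K \<rbrakk> \<Longrightarrow> alg_rel B t"
    and y: "y \<in> K" "alg_rel D y"
  shows "y \<in> D"
proof (rule ccontr)
  assume yD: "y \<notin> D"
  have yc: "y \<in> carrier R" using y K subfieldE(3) by blast
  note Dr = subfieldE(1)[OF D(1)]
  have ya: "(algebraic over D) y" using alg_rel_iff_algebraic[OF Dr yc] y by simp
  let ?B = "simple_extension D y"
  have B: "subfield ?B R" using simple_extension_is_subfield[OF D(1) yc] ya by simp
  have "?B \<subseteq> K" using simple_extension_subring_incl[OF subfieldE(1)[OF K] D(2) y(1)] .
  moreover have "D \<subseteq> ?B" "y \<in> ?B"
    using simple_extension_incl[OF subringE(1)[OF Dr] yc] simple_extension_mem[OF Dr yc] by auto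
  ultimately have "alg_rel ?B t" using max[OF subfieldE(1)[OF B]] yD by blast
  then have ta: "(algebraic over ?B) t" using alg_rel_iff_algebraic[OF subfieldE(1)[OF B] t(1)] by simp
  have fd: "finite_dimension ?B (simple_extension ?B t)"
    using finite_dimension_simple_extension[OF B t(1)] ta by simp
  have fd0: "finite_dimension D ?B" using finite_dimension_simple_extension[OF D(1) yc] ya by simp
  have "finite_dimension D (simple_extension ?B t)"
    using telescopic_base_dim(1)[OF D(1) B fd0 fd] .
  then have "(algebraic over D) t"
    using finite_dimension_imp_algebraic[OF D(1) simple_extension_is_subring[OF subfieldE(1)[OF B] t(1)]]
      simple_extension_mem[OF subfieldE(1)[OF B] t(1)] by blast
  then show False using alg_rel_iff_algebraic[OF Dr t(1)] t(2) by simp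
qed

lemma simple_extension_imp_peval:
  assumes A: "subring A R" "x \<in> carrier R" and y: "y \<in> simple_extension A x"
  obtains f n where "\<And>i. f i \<in> A" "y = peval f n x"
proof -
  have "\<exists>f n. (\<forall>i. f i \<in> A) \<and> y = peval f n x"
    using y
  proof (induct rule: simple_extension.induct)
    case zero
    show ?case using subringE(2)[OF A(1)] by (intro exI[of _ "\<lambda>_. \<zero>"] exI[of _ 0]) auto
  next
    case (lin k1 k2)
    then obtain f n where f: "\<forall>i. f i \<in> A" "k1 = peval f n x" by blast
    let ?g = "\<lambda>i. case i of 0 \<Rightarrow> k2 | Suc j \<Rightarrow> f j"
    have g: "\<forall>i. ?g i \<in> A" using f lin by (auto split: nat.splits)
    have gc: "\<And>i. ?g i \<in> carrier R" using g subringE(1)[OF A(1)] by blast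
    have "peval ?g (Suc n) x = k2 \<oplus> x \<otimes> peval f n x"
      using peval_Suc[of ?g x n, OF gc A(2)] by simp
    also have "\<dots> = k1 \<otimes> x \<oplus> k2"
      using f lin A subringE(1)[OF A(1)] by (subst a_comm) (auto simp: m_comm subset_iff)
    finally show ?case using g by metis
  qed
  then show ?thesis using that by blast
qed

lemma peval_in_simple_extension:
  assumes A: "subring A R" "x \<in> carrier R" "\<And>i. f i \<in> A"
  shows "peval f n x \<in> simple_extension A x"
  using peval_in_subring[OF simple_extension_is_subring[OF A(1,2)]] A
    simple_extension_incl[OF subringE(1)[OF A(1)] A(2)] simple_extension_mem[OF A(1,2)]
  by blast

text \<open>Steinitz exchange at the level of relations: a relation for \<open>t\<close> over D[y]
  is a polynomial in two variables over \<open>D\<close>, and ordering it by powers of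
  \<open>y\<close> gives coefficients in D[t].\<close>

lemma maximal_transcendental_exchange:
  assumes D: "subring D R" "D \<subseteq> K" and K: "subfield K R" and t: "t \<in> carrier R" "\<not> alg_rel D t"
    and max: "\<And>B. \<lbrakk> subring B R; D \<subset> B; B \<subseteq> K \<rbrakk> \<Longrightarrow> alg_rel B t"
    and y: "y \<in> K"
  shows "alg_rel (simple_extension D t) y"
proof (cases "y \<in> D")
  case True
  have yc: "y \<in> carrier R" using y K subfieldE(3) by blast
  let ?f = "\<lambda>i::nat. if i = 0 then \<ominus> y else \<one>"
  have "peval ?f 2 y = \<zero>" using yc by (simp add: numeral_2_eq_2 l_neg)
  moreover have "\<And>i. ?f i \<in> simple_extension D t"
    using True subringE(3,5)[OF D(1)] simple_extension_incl[OF subringE(1)[OF D(1)] t(1)] by auto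
  ultimately show ?thesis by (intro alg_relI[of ?f _ 1 2]) auto
next
  case False
  have yc: "y \<in> carrier R" using y K subfieldE(3) by blast
  let ?B = "simple_extension D y"
  have B: "subring ?B R" using simple_extension_is_subring[OF D(1) yc] .
  have "?B \<subseteq> K" using simple_extension_subring_incl[OF subfieldE(1)[OF K] D(2) y(1)] .
  moreover have "D \<subseteq> ?B" "y \<in> ?B"
    using simple_extension_incl[OF subringE(1)[OF D(1)] yc] simple_extension_mem[OF D(1) yc] by auto
  ultimately have "alg_rel ?B t" using max[OF B] False by blast
  then obtain f n i where f: "\<And>i. f i \<in> ?B" and i: "i < n" "f i \<noteq> \<zero>" and e: "peval f n t = \<zero>"
    unfolding alg_rel_def by blast
  have "\<forall>i. \<exists>c m. (\<forall>j. c j \<in> D) \<and> f i = peval c m y"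
    using simple_extension_imp_peval[OF D(1) yc f] by metis
  then obtain c m where c: "\<And>i j. c i j \<in> D" "\<And>i. f i = peval (c i) (m i) y" by metis
  have cc: "\<And>i j. c i j \<in> carrier R" using c(1) subringE(1)[OF D(1)] by blast
  \<comment> \<open>A common length for all coefficients, so that the double sum is
    rectangular.\<close>
  define M where "M = Max (m ` {..<n})"
  define c' where "c' = (\<lambda>i j. if j < m i then c i j else \<zero>)"
  have c'D: "\<And>i j. c' i j \<in> D" using c(1) subringE(2)[OF D(1)] unfolding c'_def by auto
  have c'c: "\<And>i j. c' i j \<in> carrier R" using c'D subringE(1)[OF D(1)] by blast
  have fM: "f i = peval (c' i) M y" if "i < n" for i
  proof -
    have "m i \<le> M" unfolding M_def using that by (intro Max_ge) auto
    then have "peval (c' i) M y = peval (c' i) (m i) y"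
      using c'c yc by (intro lincomb_extend) (auto simp: c'_def)
    also have "\<dots> = f i" unfolding c(2) by (rule lincomb_cong) (auto simp: c'_def)
    finally show ?thesis ..
  qed
  let ?h = "\<lambda>j. peval (\<lambda>i. c' i j) n t"
  have "\<zero> = peval (\<lambda>i. peval (c' i) M y) n t"
    unfolding e[symmetric] by (rule lincomb_cong) (auto simp: fM)
  also have "\<dots> = peval ?h M y"
    using c'c yc t(1) by (intro lincomb_swap) (auto simp: m_comm)
  finally have 1: "peval ?h M y = \<zero>" ..
  have "\<exists>j<M. c' i j \<noteq> \<zero>"
  proof (rule ccontr)
    assume "\<not> ?thesis"
    then have "peval (c' i) M y = \<zero>" using yc by (intro lincomb_zero) auto
    then show False using fM[OF i(1)] i(2) by simp
  qed
  then obtain j where j: "j < M" "c' i j \<noteq> \<zero>" by blast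
  \<comment> \<open>This is a polynomial in \<open>t\<close> over \<open>D\<close> with the nonzero
    coefficient \<open>c' i j\<close>; transcendence of \<open>t\<close> keeps it from
    vanishing.\<close>
  have "?h j \<noteq> \<zero>" using t(2) alg_relI[of "\<lambda>i. c' i j" D i n t, OF c'D i(1) j(2)] by metis
  moreover have "\<And>j. ?h j \<in> simple_extension D t"
    by (rule peval_in_simple_extension[OF D(1) t(1) c'D])
  ultimately show ?thesis using 1 j(1) by (intro alg_relI[of ?h _ j M])
qed

end

section \<open>Valuation rings\<close>

lemma (in algebraically_closed) exists_peval_root:
  assumes f: "\<And>i. f i \<in> carrier L" and n: "f n \<noteq> \<zero>" "0 < n"
  obtains b where "b \<in> carrier L" "peval f (Suc n) b = \<zero>"
proof -
  let ?p = "map f (rev [0..<Suc n])"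
  have "polynomial (carrier L) ?p" using f n by (intro polynomialI) auto
  then have p: "?p \<in> carrier (poly_ring L)" by (simp only: univ_poly_carrier)
  have "size (roots ?p) = n" using roots_over_carrier[OF p] by (simp add: splitted_def)
  then obtain b where "b \<in># roots ?p" using n(2) by (metis multiset_nonemptyE size_empty less_irrefl)
  then have "is_root ?p b" using roots_mem_iff_is_root[OF p] by simp
  then have "b \<in> carrier L" "eval ?p b = \<zero>" unfolding is_root_def by auto
  then show ?thesis using that eval_map_rev[of f b "Suc n", OF f] by metis
qed

context field
begin

definition valuation_ring :: "'a set \<Rightarrow> bool" where
  "valuation_ring V \<longleftrightarrow> subring V R \<and> (\<forall>x\<in>carrier R. x \<noteq> \<zero> \<longrightarrow> x \<in> V \<or> inv x \<in> V)"

definition vunit :: "'a set \<Rightarrow> 'a \<Rightarrow> bool" where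
  "vunit V u \<longleftrightarrow> u \<in> V \<and> u \<noteq> \<zero> \<and> inv u \<in> V"

text \<open>The maximal ideal, when \<open>V\<close> is a valuation ring. No value group is formed;
  orders of vanishing are expressed by powers of a single element.\<close>

definition small :: "'a set \<Rightarrow> 'a \<Rightarrow> bool" where
  "small V x \<longleftrightarrow> x \<in> V \<and> \<not> vunit V x"

lemma inv_mult_nonzero:
  assumes "a \<in> carrier R" "a \<noteq> \<zero>" "b \<in> carrier R" "b \<noteq> \<zero>"
  shows "inv (a \<otimes> b) = inv a \<otimes> inv b"
proof (rule inv_unique_nonzero)
  have "(a \<otimes> b) \<otimes> (inv a \<otimes> inv b) = (a \<otimes> inv a) \<otimes> (b \<otimes> inv b)"
    using assms field_inv(1)[OF assms(1,2)] field_inv(1)[OF assms(3,4)] by (simp add: m_ac)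
  then show "(a \<otimes> b) \<otimes> (inv a \<otimes> inv b) = \<one>"
    using field_inv(3)[OF assms(1,2)] field_inv(3)[OF assms(3,4)] by simp
qed (use assms field_inv in auto)

lemma inv_inv_nonzero: "\<lbrakk> a \<in> carrier R; a \<noteq> \<zero> \<rbrakk> \<Longrightarrow> inv (inv a) = a"
  using field_inv by (intro inv_unique_nonzero) auto

lemma integral': "\<lbrakk> a \<in> carrier R; a \<noteq> \<zero>; b \<in> carrier R; b \<noteq> \<zero> \<rbrakk> \<Longrightarrow> a \<otimes> b \<noteq> \<zero>"
  using integral by blast

lemma vunit_one: "subring V R \<Longrightarrow> vunit V \<one>"
  using subringE(3)[of V R] by (auto simp: vunit_def)

lemma vunit_mult:
  assumes "subring V R" "vunit V a" "vunit V b" shows "vunit V (a \<otimes> b)"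
proof -
  have c: "a \<in> carrier R" "b \<in> carrier R" using assms subringE(1)[OF assms(1)] by (auto simp: vunit_def)
  then show ?thesis using assms subringE(6)[OF assms(1)] inv_mult_nonzero[of a b] integral'[of a b]
    by (auto simp: vunit_def)
qed

lemma vunit_inv:
  assumes "subring V R" "vunit V a" shows "vunit V (inv a)"
  using assms subringE(1)[OF assms(1)] field_inv[of a] inv_inv_nonzero[of a] by (auto simp: vunit_def)

lemma vunit_pow: "\<lbrakk> subring V R; vunit V a \<rbrakk> \<Longrightarrow> vunit V (a [^] (n::nat))"
  by (induct n) (auto intro: vunit_one vunit_mult)

lemma vunit_factor:
  assumes "subring V R" "vunit V (a \<otimes> b)" "a \<in> V" "b \<in> V" shows "vunit V a"
proof -
  have c: "a \<in> carrier R" "b \<in> carrier R" using assms subringE(1)[OF assms(1)] by auto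
  have ab: "a \<otimes> b \<noteq> \<zero>" "inv (a \<otimes> b) \<in> V" using assms(2) by (auto simp: vunit_def)
  have a: "a \<noteq> \<zero>" using ab c by auto
  have "a \<otimes> (b \<otimes> inv (a \<otimes> b)) = (a \<otimes> b) \<otimes> inv (a \<otimes> b)"
    using c field_inv(1)[of "a \<otimes> b"] ab by (simp add: m_assoc)
  also have "\<dots> = \<one>" using field_inv(3)[of "a \<otimes> b"] ab c by simp
  finally have "inv a = b \<otimes> inv (a \<otimes> b)"
    using c field_inv(1)[of "a \<otimes> b"] ab by (intro inv_unique_nonzero) auto
  then show ?thesis using assms a ab subringE(6)[OF assms(1)] by (auto simp: vunit_def)
qed

lemma small_zero: "subring V R \<Longrightarrow> small V \<zero>"
  using subringE(2)[of V R] by (auto simp: small_def vunit_def)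

lemma small_mult:
  assumes "subring V R" "small V x" "y \<in> V" shows "small V (x \<otimes> y)"
  using assms vunit_factor[OF assms(1), of x y] subringE(6)[OF assms(1)] by (auto simp: small_def)

lemma small_minus:
  assumes "subring V R" "small V x" shows "small V (\<ominus> x)"
proof -
  have "x \<in> carrier R" using assms subringE(1)[OF assms(1)] by (auto simp: small_def)
  then have "\<ominus> x = x \<otimes> \<ominus> \<one>" by (simp add: r_minus)
  then show ?thesis using small_mult[OF assms, of "\<ominus> \<one>"] subringE(3,5)[OF assms(1)] by simp
qed

lemma small_add_aux:
  assumes V: "subring V R" and x: "small V x" "x \<noteq> \<zero>" and y: "y \<in> V" and q: "y \<otimes> inv x \<in> V"
  shows "small V (x \<oplus> y)"
proof -
  have c: "x \<in> carrier R" "y \<in> carrier R" using x y subringE(1)[OF V] by (auto simp: small_def)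
  note i = field_inv[OF c(1) x(2)]
  have "x \<otimes> (\<one> \<oplus> y \<otimes> inv x) = x \<oplus> (x \<otimes> inv x) \<otimes> y"
    using c i(1) by algebra
  then have "x \<oplus> y = x \<otimes> (\<one> \<oplus> y \<otimes> inv x)" using c i(3) by simp
  then show ?thesis using small_mult[OF V x(1), of "\<one> \<oplus> y \<otimes> inv x"] q subringE(3,7)[OF V] by simp
qed

text \<open>One of y/x and x/y lies in \<open>V\<close>, and x + y = x (1 + y/x); this is where the
  dichotomy of valuation rings enters.\<close>

lemma small_add:
  assumes V: "valuation_ring V" and x: "small V x" and y: "small V y" shows "small V (x \<oplus> y)"
proof -
  have S: "subring V R" using V by (simp add: valuation_ring_def)
  have c: "x \<in> carrier R" "y \<in> carrier R" "x \<in> V" "y \<in> V"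
    using x y subringE(1)[OF S] by (auto simp: small_def)
  show ?thesis
  proof (cases "x = \<zero> \<or> y = \<zero>")
    case True
    then show ?thesis using c x y by auto
  next
    case False
    then have q: "y \<otimes> inv x \<noteq> \<zero>" "y \<otimes> inv x \<in> carrier R"
      using c field_inv[of x] integral'[of y "inv x"] by auto
    have "inv (y \<otimes> inv x) = inv y \<otimes> inv (inv x)" using c False field_inv[of x] by (intro inv_mult_nonzero) auto
    also have "\<dots> = x \<otimes> inv y" using c False field_inv[of y] inv_inv_nonzero[of x] by (simp add: m_comm)
    finally have "y \<otimes> inv x \<in> V \<or> x \<otimes> inv y \<in> V" using V q unfolding valuation_ring_def by metis
    then show ?thesis
      using small_add_aux[OF S x _ c(4)] small_add_aux[OF S y _ c(3)] False a_comm[OF c(1,2)] by auto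
  qed
qed

lemma small_diff:
  assumes "valuation_ring V" "small V x" "small V y" shows "small V (x \<ominus> y)"
  using small_add[OF assms(1,2) small_minus[OF _ assms(3)]] assms(1)
  by (simp add: valuation_ring_def minus_eq)

lemma small_lincomb:
  assumes V: "valuation_ring V" and "\<And>i. small V (f i)" "\<And>i. u i \<in> V"
  shows "small V (lincomb f u n)"
proof -
  have S: "subring V R" using V by (simp add: valuation_ring_def)
  show ?thesis
    by (induct n) (auto intro!: small_zero[OF S] small_add[OF V] small_mult[OF S] assms(2,3))
qed

lemma vunit_add_small:
  assumes V: "valuation_ring V" and u: "vunit V u" and x: "small V x"
  shows "vunit V (u \<oplus> x)"
proof (rule ccontr)
  have S: "subring V R" using V by (simp add: valuation_ring_def)
  have m: "u \<in> V" "x \<in> V" using u x by (auto simp: vunit_def small_def)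
  assume "\<not> ?thesis"
  then have "small V (u \<oplus> x)" using m subringE(7)[OF S] by (auto simp: small_def)
  from small_diff[OF V this x] have "small V u"
    using m subringE(1)[OF S] by (simp add: minus_eq a_assoc r_neg subset_iff)
  then show False using u by (simp add: small_def)
qed

lemma not_in_valuation_ring_imp_small_inv:
  assumes V: "valuation_ring V" and y: "y \<in> carrier R" "y \<notin> V"
  shows "y \<noteq> \<zero>" "small V (inv y)"
proof -
  show 1: "y \<noteq> \<zero>" using y subringE(2)[of V R] V by (auto simp: valuation_ring_def)
  show "small V (inv y)"
    using V y 1 inv_inv_nonzero[OF y(1) 1] by (auto simp: valuation_ring_def small_def vunit_def)
qed

text \<open>For \<open>y\<close> outside \<open>V\<close> the inverse \<open>z\<close> lies in the
  maximal ideal. Multiplying the relation by z^n turns every term but the leading coefficient into a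
  multiple of \<open>z\<close>, so that coefficient could not be a unit.\<close>

lemma valuation_ring_integrally_closed:
  assumes V: "valuation_ring V" and f: "\<And>i. f i \<in> V" and fn: "vunit V (f n)"
    and y: "y \<in> carrier R" "peval f (Suc n) y = \<zero>"
  shows "y \<in> V"
proof (rule ccontr)
  assume "y \<notin> V"
  note w = not_in_valuation_ring_imp_small_inv[OF V y(1) this]
  have S: "subring V R" using V by (simp add: valuation_ring_def)
  note SE = subringE[OF S]
  define z where "z = inv y"
  have z: "z \<in> V" "z \<in> carrier R" "y \<otimes> z = \<one>" "small V z"
    using w field_inv[OF y(1) w(1)] by (auto simp: small_def z_def)
  have fc: "\<And>i. f i \<in> carrier R" using f SE(1) by blast
  have yz: "y [^] m \<otimes> z [^] m = \<one>" for m :: nat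
    using nat_pow_distrib[of y z m] z y by simp
  have "\<exists>s\<in>V. peval f m y \<otimes> z [^] m = s \<otimes> z" for m
  proof (induct m)
    case 0
    show ?case using SE(2) z by (intro bexI[of _ \<zero>]) auto
  next
    case (Suc m)
    then obtain s where s: "s \<in> V" "peval f m y \<otimes> z [^] m = s \<otimes> z" by blast
    have e: "(p \<oplus> q \<otimes> Y) \<otimes> (Z \<otimes> z) = (p \<otimes> Z \<oplus> q \<otimes> (Y \<otimes> Z)) \<otimes> z"
      if "p \<in> carrier R" "q \<in> carrier R" "Y \<in> carrier R" "Z \<in> carrier R" for p q Y Z
      using that z by algebra
    have "peval f (Suc m) y \<otimes> z [^] Suc m = (peval f m y \<oplus> f m \<otimes> y [^] m) \<otimes> (z [^] m \<otimes> z)"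
      by simp
    also have "\<dots> = (peval f m y \<otimes> z [^] m \<oplus> f m \<otimes> (y [^] m \<otimes> z [^] m)) \<otimes> z"
      using fc y z by (intro e) auto
    also have "\<dots> = (s \<otimes> z \<oplus> f m) \<otimes> z" using s yz fc by simp
    finally show ?case using s(1) z(1) f SE(6,7) by (intro bexI[of _ "s \<otimes> z \<oplus> f m"]) auto
  qed
  then obtain s where s: "s \<in> V" "peval f n y \<otimes> z [^] n = s \<otimes> z" by blast
  have sc: "s \<in> carrier R" using s SE(1) by blast
  have "\<zero> = (peval f n y \<oplus> f n \<otimes> y [^] n) \<otimes> z [^] n" using y(2) z by simp
  also have "\<dots> = peval f n y \<otimes> z [^] n \<oplus> f n \<otimes> (y [^] n \<otimes> z [^] n)"
    using fc y(1) z by (simp add: l_distr m_assoc)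
  also have "\<dots> = z \<otimes> s \<oplus> f n" using s yz fc sc z by (simp add: m_comm)
  finally have "f n = \<ominus> (z \<otimes> s)" using fc z sc by (metis a_comm m_closed minus_equality)
  then have "small V (f n)" using small_minus[OF S small_mult[OF S z(4) s(1)]] by simp
  then show False using fn by (simp add: small_def)
qed

lemma peval_single:
  assumes "k < n" "a \<in> carrier R" "x \<in> carrier R"
  shows "peval (\<lambda>i. if i = k then a else \<zero>) n x = a \<otimes> x [^] k"
proof -
  have "peval (\<lambda>i. if i = k then a else \<zero>) n x = peval (\<lambda>i. if i = k then a else \<zero>) (Suc k) x"
    using assms by (intro lincomb_extend) auto
  also have "peval (\<lambda>i. if i = k then a else \<zero>) k x = \<zero>"
    using assms by (intro lincomb_zero) auto
  then have "peval (\<lambda>i. if i = k then a else \<zero>) (Suc k) x = a \<otimes> x [^] k" using assms by simp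
  finally show ?thesis .
qed

text \<open>The extra factor \<open>w\<close> = 1/x keeps the degree below \<open>n\<close>: the
  terms of x^(n-1) g(1/x) have exponents from n - m to n - 1.\<close>

lemma peval_reverse:
  assumes V: "subring V R" and g: "\<And>i. g i \<in> V" and x: "x \<in> carrier R" "w \<in> carrier R" "x \<otimes> w = \<one>"
    and "m \<le> n"
  shows "\<exists>h. (\<forall>i. h i \<in> V) \<and> w \<otimes> x [^] n \<otimes> peval g m w = peval h n x"
  using \<open>m \<le> n\<close>
proof (induct m)
  case 0
  have "peval (\<lambda>i. \<zero>) n x = \<zero>" using x by (intro lincomb_zero) auto
  then show ?case using subringE(2)[OF V] x by (intro exI[of _ "\<lambda>_. \<zero>"]) auto
next
  case (Suc m)
  then obtain h where h: "\<And>i. h i \<in> V" "w \<otimes> x [^] n \<otimes> peval g m w = peval h n x" by auto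
  have gc: "\<And>i. g i \<in> carrier R" and hc: "\<And>i. h i \<in> carrier R" using g h subringE(1)[OF V] by blast+
  define k where "k = n - Suc m"
  have k: "k < n" "n = k + Suc m" using Suc(2) by (auto simp: k_def)
  have xw: "x [^] Suc m \<otimes> w [^] Suc m = \<one>"
    using nat_pow_distrib[of x w "Suc m"] x by simp
  have "w \<otimes> x [^] n \<otimes> (g m \<otimes> w [^] m) = g m \<otimes> x [^] n \<otimes> w [^] Suc m"
    using x gc by (simp add: m_ac)
  also have "\<dots> = g m \<otimes> (x [^] k \<otimes> x [^] Suc m) \<otimes> w [^] Suc m"
    unfolding k(2) nat_pow_mult[OF x(1), of k "Suc m"] ..
  also have "g m \<otimes> (x [^] k \<otimes> x [^] Suc m) \<otimes> w [^] Suc m = g m \<otimes> x [^] k \<otimes> (x [^] Suc m \<otimes> w [^] Suc m)"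
    using x gc by (simp add: m_assoc del: nat_pow_Suc)
  also have "\<dots> = peval (\<lambda>i. if i = k then g m else \<zero>) n x"
    using xw peval_single[of k n "g m" x] k x gc by simp
  finally have 1: "w \<otimes> x [^] n \<otimes> (g m \<otimes> w [^] m) = peval (\<lambda>i. if i = k then g m else \<zero>) n x" .
  have "w \<otimes> x [^] n \<otimes> peval g (Suc m) w
      = w \<otimes> x [^] n \<otimes> peval g m w \<oplus> w \<otimes> x [^] n \<otimes> (g m \<otimes> w [^] m)"
    using x gc by (simp add: r_distr)
  also have "\<dots> = peval (\<lambda>i. h i \<oplus> (if i = k then g m else \<zero>)) n x"
    unfolding 1 h(2) using hc gc x by (intro lincomb_add[symmetric]) auto
  finally show ?case using h(1) g subringE(2,7)[OF V]
    by (intro exI[of _ "\<lambda>i. h i \<oplus> (if i = k then g m else \<zero>)"]) auto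
qed

text \<open>The degree reduction of the classical proof that a maximal subring is a valuation ring: two
  representations of \<open>\<one>\<close>, by polynomials in \<open>x\<close> and in its inverse, give a shorter one.\<close>

lemma one_eq_peval_reduce:
  assumes V: "subring V R" and p: "p \<in> V" and un: "\<And>b. b \<in> V \<Longrightarrow> vunit V (\<one> \<ominus> p \<otimes> b)"
    and x: "x \<in> carrier R" "w \<in> carrier R" "x \<otimes> w = \<one>" and mn: "m \<le> n"
    and f: "\<And>i. f i \<in> V" "\<one> = p \<otimes> peval f (Suc n) x"
    and g: "\<And>i. g i \<in> V" "\<one> = p \<otimes> peval g (Suc m) w"
  shows "\<exists>h. (\<forall>i. h i \<in> V) \<and> \<one> = p \<otimes> peval h n x"
proof -
  note SE = subringE[OF V]
  have fc: "\<And>i. f i \<in> carrier R" and gc: "\<And>i. g i \<in> carrier R" and pc: "p \<in> carrier R"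
    using f(1) g(1) p SE(1) by blast+
  define u where "u = \<one> \<ominus> p \<otimes> g 0"
  have u: "vunit V u" unfolding u_def using un g by blast
  then have uc: "u \<in> carrier R" "u \<noteq> \<zero>" "inv u \<in> V" "inv u \<in> carrier R" using SE(1) by (auto simp: vunit_def)
  define G where "G = peval (\<lambda>i. g (Suc i)) m w"
  have Gc: "G \<in> carrier R" unfolding G_def using gc x by auto
  have "\<one> = p \<otimes> (g 0 \<oplus> w \<otimes> G)" using g(2) peval_Suc[of g w m, OF gc x(2)] unfolding G_def by simp
  moreover have "p \<otimes> (g 0 \<oplus> w \<otimes> G) \<ominus> p \<otimes> g 0 = p \<otimes> w \<otimes> G" using pc gc[of 0] x Gc by algebra
  ultimately have "u = p \<otimes> w \<otimes> G" unfolding u_def by simp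
  then have 1: "\<one> = inv u \<otimes> (p \<otimes> w \<otimes> G)" using field_inv[OF uc(1,2)] by simp
  \<comment> \<open>Multiplied by x^n, this expresses x^n by lower powers of \<open>x\<close> with
    coefficients in p V, which eliminates the top term of the first representation.\<close>
  have "x [^] n = x [^] n \<otimes> (inv u \<otimes> (p \<otimes> w \<otimes> G))" unfolding 1[symmetric] using x by simp
  also have "\<dots> = inv u \<otimes> p \<otimes> (w \<otimes> x [^] n \<otimes> G)" using x pc uc Gc by (simp add: m_ac)
  finally have 2: "x [^] n = inv u \<otimes> p \<otimes> (w \<otimes> x [^] n \<otimes> G)" .
  obtain h where h: "\<And>i. h i \<in> V" "w \<otimes> x [^] n \<otimes> G = peval h n x"
    using peval_reverse[OF V, of "\<lambda>i. g (Suc i)" x w m n] g(1) x mn unfolding G_def by blast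
  have hc: "\<And>i. h i \<in> carrier R" using h SE(1) by blast
  let ?k = "\<lambda>i. f i \<oplus> (f n \<otimes> inv u \<otimes> p) \<otimes> h i"
  have "peval f (Suc n) x = peval f n x \<oplus> f n \<otimes> (inv u \<otimes> p \<otimes> peval h n x)"
    using 2 h(2) by simp
  also have "\<dots> = peval f n x \<oplus> (f n \<otimes> inv u \<otimes> p) \<otimes> peval h n x"
    using fc uc pc hc x by (simp add: m_assoc)
  also have "\<dots> = peval ?k n x"
    using fc uc pc hc x by (simp add: lincomb_add lincomb_smult)
  finally have "\<one> = p \<otimes> peval ?k n x" using f(2) by simp
  moreover have "\<And>i. ?k i \<in> V" using f h uc p SE(6,7) by simp
  ultimately show ?thesis by (intro exI[of _ ?k]) simp
qed

text \<open>Maximality gives 1/p in V[y], that is \<one> in p V[y], for every \<open>y\<close>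
  outside \<open>V\<close>. If neither \<open>x\<close> nor 1/x were in \<open>V\<close>, the
  shortest such representations for the two could be played off against each other.\<close>

lemma maximal_avoiding_inv_imp_valuation_ring:
  assumes V: "subring V R" and p: "p \<in> V" "p \<noteq> \<zero>" "inv p \<notin> V"
    and max: "\<And>B. \<lbrakk> subring B R; V \<subset> B \<rbrakk> \<Longrightarrow> inv p \<in> B"
  shows "valuation_ring V"
proof -
  note SE = subringE[OF V]
  have pc: "p \<in> carrier R" using p SE(1) by blast
  note ip = field_inv[OF pc p(2)]
  have adj: "inv p \<in> simple_extension V y" if "y \<in> carrier R" "y \<notin> V" for y
    using max[OF simple_extension_is_subring[OF V that(1)]] simple_extension_incl[OF SE(1) that(1)]
      simple_extension_mem[OF V that(1)] that(2) by blast
  \<comment> \<open>This says that \<open>p\<close> lies in the Jacobson radical. Otherwise 1/p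
    would be in V[1/u], so u^N / p in \<open>V\<close>; but u^N is \<one> modulo \<open>p\<close>,
    which would put 1/p into \<open>V\<close>.\<close>
  have un: "vunit V (\<one> \<ominus> p \<otimes> b)" if b: "b \<in> V" for b
  proof -
    define u where "u = \<one> \<ominus> p \<otimes> b"
    have bc: "b \<in> carrier R" using b SE(1) by blast
    have uV: "u \<in> V" unfolding u_def using b p SE(3,5,6,7) by (simp add: minus_eq)
    have uc: "u \<in> carrier R" using uV SE(1) by blast
    have u0: "u \<noteq> \<zero>"
    proof
      assume "u = \<zero>"
      then have "p \<otimes> b = \<one>" unfolding u_def using pc bc by (metis m_closed one_closed r_right_minus_eq)
      then show False using inv_unique_nonzero[OF pc bc] p b by simp
    qed
    have "inv u \<in> V"
    proof (rule ccontr)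
      assume "inv u \<notin> V"
      then have "inv p \<in> simple_extension V (inv u)" using adj field_inv[OF uc u0] by blast
      then obtain N where N: "u [^] (N::nat) \<otimes> inv p \<in> V"
        using simple_extension_inv_denominator[OF V uV u0] by blast
      have "\<exists>c\<in>V. u [^] M = \<one> \<oplus> p \<otimes> c" for M :: nat
      proof (induct M)
        case 0
        show ?case using SE(2) pc by (intro bexI[of _ \<zero>]) auto
      next
        case (Suc M)
        then obtain c where c: "c \<in> V" "u [^] M = \<one> \<oplus> p \<otimes> c" by blast
        have cc: "c \<in> carrier R" using c SE(1) by blast
        have "u [^] Suc M = (\<one> \<oplus> p \<otimes> c) \<otimes> (\<one> \<ominus> p \<otimes> b)" using c by (simp add: u_def)
        also have "\<dots> = \<one> \<oplus> p \<otimes> (c \<ominus> b \<ominus> p \<otimes> c \<otimes> b)" using cc bc pc by algebra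
        finally show ?case using c b p SE(5,6,7) by (intro bexI[of _ "c \<ominus> b \<ominus> p \<otimes> c \<otimes> b"]) (auto simp: minus_eq)
      qed
      then obtain c where c: "c \<in> V" "u [^] N = \<one> \<oplus> p \<otimes> c" by blast
      have cc: "c \<in> carrier R" using c SE(1) by blast
      have "u [^] N \<otimes> inv p = inv p \<oplus> (p \<otimes> inv p) \<otimes> c" unfolding c(2) using cc pc ip(1) by algebra
      then have "u [^] N \<otimes> inv p = inv p \<oplus> c" using ip cc by simp
      then have "inv p = u [^] N \<otimes> inv p \<oplus> \<ominus> c" using ip cc by (simp add: a_assoc r_neg)
      then show False using N c(1) SE(5,7) p(3) by metis
    qed
    then show ?thesis using uV u0 unfolding vunit_def u_def by blast
  qed
  let ?P = "\<lambda>x n. \<exists>f. (\<forall>i. f i \<in> V) \<and> \<one> = p \<otimes> peval f n x"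
  have exP: "\<exists>n. ?P y n" if y: "y \<in> carrier R" "y \<notin> V" for y
  proof -
    obtain f n where f: "\<And>i. f i \<in> V" "inv p = peval f n y"
      using simple_extension_imp_peval[OF V y(1) adj[OF y]] by blast
    then have "\<one> = p \<otimes> peval f n y" using ip(3) by metis
    then show ?thesis using f(1) by blast
  qed
  have P0: "\<not> ?P x 0" if "x \<in> carrier R" for x using pc by simp
  have "x \<in> V \<or> inv x \<in> V" if x: "x \<in> carrier R" "x \<noteq> \<zero>" for x
  proof (rule ccontr)
    assume "\<not> ?thesis"
    then have xV: "x \<notin> V" "inv x \<notin> V" by auto
    note ix = field_inv[OF x]
    \<comment> \<open>The shortest lengths for \<open>x\<close> and for its inverse; the longer of
      the two representations is the one that gets shortened.\<close>
    define n where "n = (LEAST n. ?P x n)"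
    define m where "m = (LEAST m. ?P (inv x) m)"
    have n: "?P x n" unfolding n_def using exP[OF x(1) xV(1)] by (rule LeastI_ex)
    have m: "?P (inv x) m" unfolding m_def using exP[OF ix(1) xV(2)] by (rule LeastI_ex)
    obtain n' where n': "n = Suc n'" using n P0[OF x(1)] by (cases n) auto
    obtain m' where m': "m = Suc m'" using m P0[OF ix(1)] by (cases m) auto
    obtain f where f: "\<And>i. f i \<in> V" "\<one> = p \<otimes> peval f (Suc n') x" using n n' by blast
    obtain g where g: "\<And>i. g i \<in> V" "\<one> = p \<otimes> peval g (Suc m') (inv x)" using m m' by blast
    show False
    proof (cases "m' \<le> n'")
      case True
      have "?P x n'" by (rule one_eq_peval_reduce[OF V p(1) un x(1) ix(1) ix(3) True f g])
      then show False using not_less_Least[of n' "?P x"] n' n_def by auto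
    next
      case False
      have "?P (inv x) m'" by (rule one_eq_peval_reduce[OF V p(1) un ix(1) x(1) ix(4) _ g f]) (use False in auto)
      then show False using not_less_Least[of m' "?P (inv x)"] m' m_def by auto
    qed
  qed
  then show ?thesis using V unfolding valuation_ring_def by blast
qed

end

section \<open>Places of an algebraically closed field\<close>

context field
begin

lemma subring_minus: "\<lbrakk> subring A R; a \<in> A; b \<in> A \<rbrakk> \<Longrightarrow> a \<ominus> b \<in> A"
  using subringE(5,7)[of A R] by (simp add: minus_eq)

primrec linprod :: "'a \<Rightarrow> 'a list \<Rightarrow> 'a" where
  "linprod x [] = \<one>"
| "linprod x (d # ds) = (x \<ominus> d) \<otimes> linprod x ds"

lemma linprod_closed: "\<lbrakk> x \<in> carrier R; set ds \<subseteq> carrier R \<rbrakk> \<Longrightarrow> linprod x ds \<in> carrier R"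
  by (induct ds) auto

lemma linprod_vunit:
  assumes "subring V R" "\<And>d. d \<in> set ds \<Longrightarrow> vunit V (x \<ominus> d)"
  shows "vunit V (linprod x ds)"
  using assms(2) by (induct ds) (auto intro: vunit_one[OF assms(1)] vunit_mult[OF assms(1)])

lemma peval_split:
  assumes "\<And>i. f i \<in> carrier R" "x \<in> carrier R"
  shows "peval f (j + m) x = peval f j x \<oplus> x [^] j \<otimes> peval (\<lambda>i. f (i + j)) m x"
proof (induct m)
  case (Suc m)
  have "x [^] (j + m) = x [^] j \<otimes> x [^] m" by (rule nat_pow_mult[OF assms(2), symmetric])
  moreover have "f (j + m) = f (m + j)" by (simp add: add.commute)
  ultimately show ?case using Suc assms by (simp add: a_assoc r_distr m_lcomm)
qed (use assms in simp)

text \<open>Dividing by a power of \<open>y\<close> makes the constant coefficient nonzero, and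
  cutting off zeros does the same for the leading one. The former exhibits \<open>y\<close> as a
  divisor of a coefficient, the latter is what integrality requires.\<close>

lemma alg_rel_trim:
  assumes A: "subring A R" and y: "y \<in> carrier R" "y \<noteq> \<zero>" and rel: "alg_rel A y"
  obtains f n where "\<And>i. f i \<in> A" "f 0 \<noteq> \<zero>" "f n \<noteq> \<zero>" "peval f (Suc n) y = \<zero>"
proof -
  obtain f n k where f: "\<And>i. f i \<in> A" "k < n" "f k \<noteq> \<zero>" "peval f n y = \<zero>"
    using rel unfolding alg_rel_def by blast
  have fc: "\<And>i. f i \<in> carrier R" using f(1) subringE(1)[OF A] by blast
  define j where "j = (LEAST i. f i \<noteq> \<zero>)"
  have j: "f j \<noteq> \<zero>" "\<And>i. i < j \<Longrightarrow> f i = \<zero>"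
    unfolding j_def using LeastI[of "\<lambda>i. f i \<noteq> \<zero>", OF f(3)] not_less_Least by blast+
  define t where "t = Max {i. i < n \<and> f i \<noteq> \<zero>}"
  have ne: "{i. i < n \<and> f i \<noteq> \<zero>} \<noteq> {}" "finite {i. i < n \<and> f i \<noteq> \<zero>}" using f by auto
  have t: "t < n" "f t \<noteq> \<zero>" using Max_in[OF ne(2,1)] by (auto simp: t_def)
  have t': "f i = \<zero>" if "t < i" "i < n" for i
    using Max_ge[OF ne(2), of i] that by (fastforce simp: t_def)
  have jt: "j \<le> t" using t j(2) by (meson not_le)
  have "peval f n y = peval f (Suc t) y"
    using fc y t t' by (intro lincomb_extend) auto
  also have "Suc t = j + Suc (t - j)" using jt by simp
  also have "peval f (j + Suc (t - j)) y = y [^] j \<otimes> peval (\<lambda>i. f (i + j)) (Suc (t - j)) y"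
    using lincomb_zero[of j f "\<lambda>i. y [^] i"] j(2) fc y peval_split[of f y j "Suc (t - j)", OF fc y(1)]
    by (simp del: lincomb.simps)
  finally have "y [^] j \<otimes> peval (\<lambda>i. f (i + j)) (Suc (t - j)) y = \<zero>" using f(4) by simp
  moreover have "peval (\<lambda>i. f (i + j)) (Suc (t - j)) y \<in> carrier R" by (intro lincomb_closed) (use fc y in auto)
  ultimately have "peval (\<lambda>i. f (i + j)) (Suc (t - j)) y = \<zero>"
    using integral[of "y [^] j"] nat_pow_nonzero[OF y, of j] y(1) nat_pow_closed by blast
  then show ?thesis using that[of "\<lambda>i. f (i + j)" "t - j"] f(1) j(1) t(2) jt by simp
qed

text \<open>Fractions over a ring that contains the generators are stable under all field
  operations. Orders of vanishing then have to be computed in the ring \<open>B\<close>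
  only.\<close>

lemma generate_field_fraction:
  assumes B: "subring B R" "H \<subseteq> B" and y: "y \<in> generate_field R H"
  shows "y \<in> carrier R \<and> (\<exists>b\<in>B. b \<noteq> \<zero> \<and> y \<otimes> b \<in> B)"
  using y
proof (induct rule: generate_field.induct)
  case one
    show ?case using subringE(3)[OF B(1)] by (intro conjI bexI[of _ \<one>]) simp_all
  next
    case (incl h)
    then show ?case using subsetD[OF subringE(1)[OF B(1)], of h] subringE(3)[OF B(1)] subsetD[OF B(2), of h] by (intro conjI bexI[of _ \<one>]) simp_all
  next
    case (a_inv h)
    then obtain b where b: "b \<in> B" "b \<noteq> \<zero>" "h \<otimes> b \<in> B" "h \<in> carrier R" by blast
    have "b \<in> carrier R" using b subringE(1)[OF B(1)] by blast
    then have "\<ominus> h \<otimes> b = \<ominus> (h \<otimes> b)" using b by (simp add: l_minus)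
    then show ?case using b subringE(5)[OF B(1)] by (intro conjI bexI[of _ b]) simp_all
  next
    case (m_inv h)
    then obtain b where b: "b \<in> B" "b \<noteq> \<zero>" "h \<otimes> b \<in> B" "h \<in> carrier R" by blast
    have bc: "b \<in> carrier R" using b subringE(1)[OF B(1)] by blast
    note i = field_inv[OF b(4) m_inv(3)]
    have "inv h \<otimes> (h \<otimes> b) = b" using i bc b by (simp add: m_assoc[symmetric])
    then show ?case using b i integral'[OF b(4) m_inv(3) bc b(2)]
      by (intro conjI bexI[of _ "h \<otimes> b"]) simp_all
  next
    case (eng_add h1 h2)
    then obtain b1 b2 where b: "b1 \<in> B" "b1 \<noteq> \<zero>" "h1 \<otimes> b1 \<in> B" "h1 \<in> carrier R"
      "b2 \<in> B" "b2 \<noteq> \<zero>" "h2 \<otimes> b2 \<in> B" "h2 \<in> carrier R" by blast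
    have bc: "b1 \<in> carrier R" "b2 \<in> carrier R" using b subringE(1)[OF B(1)] by blast+
    have "(h1 \<oplus> h2) \<otimes> (b1 \<otimes> b2) = (h1 \<otimes> b1) \<otimes> b2 \<oplus> (h2 \<otimes> b2) \<otimes> b1"
      using b bc by algebra
    moreover have "\<dots> \<in> B" using b subringE(6,7)[OF B(1)] by simp
    ultimately show ?case using b bc subringE(6)[OF B(1)] integral'[of b1 b2]
      by (intro conjI bexI[of _ "b1 \<otimes> b2"]) simp_all
  next
    case (eng_mult h1 h2)
    then obtain b1 b2 where b: "b1 \<in> B" "b1 \<noteq> \<zero>" "h1 \<otimes> b1 \<in> B" "h1 \<in> carrier R"
      "b2 \<in> B" "b2 \<noteq> \<zero>" "h2 \<otimes> b2 \<in> B" "h2 \<in> carrier R" by blast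
    have bc: "b1 \<in> carrier R" "b2 \<in> carrier R" using b subringE(1)[OF B(1)] by blast+
    have "(h1 \<otimes> h2) \<otimes> (b1 \<otimes> b2) = (h1 \<otimes> b1) \<otimes> (h2 \<otimes> b2)"
      using b bc by algebra
    moreover have "\<dots> \<in> B" using b subringE(6)[OF B(1)] by simp
    ultimately show ?case using b bc subringE(6)[OF B(1)] integral'[of b1 b2]
      by (intro conjI bexI[of _ "b1 \<otimes> b2"]) simp_all
qed

text \<open>\<open>x\<close> is p^(l-k) times a unit, written without negative exponents. For
  \<open>p\<close> in \<open>N\<close> and in the maximal ideal, this makes \<open>p\<close> a
  uniformizer of the valuation restricted to \<open>N\<close>. It can hold on proper subfields only,
  since in an algebraically closed field \<open>p\<close> has a square root.\<close>

definition uniformized :: "'a set \<Rightarrow> 'a \<Rightarrow> 'a set \<Rightarrow> bool" where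
  "uniformized V p N \<longleftrightarrow>
     (\<forall>x\<in>N. x \<noteq> \<zero> \<longrightarrow> (\<exists>k l u. vunit V u \<and> x \<otimes> p [^] (k::nat) = p [^] (l::nat) \<otimes> u))"

lemma uniformized_fractions:
  assumes V: "subring V R" and p: "p \<in> carrier R" "p \<noteq> \<zero>" and B: "subring B R" "H \<subseteq> B"
    and u: "uniformized V p B"
  shows "uniformized V p (generate_field R H)"
  unfolding uniformized_def
proof (intro ballI impI)
  fix y assume y: "y \<in> generate_field R H" "y \<noteq> \<zero>"
  obtain b where b: "y \<in> carrier R" "b \<in> B" "b \<noteq> \<zero>" "y \<otimes> b \<in> B"
    using generate_field_fraction[OF B y(1)] by blast
  have bc: "b \<in> carrier R" using b B subringE(1) by blast
  have "y \<otimes> b \<noteq> \<zero>" using integral' b bc y by blast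
  then obtain k l c where c: "vunit V c" "y \<otimes> b \<otimes> p [^] (k::nat) = p [^] (l::nat) \<otimes> c"
    using u b(4) unfolding uniformized_def by blast
  obtain k' l' c' where c': "vunit V c'" "b \<otimes> p [^] (k'::nat) = p [^] (l'::nat) \<otimes> c'"
    using u b(2,3) unfolding uniformized_def by blast
  have cc: "c \<in> carrier R" "c' \<in> carrier R" "c' \<noteq> \<zero>" using c c' subringE(1)[OF V] by (auto simp: vunit_def)
  note i = field_inv[OF cc(2,3)]
  have e: "(y \<otimes> (L \<otimes> K)) = (((y \<otimes> b) \<otimes> K) \<otimes> K') \<otimes> d"
    if "K \<in> carrier R" "K' \<in> carrier R" "L \<in> carrier R" "d \<in> carrier R" "b \<otimes> K' = L \<otimes> c'" "c' \<otimes> d = \<one>"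
    for K K' L d
  proof -
    have "(((y \<otimes> b) \<otimes> K) \<otimes> K') \<otimes> d = y \<otimes> K \<otimes> (b \<otimes> K') \<otimes> d" using that(1-4) b(1) bc by algebra
    also have "\<dots> = y \<otimes> (L \<otimes> K) \<otimes> (c' \<otimes> d)" unfolding that(5) using that(1-4) b(1) cc(2) by algebra
    finally show ?thesis using that b by simp
  qed
  have "y \<otimes> p [^] (l' + k) = y \<otimes> (p [^] l' \<otimes> p [^] k)" using p by (simp add: nat_pow_mult)
  also have "\<dots> = (((y \<otimes> b) \<otimes> p [^] k) \<otimes> p [^] k') \<otimes> inv c'"
    by (rule e) (use p i c' in auto)
  also have "\<dots> = (p [^] l \<otimes> p [^] k') \<otimes> (c \<otimes> inv c')" unfolding c(2) using p cc i by (simp add: m_ac)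
  also have "\<dots> = p [^] (l + k') \<otimes> (c \<otimes> inv c')" using p by (simp add: nat_pow_mult)
  finally show "\<exists>k l u. vunit V u \<and> y \<otimes> p [^] (k::nat) = p [^] (l::nat) \<otimes> u"
    using vunit_mult[OF V c(1) vunit_inv[OF V c'(1)]] by blast
qed

end

text \<open>The situation is that of an algebraic closure \<open>L\<close> of the rational function
  field C(\<alpha>): \<open>C\<close> is relatively, hence absolutely, algebraically closed, and
  \<open>exchange\<close> says that \<open>L\<close> is algebraic over C(\<alpha>).\<close>

locale constants = algebraically_closed L for L (structure) +
  fixes C :: "'a set" and \<alpha> :: 'a
  assumes C: "subfield C L" and \<alpha>: "\<alpha> \<in> carrier L" "\<not> alg_rel C \<alpha>"
    and C_closed: "\<lbrakk> y \<in> carrier L; alg_rel C y \<rbrakk> \<Longrightarrow> y \<in> C"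
    and exchange: "y \<in> carrier L \<Longrightarrow> alg_rel (simple_extension C \<alpha>) y"
begin

lemmas CE = subringE[OF subfieldE(1)[OF C]]

text \<open>Roots in \<open>L\<close> of a polynomial over \<open>C\<close> are algebraic over
  \<open>C\<close>, hence in \<open>C\<close>, and can be divided out one by one. The factorization
  is an identity of values on all of \<open>L\<close>, because it is used at \<alpha> and also at
  elements of valuation rings.\<close>

lemma splitting:
  assumes "\<And>i. f i \<in> C" "i < n" "f i \<noteq> \<zero>"
  shows "\<exists>a ds. a \<in> C \<and> a \<noteq> \<zero> \<and> set ds \<subseteq> C \<and> (\<forall>x\<in>carrier L. peval f n x = a \<otimes> linprod x ds)"
  using assms
proof (induct n arbitrary: f i)
  case (Suc n)
  have fc: "\<And>i. f i \<in> carrier L" using Suc(2) CE(1) by blast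
  show ?case
  proof (cases "f n = \<zero>")
    case True
    then have "i < n" using Suc(3,4) less_SucE by blast
    moreover have "peval f (Suc n) x = peval f n x" if "x \<in> carrier L" for x using True that fc by simp
    ultimately show ?thesis using Suc(1)[of f i] Suc(2,4) by simp
  next
    case False
    show ?thesis
    proof (cases "n = 0")
      case True
      then show ?thesis using Suc(2) fc False by (intro exI[of _ "f 0"] exI[of _ "[]"]) auto
    next
      case n: False
      obtain b where b: "b \<in> carrier L" "peval f (Suc n) b = \<zero>"
        using exists_peval_root[of f n] fc False n by blast
      have bC: "b \<in> C" using C_closed[OF b(1)] alg_relI[of f C n "Suc n" b, OF Suc(2) _ False b(2)] by simp
      obtain q where q: "\<And>i. q i \<in> C"
        "\<And>x. x \<in> carrier L \<Longrightarrow> peval f (Suc n) x = (x \<ominus> b) \<otimes> peval q n x \<oplus> peval f (Suc n) b"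
        "peval q n b = peval (\<lambda>i. [Suc i] \<cdot> f (Suc i)) n b" "0 < n \<Longrightarrow> q (n - 1) = f n"
        by (rule peval_quotient[of C f b n, OF subfieldE(1)[OF C] Suc(2) bC]) (rule that)
      have qc: "\<And>i. q i \<in> carrier L" using q(1) CE(1) by blast
      obtain a ds where a: "a \<in> C" "a \<noteq> \<zero>" "set ds \<subseteq> C" "\<And>x. x \<in> carrier L \<Longrightarrow> peval q n x = a \<otimes> linprod x ds"
        using Suc(1)[of q "n - 1"] q(1,4) n False by auto
      have "peval f (Suc n) x = a \<otimes> linprod x (b # ds)" if x: "x \<in> carrier L" for x
      proof -
        have "linprod x ds \<in> carrier L" "a \<in> carrier L" using linprod_closed[OF x] a CE(1) by auto
        then show ?thesis using q(2)[OF x] a(4)[OF x] b x by (simp add: m_lcomm del: lincomb.simps)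
      qed
      then show ?thesis using a bC by (intro exI[of _ a] exI[of _ "b # ds"]) auto
    qed
  qed
qed simp

lemma split_simple_extension:
  assumes h: "h \<in> simple_extension C \<alpha>" "h \<noteq> \<zero>"
  obtains a ds where "a \<in> C" "a \<noteq> \<zero>" "set ds \<subseteq> C" "h = a \<otimes> linprod \<alpha> ds"
proof -
  obtain f n where f: "\<And>i. f i \<in> C" "h = peval f n \<alpha>"
    using simple_extension_imp_peval[OF subfieldE(1)[OF C] \<alpha>(1) h(1)] by blast
  have "\<exists>i<n. f i \<noteq> \<zero>"
  proof (rule ccontr)
    assume "\<not> ?thesis"
    then have "peval f n \<alpha> = \<zero>" using \<alpha>(1) by (intro lincomb_zero) auto
    then show False using f h by simp
  qed
  then obtain i where "i < n" "f i \<noteq> \<zero>" by blast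
  from splitting[of f i n, OF f(1) this] show ?thesis using f(2) \<alpha>(1) that by blast
qed

definition place :: "'a \<Rightarrow> 'a set \<Rightarrow> bool" where
  "place d V \<longleftrightarrow> valuation_ring V \<and> C \<subseteq> V \<and> \<alpha> \<in> V \<and> small V (\<alpha> \<ominus> d)"

lemma \<alpha>_minus_nonzero:
  assumes "d \<in> C" shows "\<alpha> \<ominus> d \<in> carrier L" "\<alpha> \<ominus> d \<noteq> \<zero>"
proof -
  have dc: "d \<in> carrier L" using assms CE(1) by blast
  show "\<alpha> \<ominus> d \<in> carrier L" using \<alpha>(1) dc by simp
  have "\<alpha> \<noteq> d"
  proof
    assume "\<alpha> = d"
    let ?f = "\<lambda>i::nat. if i = 0 then \<ominus> d else \<one>"
    have "peval ?f 2 \<alpha> = \<zero>" using \<open>\<alpha> = d\<close> dc by (simp add: numeral_2_eq_2 l_neg)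
    then have "alg_rel C \<alpha>" using assms CE(3,5) by (intro alg_relI[of ?f C 1 2]) auto
    then show False using \<alpha> by blast
  qed
  then show "\<alpha> \<ominus> d \<noteq> \<zero>" using \<alpha>(1) dc by simp
qed

text \<open>A representation of the inverse as f(\<alpha>) would make \<alpha> a root of (X - d)
  f(X) - 1. By transcendence this polynomial is zero, but its value at \<open>d\<close> is
  -1.\<close>

lemma inv_not_in_simple_extension:
  assumes d: "d \<in> C" shows "inv (\<alpha> \<ominus> d) \<notin> simple_extension C \<alpha>"
proof
  assume "inv (\<alpha> \<ominus> d) \<in> simple_extension C \<alpha>"
  then obtain f n where f: "\<And>i. f i \<in> C" "inv (\<alpha> \<ominus> d) = peval f n \<alpha>"
    using simple_extension_imp_peval[OF subfieldE(1)[OF C] \<alpha>(1)] by blast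
  have dc: "d \<in> carrier L" using assms CE(1) by blast
  have fc: "\<And>i. f i \<in> carrier L" using f CE(1) by blast
  \<comment> \<open>\<open>g\<close> is \<open>f\<close> cut off at its length, and \<open>h\<close>
    are the coefficients of X f(X) - 1, so that \<open>?k\<close> below stands for (X - d) f(X) -
    1.\<close>
  define g where "g = (\<lambda>i. if i < n then f i else \<zero>)"
  define h where "h = (\<lambda>i. case i of 0 \<Rightarrow> \<ominus> \<one> | Suc j \<Rightarrow> f j)"
  have gC: "\<And>i. g i \<in> C" "\<And>i. h i \<in> C"
    using f(1) CE(2,3,5) by (auto simp: g_def h_def split: nat.splits)
  then have gc: "\<And>i. g i \<in> carrier L" "\<And>i. h i \<in> carrier L" using CE(1) by blast+
  let ?k = "\<lambda>i. h i \<oplus> (\<ominus> d) \<otimes> g i"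
  have k: "peval ?k (Suc n) x = (x \<ominus> d) \<otimes> peval f n x \<ominus> \<one>" if x: "x \<in> carrier L" for x
  proof -
    have "peval g (Suc n) x = peval g n x" using gc x by (simp add: g_def)
    also have "\<dots> = peval f n x" by (rule lincomb_cong) (auto simp: g_def)
    finally have 1: "peval g (Suc n) x = peval f n x" .
    have 2: "peval h (Suc n) x = \<ominus> \<one> \<oplus> x \<otimes> peval f n x"
      using peval_Suc[of h x n, OF gc(2) x] by (simp add: h_def)
    have "peval ?k (Suc n) x = peval h (Suc n) x \<oplus> (\<ominus> d) \<otimes> peval g (Suc n) x"
      using gc x dc by (simp add: lincomb_add lincomb_smult del: lincomb.simps)
    also have "\<dots> = (\<ominus> \<one> \<oplus> x \<otimes> peval f n x) \<oplus> (\<ominus> d) \<otimes> peval f n x" unfolding 1 2 ..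
    also have "\<dots> = (x \<ominus> d) \<otimes> peval f n x \<ominus> \<one>"
    proof -
      have "(\<ominus> \<one> \<oplus> x \<otimes> F) \<oplus> (\<ominus> d) \<otimes> F = (x \<ominus> d) \<otimes> F \<ominus> \<one>" if "F \<in> carrier L" for F
        using that x dc by algebra
      then show ?thesis using fc x by simp
    qed
    finally show ?thesis .
  qed
  have "peval ?k (Suc n) \<alpha> = \<zero>"
    unfolding k[OF \<alpha>(1)] f(2)[symmetric] using field_inv[OF \<alpha>_minus_nonzero[OF d]] by simp
  then have z: "?k i = \<zero>" if "i < Suc n" for i
    using \<alpha>(2) alg_relI[of ?k C i "Suc n" \<alpha>] gC CE(5,6,7) d that by blast
  have "peval ?k (Suc n) d = \<zero>" using z dc by (intro lincomb_zero) auto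
  moreover have "peval ?k (Suc n) d = \<ominus> \<one>"
    unfolding k[OF dc] using dc fc by (simp add: r_neg minus_eq)
  ultimately have "\<ominus> \<one> = \<zero>" by simp
  then have "\<one> = \<zero>" using minus_minus[OF one_closed] by simp
  then show False by simp
qed

text \<open>A subring over C[\<alpha>] that is maximal without the inverse of \<alpha> - d is a
  valuation ring, and keeping that inverse out means that \<alpha> - d is not a unit.\<close>

lemma exists_place:
  assumes d: "d \<in> C" shows "\<exists>V. place d V"
proof -
  let ?A = "simple_extension C \<alpha>" and ?p = "\<alpha> \<ominus> d"
  have A: "subring ?A L" "C \<subseteq> ?A" "\<alpha> \<in> ?A"
    using simple_extension_is_subring[OF subfieldE(1)[OF C] \<alpha>(1)] simple_extension_incl[OF CE(1) \<alpha>(1)]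
      simple_extension_mem[OF subfieldE(1)[OF C] \<alpha>(1)] by auto
  obtain V where V: "subring V L" "?A \<subseteq> V" "inv ?p \<notin> V"
    "\<And>B. \<lbrakk> subring B L; V \<subset> B; B \<subseteq> carrier L \<rbrakk> \<Longrightarrow> \<not> inv ?p \<notin> B"
  proof (rule exists_maximal_subring[of ?A "carrier L" "\<lambda>B. inv ?p \<notin> B"])
    fix S assume "subset.chain {B. subring B L \<and> ?A \<subseteq> B \<and> B \<subseteq> carrier L \<and> inv ?p \<notin> B} S"
    then have "\<And>B. B \<in> S \<Longrightarrow> inv ?p \<notin> B" unfolding subset.chain_def by auto
    then show "inv ?p \<notin> \<Union>S" by blast
  qed (use A(1) subringE(1)[OF A(1)] inv_not_in_simple_extension[OF d] in auto)
  have p: "?p \<in> V" using A V(2) d by (intro subring_minus[OF V(1)]) auto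
  have "valuation_ring V"
    using maximal_avoiding_inv_imp_valuation_ring[OF V(1) p \<alpha>_minus_nonzero(2)[OF d] V(3)]
      V(4) subringE(1) by blast
  moreover have "small V ?p" using p V(3) by (simp add: small_def vunit_def)
  ultimately show ?thesis using A V(2) unfolding place_def by (intro exI[of _ V]) blast
qed

context
  fixes d V assumes d: "d \<in> C" and pl: "place d V"
begin

lemma V: "valuation_ring V" "subring V L" "C \<subseteq> V" "\<alpha> \<in> V" "small V (\<alpha> \<ominus> d)"
  using pl by (auto simp: place_def valuation_ring_def)

lemmas VE = subringE[OF V(2)]

lemma vunit_constant: "\<lbrakk> c \<in> C; c \<noteq> \<zero> \<rbrakk> \<Longrightarrow> vunit V c"
  using V(3) subfield_m_inv(1)[OF C, of c] by (auto simp: vunit_def)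

lemma vunit_of_residue:
  assumes "c \<in> C" "c \<noteq> \<zero>" "u \<in> V" "small V (u \<ominus> c)" shows "vunit V u"
proof -
  have m: "c \<in> carrier L" "u \<in> carrier L" using assms V(3) VE(1) by auto
  have "u = c \<oplus> (u \<ominus> c)" using m by algebra
  then show ?thesis using vunit_add_small[OF V(1) vunit_constant[OF assms(1,2)] assms(4)] by simp
qed

lemma small_residue_mult:
  assumes "c \<in> C" "u \<in> V" "small V (u \<ominus> c)" "c' \<in> C" "u' \<in> V" "small V (u' \<ominus> c')"
  shows "small V (u \<otimes> u' \<ominus> c \<otimes> c')"
proof -
  have m: "c \<in> carrier L" "u \<in> carrier L" "c' \<in> carrier L" "u' \<in> carrier L" using assms V(3) VE(1) by auto
  have "u \<otimes> u' \<ominus> c \<otimes> c' = (u \<ominus> c) \<otimes> u' \<oplus> (u' \<ominus> c') \<otimes> c" using m by algebra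
  then show ?thesis
    using small_add[OF V(1) small_mult[OF V(2) assms(3,5)] small_mult[OF V(2) assms(6)]] assms(1) V(3) by auto
qed

text \<open>The order of vanishing at \<open>d\<close> is the number of linear factors \<alpha> - d;
  every other factor \<alpha> - e has the nonzero residue d - e. The residue \<open>c\<close> is
  recorded, and not just that \<open>u\<close> is a unit, because it becomes a coefficient when
  relations are reduced modulo the place.\<close>

lemma simple_extension_order:
  assumes h: "h \<in> simple_extension C \<alpha>" "h \<noteq> \<zero>"
  obtains k u c where "h = (\<alpha> \<ominus> d) [^] (k::nat) \<otimes> u" "u \<in> V" "c \<in> C" "c \<noteq> \<zero>" "small V (u \<ominus> c)"
proof -
  obtain a ds where a: "a \<in> C" "a \<noteq> \<zero>" "set ds \<subseteq> C" "h = a \<otimes> linprod \<alpha> ds"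
    using split_simple_extension[OF h] by blast
  let ?p = "\<alpha> \<ominus> d"
  have pc: "?p \<in> carrier L" using \<alpha>_minus_nonzero[OF d] by blast
  have dc: "d \<in> carrier L" using d CE(1) by blast
  have "\<exists>k u c. a \<otimes> linprod \<alpha> ds = ?p [^] (k::nat) \<otimes> u \<and> u \<in> V \<and> c \<in> C \<and> c \<noteq> \<zero> \<and> small V (u \<ominus> c)"
    using a(3)
  proof (induct ds)
    case Nil
    have "a \<in> carrier L" "a \<in> V" using a V(3) VE(1) by auto
    then show ?case using a small_zero[OF V(2)]
      by (intro exI[of _ "0::nat"] exI[of _ a]) (auto simp: r_neg minus_eq)
  next
    case (Cons e ds)
    then obtain k u c where u: "a \<otimes> linprod \<alpha> ds = ?p [^] (k::nat) \<otimes> u" "u \<in> V" "c \<in> C" "c \<noteq> \<zero>" "small V (u \<ominus> c)"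
      by auto
    have ec: "e \<in> carrier L" "e \<in> C" "a \<in> carrier L" "u \<in> carrier L" "c \<in> carrier L" using Cons a CE(1) u VE(1) by auto
    have lc: "linprod \<alpha> ds \<in> carrier L" using linprod_closed[OF \<alpha>(1)] Cons CE(1) by auto
    have 1: "a \<otimes> linprod \<alpha> (e # ds) = (\<alpha> \<ominus> e) \<otimes> (?p [^] k \<otimes> u)"
      unfolding u(1)[symmetric] using ec lc \<alpha> by (simp add: m_lcomm)
    show ?case
    proof (cases "e = d")
      case True
      then have "a \<otimes> linprod \<alpha> (e # ds) = ?p [^] Suc k \<otimes> u" unfolding 1 using pc ec by (simp add: m_ac)
      then show ?thesis using u by blast
    next
      case False
      have "a \<otimes> linprod \<alpha> (e # ds) = ?p [^] k \<otimes> ((\<alpha> \<ominus> e) \<otimes> u)" unfolding 1 using pc ec \<alpha> by (simp add: m_lcomm)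
      moreover have "(\<alpha> \<ominus> e) \<ominus> (d \<ominus> e) = ?p" using ec dc \<alpha> by algebra
      then have "small V ((\<alpha> \<ominus> e) \<ominus> (d \<ominus> e))" using V by simp
      moreover have "\<alpha> \<ominus> e \<in> V" "d \<ominus> e \<in> C"
        using V ec d subring_minus[OF V(2)] subring_minus[OF subfieldE(1)[OF C]] by auto
      moreover have "d \<ominus> e \<noteq> \<zero>" using False dc ec by simp
      ultimately show ?thesis
        using small_residue_mult[of "d \<ominus> e" "\<alpha> \<ominus> e" c u] u integral'[of "d \<ominus> e" c] ec dc VE(6) CE(6)
        by (intro exI[of _ k] exI[of _ "(\<alpha> \<ominus> e) \<otimes> u"] exI[of _ "(d \<ominus> e) \<otimes> c"]) auto
    qed
  qed
  then show ?thesis using a(4) that by blast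
qed

lemma simple_extension_subset: "simple_extension C \<alpha> \<subseteq> V"
  by (rule simple_extension_subring_incl[OF V(2,3,4)])

text \<open>The residue field is \<open>C\<close>: an algebraic relation for \<open>x\<close> over
  C[\<alpha>], divided by the common power of \<alpha> - d and reduced, becomes a nonzero polynomial
  over \<open>C\<close> that vanishes at \<open>x\<close> modulo the place. It splits, so one of its
  linear factors is not a unit at \<open>x\<close>.\<close>

lemma exists_residue:
  assumes x: "x \<in> V" shows "\<exists>c\<in>C. small V (x \<ominus> c)"
proof -
  let ?p = "\<alpha> \<ominus> d"
  have pc: "?p \<in> carrier L" "?p \<noteq> \<zero>" using \<alpha>_minus_nonzero[OF d] by auto
  have pV: "?p \<in> V" using V(5) by (simp add: small_def)
  have xc: "x \<in> carrier L" using x VE(1) by blast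
  obtain h n i0 where h: "\<And>i. h i \<in> simple_extension C \<alpha>" "i0 < n" "h i0 \<noteq> \<zero>" "peval h n x = \<zero>"
    using exchange[OF xc] unfolding alg_rel_def by blast
  have "\<forall>i. \<exists>k u c. h i \<noteq> \<zero> \<longrightarrow> h i = ?p [^] (k::nat) \<otimes> u \<and> u \<in> V \<and> c \<in> C \<and> c \<noteq> \<zero> \<and> small V (u \<ominus> c)"
  proof
    fix i
    show "\<exists>k u c. h i \<noteq> \<zero> \<longrightarrow> h i = ?p [^] (k::nat) \<otimes> u \<and> u \<in> V \<and> c \<in> C \<and> c \<noteq> \<zero> \<and> small V (u \<ominus> c)"
    proof (cases "h i = \<zero>")
      case False
      then show ?thesis using simple_extension_order[OF h(1)[of i]] by metis
    qed simp
  qed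
  then obtain k u c where k: "\<And>i. h i \<noteq> \<zero> \<Longrightarrow> h i = ?p [^] (k i :: nat) \<otimes> u i \<and> u i \<in> V \<and> c i \<in> C \<and> c i \<noteq> \<zero> \<and> small V (u i \<ominus> c i)"
    by metis
  \<comment> \<open>The least order of vanishing among the nonzero coefficients; after division by
    p^m at least one of them has a nonzero residue.\<close>
  define m where "m = (LEAST m. \<exists>i<n. h i \<noteq> \<zero> \<and> k i = m)"
  have "\<exists>i<n. h i \<noteq> \<zero> \<and> k i = m" unfolding m_def by (rule LeastI[of _ "k i0"]) (use h in blast)
  then obtain j where j: "j < n" "h j \<noteq> \<zero>" "k j = m" by blast
  have mk: "m \<le> k i" if "i < n" "h i \<noteq> \<zero>" for i
    unfolding m_def by (rule Least_le) (use that in blast)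
  define h' where "h' = (\<lambda>i. if i < n \<and> h i \<noteq> \<zero> then ?p [^] (k i - m) \<otimes> u i else \<zero>)"
  \<comment> \<open>The relation reduced modulo the place: coefficients of higher order have residue
    zero.\<close>
  define c' where "c' = (\<lambda>i. if i < n \<and> h i \<noteq> \<zero> \<and> k i = m then c i else \<zero>)"
  have uc: "u i \<in> carrier L" if "h i \<noteq> \<zero>" for i using k[OF that] VE(1) by blast
  have h'V: "h' i \<in> V" for i
    unfolding h'_def using k VE(2,6) subring_pow[OF V(2) pV] by auto
  have c'C: "c' i \<in> C" for i unfolding c'_def using k CE(2) by auto
  have h'c: "h' i \<in> carrier L" and c'c: "c' i \<in> carrier L" for i
    using h'V c'C VE(1) CE(1) by blast+
  have hh': "h i = ?p [^] m \<otimes> h' i" if "i < n" for i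
  proof (cases "h i = \<zero>")
    case True
    then show ?thesis using pc by (simp add: h'_def)
  next
    case False
    have "?p [^] m \<otimes> ?p [^] (k i - m) = ?p [^] k i" using mk[OF that False] nat_pow_mult[OF pc(1), of m "k i - m"] by simp
    then show ?thesis using k[OF False] False that pc uc[OF False]
      by (simp add: h'_def m_assoc[symmetric])
  qed
  have sm: "small V (h' i \<ominus> c' i)" for i
  proof (cases "i < n \<and> h i \<noteq> \<zero>")
    case False
    then have "h' i = \<zero>" "c' i = \<zero>" by (auto simp: h'_def c'_def)
    then show ?thesis using small_zero[OF V(2)] by (simp add: minus_eq)
  next
    case True
    note ki = k[OF conjunct2[OF True]]
    show ?thesis
    proof (cases "k i = m")
      case k: True
      have "h' i = u i" "c' i = c i" using True k uc by (auto simp: h'_def c'_def)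
      then show ?thesis using ki by simp
    next
      case False
      then obtain l where l: "k i - m = Suc l" using mk[of i] True by (metis Suc_pred diff_is_0_eq le_antisym not_gr_zero)
      have "h' i = ?p \<otimes> (?p [^] l \<otimes> u i)" "c' i = \<zero>"
        using True False l pc uc[of i] by (auto simp: h'_def c'_def m_ac)
      moreover have "?p [^] l \<otimes> u i \<in> V" using VE(6) subring_pow[OF V(2) pV] ki by simp
      ultimately have "small V (h' i)" "c' i = \<zero>" using small_mult[OF V(2,5)] by auto
      then show ?thesis using h'c[of i] by (simp add: minus_eq)
    qed
  qed
  have "\<zero> = peval (\<lambda>i. ?p [^] m \<otimes> h' i) n x" unfolding h(4)[symmetric] by (rule lincomb_cong) (use hh' in auto)
  also have "\<dots> = ?p [^] m \<otimes> peval h' n x" using pc h'c xc by (simp add: lincomb_smult)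
  finally have "peval h' n x = \<zero>"
    using integral[of "?p [^] m" "peval h' n x"] nat_pow_nonzero[OF pc, of m] pc h'c xc by auto
  moreover have "peval (\<lambda>i. h' i \<ominus> c' i) n x = peval h' n x \<ominus> peval c' n x"
    using h'c c'c xc by (simp add: minus_eq lincomb_add lincomb_minus)
  moreover have "small V (peval (\<lambda>i. h' i \<ominus> c' i) n x)"
    using sm subring_pow[OF V(2) x] by (intro small_lincomb[OF V(1)]) auto
  ultimately have "small V (\<ominus> peval c' n x)" using c'c xc by (simp add: minus_eq)
  then have sc: "small V (peval c' n x)" using small_minus[OF V(2)] c'c xc by (metis lincomb_closed minus_minus nat_pow_closed)
  have "c' j \<noteq> \<zero>" using j k by (simp add: c'_def)
  then obtain a ds where a: "a \<in> C" "a \<noteq> \<zero>" "set ds \<subseteq> C" "\<And>x. x \<in> carrier L \<Longrightarrow> peval c' n x = a \<otimes> linprod x ds"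
    using splitting[of c' j n] c'C j(1) by blast
  have "\<exists>e\<in>set ds. \<not> vunit V (x \<ominus> e)"
  proof (rule ccontr)
    assume "\<not> ?thesis"
    then have "vunit V (linprod x ds)" using linprod_vunit[OF V(2)] by blast
    then have "vunit V (peval c' n x)" unfolding a(4)[OF xc] using vunit_mult[OF V(2) vunit_constant[OF a(1,2)]] by blast
    then show False using sc by (simp add: small_def)
  qed
  then obtain e where e: "e \<in> set ds" "\<not> vunit V (x \<ominus> e)" by blast
  then have "x \<ominus> e \<in> V" using a(3) V(3) x by (intro subring_minus[OF V(2)]) auto
  then show ?thesis using e a(3) by (auto simp: small_def)
qed

text \<open>The constant term of a trimmed relation is a multiple of \<open>y\<close>, and up to a
  unit it is a power of \<alpha> - d. So no nonzero element of \<open>V\<close> is divisible by all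
  powers of \<alpha> - d, which will bound repeated division.\<close>

lemma divides_power:
  assumes y: "y \<in> V" "y \<noteq> \<zero>" shows "\<exists>k z. z \<in> V \<and> (\<alpha> \<ominus> d) [^] (k::nat) = y \<otimes> z"
proof -
  have yc: "y \<in> carrier L" using y VE(1) by blast
  note A = simple_extension_is_subring[OF subfieldE(1)[OF C] \<alpha>(1)]
  obtain h n where h: "\<And>i. h i \<in> simple_extension C \<alpha>" "h 0 \<noteq> \<zero>" "peval h (Suc n) y = \<zero>"
    using alg_rel_trim[OF A yc y(2) exchange[OF yc]] by blast
  have hV: "\<And>i. h i \<in> V" using h simple_extension_subset by blast
  then have hc: "\<And>i. h i \<in> carrier L" using VE(1) by blast
  define z where "z = peval (\<lambda>i. h (Suc i)) n y"
  have z: "z \<in> V" unfolding z_def by (rule peval_in_subring[OF V(2) hV y(1)])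
  then have zc: "z \<in> carrier L" using VE(1) by blast
  have "h 0 \<oplus> y \<otimes> z = \<zero>" using h(3) peval_Suc[of h y n, OF hc yc] by (simp add: z_def)
  then have 1: "h 0 = y \<otimes> \<ominus> z" using hc yc zc by (simp add: r_minus minus_equality)
  obtain k u c where u: "h 0 = (\<alpha> \<ominus> d) [^] (k::nat) \<otimes> u" "u \<in> V" "c \<in> C" "c \<noteq> \<zero>" "small V (u \<ominus> c)"
    using simple_extension_order[OF h(1,2)] by blast
  have "vunit V u" using vunit_of_residue u by blast
  then have uu: "u \<in> carrier L" "u \<noteq> \<zero>" "inv u \<in> V" "inv u \<in> carrier L" using VE(1) by (auto simp: vunit_def)
  have pc: "\<alpha> \<ominus> d \<in> carrier L" using \<alpha>_minus_nonzero[OF d] by blast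
  have "(\<alpha> \<ominus> d) [^] k = h 0 \<otimes> inv u" using u(1) uu pc field_inv[OF uu(1,2)] by (simp add: m_assoc)
  also have "\<dots> = y \<otimes> (\<ominus> z \<otimes> inv u)" unfolding 1 using yc zc uu by (simp add: m_assoc)
  finally show ?thesis using z uu(3) VE(5,6) by blast
qed

end

text \<open>The excluded points are the zeros of the first and last coefficients of a relation for
  \<open>y\<close>: elsewhere the last makes \<open>y\<close> integral and the first makes it a
  divisor of a unit.\<close>

lemma eventually_vunit:
  assumes y: "y \<in> carrier L" "y \<noteq> \<zero>"
  shows "\<exists>B. finite B \<and> (\<forall>d\<in>C - B. \<forall>V. place d V \<longrightarrow> vunit V y)"
proof -
  note A = simple_extension_is_subring[OF subfieldE(1)[OF C] \<alpha>(1)]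
  obtain h n where h: "\<And>i. h i \<in> simple_extension C \<alpha>" "h 0 \<noteq> \<zero>" "h n \<noteq> \<zero>" "peval h (Suc n) y = \<zero>"
    using alg_rel_trim[OF A y exchange[OF y(1)]] by blast
  obtain a ds where a: "a \<in> C" "a \<noteq> \<zero>" "set ds \<subseteq> C" "h 0 = a \<otimes> linprod \<alpha> ds"
    using split_simple_extension[OF h(1,2)] by blast
  obtain b es where b: "b \<in> C" "b \<noteq> \<zero>" "set es \<subseteq> C" "h n = b \<otimes> linprod \<alpha> es"
    using split_simple_extension[OF h(1,3)] by blast
  have "vunit V y" if d: "d \<in> C - (set ds \<union> set es)" and pl: "place d V" for d V
  proof -
    have dC: "d \<in> C" using d by blast
    note V = V[OF dC pl] and VE = VE[OF dC pl]
    have dc: "d \<in> carrier L" using dC CE(1) by blast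
    have u: "vunit V (\<alpha> \<ominus> e)" if e: "e \<in> set ds \<union> set es" for e
    proof -
      have eC: "e \<in> C" using e a b by blast
      then have ec: "e \<in> carrier L" using CE(1) by blast
      have "(\<alpha> \<ominus> e) \<ominus> (d \<ominus> e) = \<alpha> \<ominus> d" using ec dc \<alpha> by algebra
      then show ?thesis
        using vunit_of_residue[OF dC pl, of "d \<ominus> e" "\<alpha> \<ominus> e"] V(5) eC dC ec dc V(3,4) d e
          subring_minus[OF V(2), of \<alpha> e] subring_minus[OF subfieldE(1)[OF C], of d e] by auto
    qed
    have u0: "vunit V (h 0)" unfolding a(4)
      by (intro vunit_mult[OF V(2)] vunit_constant[OF dC pl] linprod_vunit[OF V(2)] a u) auto
    have un: "vunit V (h n)" unfolding b(4)
      by (intro vunit_mult[OF V(2)] vunit_constant[OF dC pl] linprod_vunit[OF V(2)] b u) auto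
    have hV: "\<And>i. h i \<in> V" using h(1) simple_extension_subset[OF dC pl] by blast
    then have hc: "\<And>i. h i \<in> carrier L" using VE(1) by blast
    have yV: "y \<in> V" by (rule valuation_ring_integrally_closed[of V h n, OF V(1) hV un y(1) h(4)])
    define z where "z = peval (\<lambda>i. h (Suc i)) n y"
    have z: "z \<in> V" unfolding z_def by (rule peval_in_subring[OF V(2) hV yV])
    then have zc: "z \<in> carrier L" using VE(1) by blast
    have "h 0 \<oplus> y \<otimes> z = \<zero>" using h(4) peval_Suc[of h y n, OF hc y(1)] by (simp add: z_def)
    then have "h 0 = y \<otimes> \<ominus> z" using hc y zc by (simp add: r_minus minus_equality)
    then show "vunit V y" using vunit_factor[OF V(2) _ yV, of "\<ominus> z"] u0 z VE(5) by simp
  qed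
  then show ?thesis by (intro exI[of _ "set ds \<union> set es"]) auto
qed

end

section \<open>Frobenius powers\<close>

context field
begin

text \<open>The same expression as in \<open>purely_inseparable\<close>; with exponent 1 in
  characteristic zero, Frobenius arguments can be stated uniformly.\<close>

definition char_exp :: nat where
  "char_exp = max 1 (ring_characteristic R)"

lemma char_exp_pos: "0 < char_exp"
  by (simp add: char_exp_def)

lemma nat_zero_iff_char_exp_dvd:
  assumes "1 < char_exp"
  shows "[n] \<cdot> \<one> = \<zero> \<longleftrightarrow> char_exp dvd n"
proof -
  let ?P = "\<lambda>n::nat. 0 < n \<and> [n] \<cdot> \<one> = \<zero>"
  have "ring_characteristic R = char_exp" "ring_characteristic R \<noteq> 0"
    using assms by (auto simp: char_exp_def max_def split: if_splits)
  then have ex: "\<exists>n. ?P n" and L: "char_exp = (LEAST n. ?P n)"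
    unfolding ring_characteristic_def by (auto split: if_splits)
  have z: "[char_exp] \<cdot> \<one> = \<zero>" using LeastI_ex[OF ex] unfolding L by blast
  have zm: "[(char_exp * k)] \<cdot> \<one> = \<zero>" for k
    using z add.nat_pow_pow[of \<one> k char_exp] by simp
  have e: "[n] \<cdot> \<one> = [(char_exp * (n div char_exp))] \<cdot> \<one> \<oplus> [(n mod char_exp)] \<cdot> \<one>"
    using add.nat_pow_mult[of \<one> "char_exp * (n div char_exp)" "n mod char_exp"] by simp
  show ?thesis
  proof
    assume "[n] \<cdot> \<one> = \<zero>"
    then have "[(n mod char_exp)] \<cdot> \<one> = \<zero>" using e zm by simp
    moreover have "n mod char_exp < char_exp" using char_exp_pos by simp
    ultimately have "n mod char_exp = 0" using not_less_Least[of "n mod char_exp" ?P] L by auto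
    then show "char_exp dvd n" by auto
  next
    assume "char_exp dvd n" then show "[n] \<cdot> \<one> = \<zero>" using zm by auto
  qed
qed

lemma nat_nonzero_char_exp_one:
  fixes n :: nat
  assumes "char_exp = 1" "0 < n" shows "[n] \<cdot> \<one> \<noteq> \<zero>"
proof
  assume n: "[n] \<cdot> \<one> = \<zero>"
  let ?P = "\<lambda>n::nat. 0 < n \<and> [n] \<cdot> \<one> = \<zero>"
  have "?P (LEAST n. ?P n)" by (rule LeastI[of ?P n]) (use n assms in auto)
  moreover have "ring_characteristic R = (LEAST n. ?P n)"
    unfolding ring_characteristic_def by (rule if_P) (use n assms in blast)
  ultimately have "0 < ring_characteristic R" "[ring_characteristic R] \<cdot> \<one> = \<zero>" by auto
  moreover from this assms have "ring_characteristic R = 1" by (auto simp: char_exp_def max_def split: if_splits)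
  ultimately show False by simp
qed

lemma prime_char_exp:
  assumes "1 < char_exp" shows "Factorial_Ring.prime char_exp"
proof (rule prime_natI)
  show "char_exp \<ge> 2" using assms by simp
  fix a b assume "char_exp dvd a * b"
  then have "[(a * b)] \<cdot> \<one> = \<zero>" using nat_zero_iff_char_exp_dvd[OF assms] by simp
  moreover have "([a] \<cdot> \<one>) \<otimes> ([b] \<cdot> \<one>) = [(a * b)] \<cdot> \<one>"
    using add_pow_ldistr[of \<one> "[b] \<cdot> \<one>" a] add.nat_pow_pow[of \<one> a b] by (simp add: mult.commute)
  ultimately have "[a] \<cdot> \<one> = \<zero> \<or> [b] \<cdot> \<one> = \<zero>" using integral[of "[a] \<cdot> \<one>" "[b] \<cdot> \<one>"] by simp
  then show "char_exp dvd a \<or> char_exp dvd b" using nat_zero_iff_char_exp_dvd[OF assms] by simp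
qed

text \<open>Frobenius powers therefore preserve the parity of orders of vanishing, on which the
  final contradiction rests.\<close>

lemma odd_char_exp:
  assumes "\<one> \<oplus> \<one> \<noteq> \<zero>" shows "odd char_exp"
proof (cases "char_exp = 1")
  case False
  then have 1: "1 < char_exp" using char_exp_pos by simp
  have "char_exp \<noteq> 2"
  proof
    assume "char_exp = 2"
    then have "[(2::nat)] \<cdot> \<one> = \<zero>" using nat_zero_iff_char_exp_dvd[OF 1, of 2] by simp
    then show False using assms by (simp add: numeral_2_eq_2)
  qed
  then show ?thesis using prime_odd_nat[OF prime_char_exp[OF 1]] 1 by simp
qed simp

lemma binomial_peval:
  assumes x: "x \<in> carrier R" and y: "y \<in> carrier R"
  shows "(x \<oplus> y) [^] n = peval (\<lambda>k. [(n choose k)] \<cdot> (y [^] (n - k))) (Suc n) x"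
proof (induct n)
  case (Suc n)
  let ?f = "\<lambda>k. [(n choose k)] \<cdot> (y [^] (n - k))"
  let ?s = "\<lambda>k. case k of 0 \<Rightarrow> \<zero> | Suc j \<Rightarrow> ?f j"
  have fc: "\<And>k. ?f k \<in> carrier R" using y by simp
  then have sc: "\<And>k. ?s k \<in> carrier R" by (auto split: nat.splits)
  have 1: "peval ?s (Suc (Suc n)) x = x \<otimes> peval ?f (Suc n) x"
    using peval_Suc[of ?s x "Suc n", OF sc x] fc x by simp
  have 2: "peval ?f (Suc (Suc n)) x = peval ?f (Suc n) x"
    using fc x by (intro lincomb_extend) (auto simp: binomial_eq_0)
  have "(x \<oplus> y) [^] Suc n = x \<otimes> peval ?f (Suc n) x \<oplus> y \<otimes> peval ?f (Suc n) x"
    using Suc x y fc by (simp add: m_comm l_distr del: lincomb.simps)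
  also have "\<dots> = peval ?s (Suc (Suc n)) x \<oplus> y \<otimes> peval ?f (Suc (Suc n)) x"
    unfolding 1 2 ..
  also have "\<dots> = peval (\<lambda>k. ?s k \<oplus> y \<otimes> ?f k) (Suc (Suc n)) x"
    using sc fc x y
    by (simp add: lincomb_add lincomb_smult del: lincomb.simps)
  also have "\<dots> = peval (\<lambda>k. [(Suc n choose k)] \<cdot> (y [^] (Suc n - k))) (Suc (Suc n)) x"
  proof (rule lincomb_cong)
    fix k assume "k < Suc (Suc n)"
    show "?s k \<oplus> y \<otimes> ?f k = [(Suc n choose k)] \<cdot> (y [^] (Suc n - k))"
    proof (cases k)
      case 0
      then show ?thesis using y by (simp add: m_comm)
    next
      case (Suc j)
      have "y \<otimes> ([(n choose Suc j)] \<cdot> (y [^] (n - Suc j))) = [(n choose Suc j)] \<cdot> (y [^] (n - j))"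
      proof (cases "Suc j \<le> n")
        case True
        then have "n - j = Suc (n - Suc j)" by simp
        then show ?thesis using y by (simp add: add_pow_rdistr m_comm)
      next
        case False
        then show ?thesis using y by (simp add: binomial_eq_0)
      qed
      then show ?thesis using Suc y by (simp add: add.nat_pow_mult)
    qed
  qed simp
  finally show ?case .
qed (use y in simp)

lemma frobenius_add:
  assumes x: "x \<in> carrier R" and y: "y \<in> carrier R"
  shows "(x \<oplus> y) [^] char_exp = x [^] char_exp \<oplus> y [^] char_exp"
proof (cases "char_exp = 1")
  case False
  then have 1: "1 < char_exp" using char_exp_pos by simp
  let ?f = "\<lambda>k. [(char_exp choose k)] \<cdot> (y [^] (char_exp - k))"
  have fc: "\<And>k. ?f k \<in> carrier R" using y by simp
  have z: "?f k = \<zero>" if "1 \<le> k" "k < char_exp" for k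
  proof -
    have "char_exp dvd (char_exp choose k)"
      by (rule dvd_choose_prime) (use that prime_char_exp[OF 1] in auto)
    then have "[(char_exp choose k)] \<cdot> \<one> = \<zero>" using nat_zero_iff_char_exp_dvd[OF 1] by simp
    then show ?thesis using add_pow_ldistr[of \<one> "y [^] (char_exp - k)" "char_exp choose k"] y by simp
  qed
  have "peval ?f char_exp x = peval ?f 1 x" using 1 fc x z by (intro lincomb_extend) auto
  then have "peval ?f (Suc char_exp) x = y [^] char_exp \<oplus> x [^] char_exp"
    using x y by simp
  then show ?thesis using binomial_peval[OF x y, of char_exp] x y a_comm by simp
qed (use assms in simp)

lemma frobenius_pow_add:
  assumes x: "x \<in> carrier R" and y: "y \<in> carrier R"
  shows "(x \<oplus> y) [^] (char_exp ^ e) = x [^] (char_exp ^ e) \<oplus> y [^] (char_exp ^ e)"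
proof (induct e)
  case (Suc e)
  have p: "z [^] (char_exp ^ Suc e) = (z [^] (char_exp ^ e)) [^] char_exp" if "z \<in> carrier R" for z
    using nat_pow_pow[OF that, of "char_exp ^ e" char_exp] by (simp add: mult.commute)
  show ?case using Suc x y frobenius_add[of "x [^] (char_exp ^ e)" "y [^] (char_exp ^ e)"] by (simp only: p a_closed nat_pow_closed)
qed (use assms in simp)

text \<open>The purely inseparable closure of \<open>N\<close> in the ambient field; it absorbs
  generators of which only a Frobenius power can be controlled.\<close>

definition perfect_closure_in :: "'a set \<Rightarrow> 'a set" where
  "perfect_closure_in N = {z \<in> carrier R. \<exists>e. z [^] (char_exp ^ e) \<in> N}"

lemma perfect_closure_in_raise:
  assumes N: "subring N R" and z: "z \<in> carrier R" "z [^] (char_exp ^ e) \<in> N" and "e \<le> e'"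
  shows "z [^] (char_exp ^ e') \<in> N"
proof -
  have "z [^] (char_exp ^ e') = (z [^] (char_exp ^ e)) [^] (char_exp ^ (e' - e))"
    using nat_pow_pow[OF z(1), of "char_exp ^ e" "char_exp ^ (e' - e)"] assms(4) by (simp flip: power_add)
  then show ?thesis using subring_pow[OF N z(2)] by simp
qed

lemma nat_pow_inv_nonzero:
  assumes "a \<in> carrier R" "a \<noteq> \<zero>" shows "inv a [^] (n::nat) = inv (a [^] n)"
proof -
  note i = field_inv[OF assms]
  have "a [^] n \<otimes> inv a [^] n = \<one>" using nat_pow_distrib[OF assms(1) i(1), of n] i by simp
  then show ?thesis using inv_unique_nonzero[of "a [^] n" "inv a [^] n"] assms i by simp
qed

lemma subfield_perfect_closure_in:
  assumes N: "subfield N R" shows "subfield (perfect_closure_in N) R" "N \<subseteq> perfect_closure_in N"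
proof -
  note S = subfieldE(1)[OF N] and SE = subringE[OF subfieldE(1)[OF N]]
  show "N \<subseteq> perfect_closure_in N"
  proof
    fix z assume z: "z \<in> N"
    then have "z \<in> carrier R" using SE(1) by blast
    then show "z \<in> perfect_closure_in N"
      using z unfolding perfect_closure_in_def by (auto intro!: exI[of _ 0])
  qed
  have two: "\<exists>e. x [^] (char_exp ^ e) \<in> N \<and> y [^] (char_exp ^ e) \<in> N"
    if "x \<in> perfect_closure_in N" "y \<in> perfect_closure_in N" for x y
  proof -
    note xy = that
    then have c: "x \<in> carrier R" "y \<in> carrier R" by (auto simp: perfect_closure_in_def)
    obtain e where e: "x [^] (char_exp ^ e) \<in> N" using xy(1) by (auto simp: perfect_closure_in_def)
    obtain e' where e': "y [^] (char_exp ^ e') \<in> N" using xy(2) by (auto simp: perfect_closure_in_def)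
    show ?thesis
      using perfect_closure_in_raise[OF S c(1) e, of "max e e'"] perfect_closure_in_raise[OF S c(2) e', of "max e e'"]
      by auto
  qed
  show "subfield (perfect_closure_in N) R"
  proof (rule subfieldI'[OF subringI])
    show "perfect_closure_in N \<subseteq> carrier R" by (auto simp: perfect_closure_in_def)
    show 1: "\<one> \<in> perfect_closure_in N" using SE(3) by (auto simp: perfect_closure_in_def)
    have m1: "\<ominus> \<one> \<in> perfect_closure_in N" using SE(3,5) \<open>N \<subseteq> perfect_closure_in N\<close> by auto
    fix x y assume xy: "x \<in> perfect_closure_in N" "y \<in> perfect_closure_in N"
    then obtain e where e: "x [^] (char_exp ^ e) \<in> N" "y [^] (char_exp ^ e) \<in> N" using two by blast
    have c: "x \<in> carrier R" "y \<in> carrier R" using xy by (auto simp: perfect_closure_in_def)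
    show "x \<otimes> y \<in> perfect_closure_in N"
      using e c SE(6) nat_pow_distrib[OF c] unfolding perfect_closure_in_def by (auto intro!: exI[of _ e])
    show "x \<oplus> y \<in> perfect_closure_in N"
      using e c SE(7) frobenius_pow_add[OF c] unfolding perfect_closure_in_def by (auto intro!: exI[of _ e])
  next
    fix x assume x: "x \<in> perfect_closure_in N"
    have m1: "\<ominus> \<one> \<in> perfect_closure_in N" using SE(3,5) \<open>N \<subseteq> perfect_closure_in N\<close> by auto
    obtain e where e: "x [^] (char_exp ^ e) \<in> N" "(\<ominus> \<one>) [^] (char_exp ^ e) \<in> N" using two[OF x m1] by blast
    have c: "x \<in> carrier R" using x by (auto simp: perfect_closure_in_def)
    \<comment> \<open>Negation is reduced to a product, which avoids a case distinction on the sign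
      of a power.\<close>
    have "\<ominus> x = x \<otimes> \<ominus> \<one>" using c by (simp add: r_minus)
    then show "\<ominus> x \<in> perfect_closure_in N"
      using e c SE(6) nat_pow_distrib[OF c, of "\<ominus> \<one>"] unfolding perfect_closure_in_def
      by (auto intro!: exI[of _ e])
  next
    fix x assume x: "x \<in> perfect_closure_in N - {\<zero>}"
    then obtain e where e: "x [^] (char_exp ^ e) \<in> N" "x \<in> carrier R" "x \<noteq> \<zero>" by (auto simp: perfect_closure_in_def)
    have "x [^] (char_exp ^ e) \<noteq> \<zero>" using nat_pow_nonzero[OF e(2,3)] .
    then have "inv (x [^] (char_exp ^ e)) \<in> N" using subfield_m_inv(1)[OF N] e(1) by blast
    then have "inv x [^] (char_exp ^ e) \<in> N" using nat_pow_inv_nonzero[OF e(2,3)] by simp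
    then show "inv x \<in> perfect_closure_in N" using field_inv[OF e(2,3)] by (auto simp: perfect_closure_in_def)
  qed
qed

lemma peval_multiples:
  assumes f: "\<And>i. f i \<in> carrier R" and x: "x \<in> carrier R" and p: "0 < p"
    and z: "\<And>i. \<lbrakk> i \<le> p * m; f i \<noteq> \<zero> \<rbrakk> \<Longrightarrow> p dvd i"
  shows "peval f (Suc (p * m)) x = peval (\<lambda>j. f (p * j)) (Suc m) (x [^] p)"
  using z
proof (induct m)
  case 0
  then show ?case using f x by simp
next
  case (Suc m)
  have "peval f (p * Suc m) x = peval f (Suc (p * m)) x"
  proof (rule lincomb_extend)
    fix i assume i: "Suc (p * m) \<le> i" "i < p * Suc m"
    have "\<not> p dvd i"
    proof
      assume "p dvd i"
      then obtain k where k: "i = p * k" by blast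
      then have "m < k" "k < Suc m" using i p by (metis Suc_le_eq mult_less_cancel1, metis mult_less_cancel1)
      then show False by simp
    qed
    then show "f i = \<zero>" using Suc(2)[of i] i(2) by auto
  qed (use f x p in auto)
  also have "\<dots> = peval (\<lambda>j. f (p * j)) (Suc m) (x [^] p)"
    using Suc(2) by (intro Suc(1)) auto
  finally have 1: "peval f (p * Suc m) x = peval (\<lambda>j. f (p * j)) (Suc m) (x [^] p)" .
  have 2: "(x [^] p) [^] Suc m = x [^] (p * Suc m)" by (rule nat_pow_pow[OF x])
  have "peval f (Suc (p * Suc m)) x = peval f (p * Suc m) x \<oplus> f (p * Suc m) \<otimes> x [^] (p * Suc m)" by simp
  also have "\<dots> = peval (\<lambda>j. f (p * j)) (Suc (Suc m)) (x [^] p)"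
    unfolding 1 2[symmetric] by (rule lincomb.simps(2)[symmetric])
  finally show ?case .
qed

text \<open>Among all relations satisfied by some \<open>\<beta> [^] (char_exp ^ e)\<close>, one of least degree has a simple root
  there: a vanishing derivative would make it a polynomial in the next Frobenius power.\<close>

lemma exists_separable_power:
  assumes N: "subfield N R" and \<beta>: "\<beta> \<in> carrier R" "alg_rel N \<beta>"
  obtains e f n q where "\<And>i. f i \<in> N" "f n \<noteq> \<zero>" "0 < n" "\<And>i. q i \<in> carrier R" "q (n - 1) \<noteq> \<zero>"
    "\<And>x. x \<in> carrier R \<Longrightarrow> peval f (Suc n) x = (x \<ominus> \<beta> [^] (char_exp ^ e)) \<otimes> peval q n x"
    "peval q n (\<beta> [^] (char_exp ^ e)) \<noteq> \<zero>"
    "\<forall>g m. (\<forall>i. g i \<in> N) \<longrightarrow> g m \<noteq> \<zero> \<longrightarrow> peval g (Suc m) (\<beta> [^] (char_exp ^ e)) = \<zero> \<longrightarrow> n \<le> m"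
proof -
  note S = subfieldE(1)[OF N] and SE = subringE[OF subfieldE(1)[OF N]]
  let ?Q = "\<lambda>n. \<exists>e f. (\<forall>i. f i \<in> N) \<and> f n \<noteq> \<zero> \<and> peval f (Suc n) (\<beta> [^] (char_exp ^ e)) = \<zero>"
  have "\<exists>n. ?Q n"
  proof (cases "\<beta> = \<zero>")
    case True
    have "peval (\<lambda>i. if i = 0 then \<zero> else \<one>) (Suc 1) (\<beta> [^] (char_exp ^ 0)) = \<zero>" using True by simp
    then show ?thesis using SE(2,3)
      by (intro exI[of _ 1] exI[of _ 0] exI[of _ "\<lambda>i. if i = 0 then \<zero> else \<one>"]) auto
  next
    case False
    obtain f n where "\<And>i. f i \<in> N" "f 0 \<noteq> \<zero>" "f n \<noteq> \<zero>" "peval f (Suc n) \<beta> = \<zero>"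
      using alg_rel_trim[OF S \<beta>(1) False \<beta>(2)] by blast
    then show ?thesis using \<beta>(1) by (intro exI[of _ n] exI[of _ 0] exI[of _ f]) auto
  qed
  define n where "n = (LEAST n. ?Q n)"
  have Qn: "?Q n" unfolding n_def by (rule LeastI_ex) fact
  have least: "n \<le> m" if "?Q m" for m unfolding n_def by (rule Least_le) (rule that)
  obtain e f where f: "\<And>i. f i \<in> N" "f n \<noteq> \<zero>" "peval f (Suc n) (\<beta> [^] (char_exp ^ e)) = \<zero>"
    using Qn by blast
  define \<gamma> where "\<gamma> = \<beta> [^] (char_exp ^ e)"
  have \<gamma>: "\<gamma> \<in> carrier R" using \<beta> by (simp add: \<gamma>_def)
  have fc: "\<And>i. f i \<in> carrier R" using f(1) SE(1) by blast
  have n0: "0 < n"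
  proof (rule ccontr)
    assume "\<not> 0 < n"
    then show False using f(2,3) fc by simp
  qed
  obtain q where q: "\<And>i. q i \<in> carrier R"
    "\<And>x. x \<in> carrier R \<Longrightarrow> peval f (Suc n) x = (x \<ominus> \<gamma>) \<otimes> peval q n x \<oplus> peval f (Suc n) \<gamma>"
    "peval q n \<gamma> = peval (\<lambda>i. [Suc i] \<cdot> f (Suc i)) n \<gamma>" "0 < n \<Longrightarrow> q (n - 1) = f n"
    by (rule peval_quotient[of "carrier R" f \<gamma> n, OF carrier_is_subring fc \<gamma>]) (rule that)
  have "peval q n \<gamma> \<noteq> \<zero>"
  proof
    assume "peval q n \<gamma> = \<zero>"
    then have d: "peval (\<lambda>i. [Suc i] \<cdot> f (Suc i)) n \<gamma> = \<zero>" using q(3) by simp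
    have "[k] \<cdot> y \<in> N" if "y \<in> N" for k :: nat and y
      using that SE(2,7) by (induct k) auto
    then have dN: "[Suc i] \<cdot> f (Suc i) \<in> N" for i using f(1) by blast
    \<comment> \<open>The derivative has coefficients in \<open>N\<close> and formal degree below
      \<open>n\<close>; since it vanishes at \<gamma>, minimality of \<open>n\<close> leaves no
      nonzero coefficient.\<close>
    have dz: "[Suc i] \<cdot> f (Suc i) = \<zero>" if "i < n" for i
    proof (rule ccontr)
      assume nz: "[Suc i] \<cdot> f (Suc i) \<noteq> \<zero>"
      define t where "t = Max {i. i < n \<and> [Suc i] \<cdot> f (Suc i) \<noteq> \<zero>}"
      have ne: "{i. i < n \<and> [Suc i] \<cdot> f (Suc i) \<noteq> \<zero>} \<noteq> {}" "finite {i. i < n \<and> [Suc i] \<cdot> f (Suc i) \<noteq> \<zero>}"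
        using nz that by auto
      have t: "t < n" "[Suc t] \<cdot> f (Suc t) \<noteq> \<zero>" using Max_in[OF ne(2,1)] unfolding t_def by blast+
      have t': "[Suc j] \<cdot> f (Suc j) = \<zero>" if "t < j" "j < n" for j
        using Max_ge[OF ne(2), of j] that unfolding t_def by (metis (mono_tags, lifting) mem_Collect_eq not_le)
      have "peval (\<lambda>i. [Suc i] \<cdot> f (Suc i)) n \<gamma> = peval (\<lambda>i. [Suc i] \<cdot> f (Suc i)) (Suc t) \<gamma>"
      proof (rule lincomb_extend)
        show "Suc t \<le> n" using t by simp
        show "[Suc i] \<cdot> f (Suc i) \<in> carrier R" for i using fc by simp
        show "\<gamma> [^] i \<in> carrier R" for i :: nat using \<gamma> by simp
        show "[Suc i] \<cdot> f (Suc i) = \<zero>" if "Suc t \<le> i" "i < n" for i using t' that by simp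
      qed
      then have "peval (\<lambda>i. [Suc i] \<cdot> f (Suc i)) (Suc t) \<gamma> = \<zero>" using d by simp
      then have "?Q t" using dN t(2) unfolding \<gamma>_def
        by (intro exI[of _ e] exI[of _ "\<lambda>i. [Suc i] \<cdot> f (Suc i)"]) blast
      then show False using least t(1) by fastforce
    qed
    \<comment> \<open>A coefficient \<open>f i\<close> survives only if \<open>i\<close> is zero in
      the field. The top one does survive, so the characteristic is positive and divides all
      exponents that occur.\<close>
    have fz: "f i = \<zero> \<or> [i] \<cdot> \<one> = \<zero>" if i: "1 \<le> i" "i \<le> n" for i
    proof -
      obtain j where j: "i = Suc j" using i by (cases i) auto
      have "([i] \<cdot> \<one>) \<otimes> f i = \<zero>" using dz[of j] add_pow_ldistr[of \<one> "f i" i] fc i j by simp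
      then show ?thesis using integral[of "[i] \<cdot> \<one>" "f i"] fc by auto
    qed
    have "[n] \<cdot> \<one> = \<zero>" using fz[of n] f(2) n0 by auto
    then have P: "1 < char_exp" using nat_nonzero_char_exp_one[of n] n0 char_exp_pos by (cases "char_exp = 1") auto
    have dv: "char_exp dvd i" if "f i \<noteq> \<zero>" "i \<le> n" for i
      using fz[of i] that nat_zero_iff_char_exp_dvd[OF P, of i] by (cases "i = 0") auto
    obtain m where m: "n = char_exp * m" using dv[of n] f(2) by blast
    have mn: "m < n" using m n0 mult_strict_right_mono[OF P, of m] by (cases "m = 0") auto
    have "peval (\<lambda>j. f (char_exp * j)) (Suc m) (\<gamma> [^] char_exp) = peval f (Suc n) \<gamma>"
      unfolding m by (rule peval_multiples[symmetric]) (use fc \<gamma> char_exp_pos dv m in auto)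
    also have "\<dots> = \<zero>" using f(3) by (simp add: \<gamma>_def)
    finally have "peval (\<lambda>j. f (char_exp * j)) (Suc m) (\<gamma> [^] char_exp) = \<zero>" .
    moreover have "\<gamma> [^] char_exp = \<beta> [^] (char_exp ^ Suc e)"
      unfolding \<gamma>_def using nat_pow_pow[OF \<beta>(1), of "char_exp ^ e" char_exp] by (simp add: mult.commute)
    ultimately have "?Q m" using f(1,2) m
      by (intro exI[of _ "Suc e"] exI[of _ "\<lambda>j. f (char_exp * j)"]) simp
    then show False using least mn by fastforce
  qed
  then have nz: "peval q n (\<beta> [^] (char_exp ^ e)) \<noteq> \<zero>" by (simp add: \<gamma>_def)
  show ?thesis
  proof (rule that[of f n q e])
    show "f i \<in> N" "q i \<in> carrier R" for i by (rule f(1), rule q(1))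
    show "f n \<noteq> \<zero>" "0 < n" "peval q n (\<beta> [^] (char_exp ^ e)) \<noteq> \<zero>" by (rule f(2), rule n0, rule nz)
    show "q (n - 1) \<noteq> \<zero>" using q(4)[OF n0] f(2) by simp
    show "peval f (Suc n) x = (x \<ominus> \<beta> [^] (char_exp ^ e)) \<otimes> peval q n x" if "x \<in> carrier R" for x
      using q(2)[OF that] f(3) that q(1) \<gamma> unfolding \<gamma>_def[symmetric] by (simp del: lincomb.simps)
    show "\<forall>g m. (\<forall>i. g i \<in> N) \<longrightarrow> g m \<noteq> \<zero> \<longrightarrow> peval g (Suc m) (\<beta> [^] (char_exp ^ e)) = \<zero> \<longrightarrow> n \<le> m"
      using least by blast
  qed
qed

text \<open>Cancelling the lower of two different powers would make a unit a multiple of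
  \<open>p\<close>.\<close>

lemma vunit_pow_eq_imp_eq:
  assumes V: "subring V R" and p: "small V p" "p \<noteq> \<zero>" and u: "vunit V u" "vunit V v"
    and e: "p [^] (a::nat) \<otimes> u = p [^] (b::nat) \<otimes> v"
  shows "a = b"
proof -
  note SE = subringE[OF V]
  have aux: "\<not> a < b" if u: "vunit V u" "vunit V v" and e: "p [^] (a::nat) \<otimes> u = p [^] (b::nat) \<otimes> v" for a b u v
  proof
    assume "a < b"
    then obtain k where k: "b = a + Suc k" using less_imp_Suc_add by auto
    have c: "p \<in> carrier R" "u \<in> carrier R" "v \<in> carrier R" "p \<in> V" "v \<in> V"
      using p u SE(1) by (auto simp: small_def vunit_def)
    have "p [^] b = p [^] a \<otimes> p [^] Suc k" unfolding k by (rule nat_pow_mult[OF c(1), symmetric])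
    then have "p [^] a \<otimes> u = p [^] a \<otimes> (p [^] Suc k \<otimes> v)" using e c by (simp add: m_assoc)
    then have "u = p [^] Suc k \<otimes> v"
      using m_lcancel[OF nat_pow_nonzero[OF c(1) p(2), of a] nat_pow_closed[OF c(1)] c(2)] c by simp
    also have "\<dots> = p \<otimes> (p [^] k \<otimes> v)" using c by (simp add: m_ac)
    finally have "small V u" using small_mult[OF V p(1), of "p [^] k \<otimes> v"] subring_pow[OF V c(4)] c(5) SE(6) by simp
    then show False using u by (simp add: small_def)
  qed
  show ?thesis using aux[OF u e] aux[OF u(2,1) e[symmetric]] by simp
qed

end

section \<open>Uniformizers\<close>

context constants
begin

context
  fixes d V assumes d: "d \<in> C" and pl: "place d V"
begin

abbreviation (input) p where "p \<equiv> \<alpha> \<ominus> d"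

lemmas V' = V[OF d pl] and VE' = VE[OF d pl]
lemmas p = \<alpha>_minus_nonzero[OF d]

text \<open>The maximal ideal of the local ring \<open>N \<inter> V\<close> is generated by
  \<open>p\<close>: a nonzero element of it is a positive power of \<open>p\<close> times a unit,
  and the quotient by \<open>p\<close> is again in the field \<open>N\<close>.\<close>

lemma small_in_uniformized:
  assumes N: "subfield N L" "C \<subseteq> N" "\<alpha> \<in> N" and u: "uniformized V p N" and x: "x \<in> N" "small V x"
  shows "\<exists>r \<in> N \<inter> V. x = p \<otimes> r"
proof (cases "x = \<zero>")
  case True
  then show ?thesis using p subringE(2)[OF subfieldE(1)[OF N(1)]] VE'(2) by (intro bexI[of _ \<zero>]) auto
next
  case False
  note NE = subringE[OF subfieldE(1)[OF N(1)]]
  have pN: "p \<in> N" using N d subring_minus[OF subfieldE(1)[OF N(1)]] by blast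
  have xc: "x \<in> carrier L" "x \<in> V" using x NE(1) by (auto simp: small_def)
  obtain k l w where w: "vunit V w" "x \<otimes> p [^] (k::nat) = p [^] (l::nat) \<otimes> w"
    using u x(1) False unfolding uniformized_def by blast
  have wc: "w \<in> carrier L" "w \<in> V" using w VE'(1) by (auto simp: vunit_def)
  have pV: "p \<in> V" using V'(5) by (simp add: small_def)
  have kl: "k < l"
  proof (rule ccontr)
    assume "\<not> k < l"
    then have "p [^] k = p [^] l \<otimes> p [^] (k - l)" using nat_pow_mult[OF p(1), of l "k - l"] by simp
    then have "p [^] l \<otimes> (x \<otimes> p [^] (k - l)) = p [^] l \<otimes> w" using w(2) xc p by (simp add: m_lcomm)
    then have "x \<otimes> p [^] (k - l) = w"
      using m_lcancel[OF nat_pow_nonzero[OF p, of l] nat_pow_closed[OF p(1)]] xc wc p by simp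
    then have "small V w" using small_mult[OF V'(2) x(2) subring_pow[OF V'(2) pV, of "k - l"]] by simp
    then show False using w(1) by (simp add: small_def)
  qed
  then obtain j where j: "l = k + Suc j" using less_imp_Suc_add by auto
  have "p [^] l = p [^] k \<otimes> (p [^] j \<otimes> p)" unfolding j using nat_pow_mult[OF p(1), of k "Suc j"] by simp
  then have "p [^] k \<otimes> x = p [^] k \<otimes> (p \<otimes> (p [^] j \<otimes> w))" using w(2) xc wc p by (simp add: m_ac)
  then have e: "x = p \<otimes> (p [^] j \<otimes> w)"
    using m_lcancel[OF nat_pow_nonzero[OF p, of k] nat_pow_closed[OF p(1)]] xc wc p by simp
  have "p [^] j \<otimes> w = (inv p \<otimes> p) \<otimes> (p [^] j \<otimes> w)" using field_inv[OF p] wc p by simp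
  also have "\<dots> = inv p \<otimes> x" unfolding e using field_inv(1)[OF p] wc p by (simp add: m_assoc)
  also have "\<dots> \<in> N" using NE(6) x(1) subfield_m_inv(1)[OF N(1), of p] pN p by blast
  finally have "p [^] j \<otimes> w \<in> N" .
  then show ?thesis using e subring_pow[OF V'(2) pV, of j] wc VE'(6) by (intro bexI[of _ "p [^] j \<otimes> w"]) auto
qed

lemma small_peval_diff:
  assumes g: "\<And>i. g i \<in> V" and x: "x \<in> V" "b \<in> V" "small V (x \<ominus> b)"
  shows "small V (peval g n x \<ominus> peval g n b)"
proof (cases n)
  case 0
  then show ?thesis using small_zero[OF V'(2)] by (simp add: minus_eq)
next
  case (Suc m)
  obtain q where q: "\<And>i. q i \<in> V"
    "\<And>x. x \<in> carrier L \<Longrightarrow> peval g (Suc m) x = (x \<ominus> b) \<otimes> peval q m x \<oplus> peval g (Suc m) b"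
    "peval q m b = peval (\<lambda>i. [Suc i] \<cdot> g (Suc i)) m b" "0 < m \<Longrightarrow> q (m - 1) = g m"
    by (rule peval_quotient[of V g b m, OF V'(2) g x(2)]) (rule that)
  have qV: "peval q m x \<in> V" by (rule peval_in_subring[OF V'(2) q(1) x(1)])
  have gV: "peval g (Suc m) b \<in> V" by (rule peval_in_subring[OF V'(2) g x(2)])
  have c: "x \<in> carrier L" "b \<in> carrier L" "peval q m x \<in> carrier L" "peval g (Suc m) b \<in> carrier L"
    using x qV gV VE'(1) by blast+
  have e: "((x \<ominus> b) \<otimes> Q \<oplus> G) \<ominus> G = (x \<ominus> b) \<otimes> Q" if "Q \<in> carrier L" "G \<in> carrier L" for Q G
    using c(1,2) that by algebra
  have "peval g (Suc m) x \<ominus> peval g (Suc m) b = (x \<ominus> b) \<otimes> peval q m x"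
    unfolding q(2)[OF c(1)] by (rule e[OF c(3,4)])
  then show ?thesis using small_mult[OF V'(2) x(3) qV] Suc by simp
qed

text \<open>The local ring at the place is obtained from \<open>N \<inter> V\<close> by adjoining \<open>\<beta>\<close>; since \<open>\<beta>\<close> is a simple
  root modulo the place, its maximal ideal is still generated by \<open>p\<close>.\<close>

lemma uniformized_adjoin:
  assumes N: "subfield N L" "C \<subseteq> N" "\<alpha> \<in> N" and uN: "uniformized V p N"
    and \<beta>: "\<beta> \<in> V" and f: "\<And>i. f i \<in> N" "\<And>i. f i \<in> V" and g: "\<And>i. g i \<in> V"
    and fg: "\<And>x. x \<in> carrier L \<Longrightarrow> peval f (Suc n) x = (x \<ominus> \<beta>) \<otimes> peval g n x"
    and ug: "vunit V (peval g n \<beta>)"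
  shows "uniformized V p (generate_field L (insert \<beta> N))"
proof -
  note NE = subringE[OF subfieldE(1)[OF N(1)]]
  let ?O = "N \<inter> V"
  have O: "subring ?O L" by (rule subring_inter[OF subfieldE(1)[OF N(1)] V'(2)])
  note OE = subringE[OF O]
  have \<beta>c: "\<beta> \<in> carrier L" using \<beta> VE'(1) by blast
  have pO: "p \<in> ?O" using V'(3,4) N d by (intro subring_minus[OF O]) auto
  \<comment> \<open>All elements of this ring lie in \<open>V\<close>, but it need not be local;
    units of \<open>V\<close> that lie in \<open>W\<close> are therefore carried along as
    multipliers instead of being inverted.\<close>
  define W where "W = simple_extension ?O \<beta>"
  have W: "subring W L" "?O \<subseteq> W" "\<beta> \<in> W" "W \<subseteq> V"
    unfolding W_def using simple_extension_is_subring[OF O \<beta>c] simple_extension_incl[OF OE(1) \<beta>c]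
      simple_extension_mem[OF O \<beta>c] simple_extension_subring_incl[OF V'(2) _ \<beta>, of ?O] by auto
  note WE = subringE[OF W(1)]
  obtain b where b: "b \<in> C" "small V (\<beta> \<ominus> b)" using exists_residue[OF d pl \<beta>] by blast
  have bO: "b \<in> ?O" using b N V'(3) by blast
  have bc: "b \<in> carrier L" using bO OE(1) by blast
  \<comment> \<open>For the residue \<open>b\<close> of \<beta>, the difference \<beta> - b is a
    multiple of \<open>p\<close> up to a unit: adjoining \<beta> causes no ramification.\<close>
  have "\<exists>s r. s \<in> W \<and> vunit V s \<and> r \<in> W \<and> s \<otimes> (\<beta> \<ominus> b) = p \<otimes> r"
  proof (cases "\<beta> = b")
    case True
    then show ?thesis using WE(2,3) vunit_one[OF V'(2)] bc p
      by (intro exI[of _ \<one>] exI[of _ \<zero>]) auto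
  next
    case False
    have fO: "\<And>i. f i \<in> ?O" using f by blast
    \<comment> \<open>A second division of \<open>f\<close>, now by X - b: the coefficients of
      \<open>g\<close> lie in \<open>V\<close>, whereas those of \<open>q\<close> lie in
      \<open>N \<inter> V\<close>, so that q(\<beta>) is in \<open>W\<close>. For \<beta> and
      \<open>b\<close> distinct, q(\<beta>) and g(b) are the same difference quotient of
      \<open>f\<close>, and g(b) is a unit because g(\<beta>) is.\<close>
    obtain q where q: "\<And>i. q i \<in> ?O"
      "\<And>x. x \<in> carrier L \<Longrightarrow> peval f (Suc n) x = (x \<ominus> b) \<otimes> peval q n x \<oplus> peval f (Suc n) b"
      "peval q n b = peval (\<lambda>i. [Suc i] \<cdot> f (Suc i)) n b" "0 < n \<Longrightarrow> q (n - 1) = f n"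
      by (rule peval_quotient[of ?O f b n, OF O fO bO]) (rule that)
    let ?s = "peval q n \<beta>" and ?G = "peval g n b" and ?fb = "peval f (Suc n) b"
    have sW: "?s \<in> W" by (rule peval_in_subring[OF W(1) _ W(3)]) (use q(1) W(2) in blast)
    have GV: "?G \<in> V" by (rule peval_in_subring[OF V'(2) g]) (use bO in blast)
    have g\<beta>V: "peval g n \<beta> \<in> V" by (rule peval_in_subring[OF V'(2) g \<beta>])
    have fbO: "?fb \<in> ?O" by (rule peval_in_subring[OF O fO bO])
    have c: "?s \<in> carrier L" "?G \<in> carrier L" "?fb \<in> carrier L" "peval g n \<beta> \<in> carrier L"
      using sW WE(1) GV VE'(1) fbO OE(1) g\<beta>V by blast+
    have "peval f (Suc n) \<beta> = \<zero>" unfolding fg[OF \<beta>c] using \<beta>c c by (simp add: r_neg minus_eq)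
    then have 1: "(\<beta> \<ominus> b) \<otimes> ?s = \<ominus> ?fb"
      using q(2)[OF \<beta>c] c \<beta>c bc minus_equality[of "(\<beta> \<ominus> b) \<otimes> ?s" ?fb] by simp
    have 2: "?fb = \<ominus> ((\<beta> \<ominus> b) \<otimes> ?G)"
    proof -
      have "(b \<ominus> \<beta>) \<otimes> G = \<ominus> ((\<beta> \<ominus> b) \<otimes> G)" if "G \<in> carrier L" for G
        using that bc \<beta>c by algebra
      then show ?thesis unfolding fg[OF bc] using c by blast
    qed
    then have "(\<beta> \<ominus> b) \<otimes> ?s = (\<beta> \<ominus> b) \<otimes> ?G" using 1 c bc \<beta>c by simp
    moreover have "\<beta> \<ominus> b \<noteq> \<zero>" using False bc \<beta>c by simp
    ultimately have sG: "?s = ?G" using m_lcancel[of "\<beta> \<ominus> b" ?s ?G] c bc \<beta>c by simp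
    have "small V (peval g n \<beta> \<ominus> ?G)" by (rule small_peval_diff[OF g \<beta> _ b(2)]) (use bO in blast)
    then have "small V (\<ominus> (peval g n \<beta> \<ominus> ?G))" by (rule small_minus[OF V'(2)])
    from vunit_add_small[OF V'(1) ug this] have us: "vunit V ?s"
    proof -
      have "S \<oplus> \<ominus> (S \<ominus> Y) = Y" if "S \<in> carrier L" "Y \<in> carrier L" for S Y using that by algebra
      then show ?thesis using vunit_add_small[OF V'(1) ug \<open>small V (\<ominus> (peval g n \<beta> \<ominus> ?G))\<close>] c sG by simp
    qed
    have "small V ((\<beta> \<ominus> b) \<otimes> ?G)" by (rule small_mult[OF V'(2) b(2) GV])
    then have "small V ?fb" unfolding 2 by (rule small_minus[OF V'(2)])
    then obtain r where r: "r \<in> ?O" "?fb = p \<otimes> r" using small_in_uniformized[OF N uN _] fbO by blast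
    have rc: "r \<in> carrier L" using r OE(1) by blast
    have "?s \<otimes> (\<beta> \<ominus> b) = p \<otimes> \<ominus> r"
      using 1 r(2) rc p c \<beta>c bc m_comm[of ?s "\<beta> \<ominus> b"] by (simp add: r_minus)
    then show ?thesis using sW us r(1) W(2) WE(5) by blast
  qed
  then obtain s0 r0 where sr: "s0 \<in> W" "vunit V s0" "r0 \<in> W" "s0 \<otimes> (\<beta> \<ominus> b) = p \<otimes> r0" by blast
  have sr_c: "s0 \<in> carrier L" "r0 \<in> carrier L" using sr WE(1) by blast+
  \<comment> \<open>Every element of \<open>W\<close> is congruent to a constant modulo
    \<open>p\<close>, up to a multiplier that is a unit of \<open>V\<close>; the property is
    inherited along Horner's scheme.\<close>
  have claim1: "\<exists>c\<in>C. \<exists>s r. s \<in> W \<and> vunit V s \<and> r \<in> W \<and> s \<otimes> (y \<ominus> c) = p \<otimes> r" if y: "y \<in> W" for y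
    using y unfolding W_def
  proof (induct rule: simple_extension.induct)
    case zero
    show ?case unfolding W_def[symmetric] using WE(2,3) vunit_one[OF V'(2)] p CE(2)
      by (intro bexI[of _ \<zero>] exI[of _ \<one>] exI[of _ \<zero>]) (auto simp: minus_eq)
  next
    case (lin k1 k2)
    have k1: "k1 \<in> W" using lin(1) by (simp add: W_def)
    obtain c1 s1 r1 where 1: "c1 \<in> C" "s1 \<in> W" "vunit V s1" "r1 \<in> W" "s1 \<otimes> (k1 \<ominus> c1) = p \<otimes> r1"
      using lin(2) by (auto simp: W_def)
    have k2: "k2 \<in> N" "k2 \<in> V" using lin(3) by auto
    obtain c2 where c2: "c2 \<in> C" "small V (k2 \<ominus> c2)" using exists_residue[OF d pl k2(2)] by blast
    have "k2 \<ominus> c2 \<in> N" using subring_minus[OF subfieldE(1)[OF N(1)]] k2 c2 N by blast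
    then obtain r2 where r2: "r2 \<in> ?O" "k2 \<ominus> c2 = p \<otimes> r2"
      using small_in_uniformized[OF N uN _ c2(2)] by blast
    have c: "k1 \<in> carrier L" "c1 \<in> carrier L" "s1 \<in> carrier L" "r1 \<in> carrier L" "k2 \<in> carrier L"
      "c2 \<in> carrier L" "r2 \<in> carrier L"
      using k1 1 k2 c2 r2 WE(1) NE(1) CE(1) by blast+
    have e: "(s0 \<otimes> s1) \<otimes> ((k1 \<otimes> \<beta> \<oplus> k2) \<ominus> (c1 \<otimes> b \<oplus> c2))
      = s0 \<otimes> (s1 \<otimes> (k1 \<ominus> c1)) \<otimes> \<beta> \<oplus> s1 \<otimes> c1 \<otimes> (s0 \<otimes> (\<beta> \<ominus> b)) \<oplus> s0 \<otimes> s1 \<otimes> (k2 \<ominus> c2)"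
      using c sr_c \<beta>c bc by algebra
    have e': "s0 \<otimes> (p \<otimes> r1) \<otimes> \<beta> \<oplus> s1 \<otimes> c1 \<otimes> (p \<otimes> r0) \<oplus> s0 \<otimes> s1 \<otimes> (p \<otimes> r2)
      = p \<otimes> (s0 \<otimes> r1 \<otimes> \<beta> \<oplus> s1 \<otimes> c1 \<otimes> r0 \<oplus> s0 \<otimes> s1 \<otimes> r2)" if "p \<in> carrier L" for p
      using c sr_c \<beta>c bc that by algebra
    have "(s0 \<otimes> s1) \<otimes> ((k1 \<otimes> \<beta> \<oplus> k2) \<ominus> (c1 \<otimes> b \<oplus> c2))
      = p \<otimes> (s0 \<otimes> r1 \<otimes> \<beta> \<oplus> s1 \<otimes> c1 \<otimes> r0 \<oplus> s0 \<otimes> s1 \<otimes> r2)"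
      unfolding e 1(5) sr(4) r2(2) using e' p by blast
    moreover have "c1 \<in> W" using 1(1) N V'(3) W(2) by blast
    then have "s0 \<otimes> r1 \<otimes> \<beta> \<oplus> s1 \<otimes> c1 \<otimes> r0 \<oplus> s0 \<otimes> s1 \<otimes> r2 \<in> W" "s0 \<otimes> s1 \<in> W"
      using sr 1 W(2,3) r2(1) WE(6,7) by (simp_all add: subset_iff)
    moreover have "c1 \<otimes> b \<oplus> c2 \<in> C" using 1 b c2 CE(6,7) by simp
    ultimately show ?case unfolding W_def[symmetric] using vunit_mult[OF V'(2) sr(2) 1(3)] by blast
  qed
  \<comment> \<open>Division by \<open>p\<close> is repeated until the constant of
    \<open>claim1\<close> is nonzero, which makes the quotient a unit. Otherwise it would go on
    forever, against the bound from \<open>divides_power\<close>.\<close>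
  have claim2: "\<exists>l s r. s \<in> W \<and> vunit V s \<and> vunit V r \<and> s \<otimes> y = p [^] (l::nat) \<otimes> r"
    if y: "y \<in> W" "y \<noteq> \<zero>" for y
  proof (rule ccontr)
    assume no: "\<not> ?thesis"
    have yc: "y \<in> carrier L" using y WE(1) by blast
    have st: "\<exists>s r. s \<in> W \<and> vunit V s \<and> r \<in> W \<and> s \<otimes> y = p [^] (j::nat) \<otimes> r" for j
    proof (induct j)
      case 0
      show ?case using WE(3) vunit_one[OF V'(2)] y yc by (intro exI[of _ \<one>] exI[of _ y]) auto
    next
      case (Suc j)
      then obtain s r where s: "s \<in> W" "vunit V s" "r \<in> W" "s \<otimes> y = p [^] j \<otimes> r" by blast
      obtain c s' r' where c: "c \<in> C" "s' \<in> W" "vunit V s'" "r' \<in> W" "s' \<otimes> (r \<ominus> c) = p \<otimes> r'"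
        using claim1[OF s(3)] by blast
      have cc: "s \<in> carrier L" "r \<in> carrier L" "c \<in> carrier L" "s' \<in> carrier L" "r' \<in> carrier L"
        using s c WE(1) CE(1) by blast+
      have "c = \<zero>"
      proof (rule ccontr)
        assume cz: "c \<noteq> \<zero>"
        have "small V (p \<otimes> r')" using small_mult[OF V'(2,5)] c(4) W(4) by blast
        then have "small V (p \<otimes> r' \<otimes> inv s')" using small_mult[OF V'(2)] c(3) by (simp add: vunit_def)
        moreover have "p \<otimes> r' \<otimes> inv s' = (s' \<otimes> (r \<ominus> c)) \<otimes> inv s'" unfolding c(5) ..
        moreover have "(s' \<otimes> (r \<ominus> c)) \<otimes> inv s' = (s' \<otimes> inv s') \<otimes> (r \<ominus> c)"
          using cc c(3) VE'(1) field_inv(1)[of s'] by (simp add: vunit_def m_ac)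
        moreover have "s' \<otimes> inv s' = \<one>" using cc c(3) field_inv(3)[of s'] by (simp add: vunit_def)
        ultimately have "small V (r \<ominus> c)" using cc by simp
        then have "vunit V r" using vunit_of_residue[OF d pl c(1) cz] s(3) W(4) by blast
        then show False using no s by blast
      qed
      then have "s' \<otimes> r = p \<otimes> r'" using c(5) cc by (simp add: minus_eq)
      then have "(s \<otimes> s') \<otimes> y = p [^] Suc j \<otimes> r'"
      proof -
        have "(s \<otimes> s') \<otimes> y = s' \<otimes> (s \<otimes> y)" using cc yc by (simp add: m_ac)
        also have "\<dots> = p [^] j \<otimes> (s' \<otimes> r)" unfolding s(4) using cc p by (simp add: m_lcomm)
        also have "\<dots> = p [^] Suc j \<otimes> r'" unfolding \<open>s' \<otimes> r = p \<otimes> r'\<close> using cc p by (simp add: m_assoc)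
        finally show ?thesis .
      qed
      then show ?case using WE(6)[OF s(1) c(2)] vunit_mult[OF V'(2) s(2) c(3)] c(4) by blast
    qed
    obtain k z where z: "z \<in> V" "p [^] (k::nat) = y \<otimes> z" using divides_power[OF d pl _ y(2)] y(1) W(4) by blast
    \<comment> \<open>One division more than the exponent \<open>k\<close> allows turns the unit
      \<open>s\<close> into a multiple of \<open>p\<close>.\<close>
    obtain s r where s: "s \<in> W" "vunit V s" "r \<in> W" "s \<otimes> y = p [^] Suc k \<otimes> r" using st by blast
    have cc: "s \<in> carrier L" "r \<in> carrier L" "z \<in> carrier L" using s z WE(1) VE'(1) by blast+
    have "p [^] k \<otimes> s = (s \<otimes> y) \<otimes> z" unfolding z(2) using cc yc by (simp add: m_ac)
    also have "\<dots> = p [^] k \<otimes> (p \<otimes> (r \<otimes> z))" unfolding s(4) using cc p by (simp add: m_assoc)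
    finally have "s = p \<otimes> (r \<otimes> z)"
      using m_lcancel[OF nat_pow_nonzero[OF p, of k] nat_pow_closed[OF p(1)]] cc p by simp
    moreover have "r \<otimes> z \<in> V" using s(3) W(4) z VE'(6) by blast
    ultimately have "small V s" using small_mult[OF V'(2,5)] by metis
    then show False using s(2) by (simp add: small_def)
  qed
  \<comment> \<open>Denominators of coefficients from \<open>N\<close> are powers of
    \<open>p\<close> up to units, and a power of \<open>p\<close> clears them.\<close>
  have claim3: "\<exists>k. p [^] (k::nat) \<otimes> y \<in> W" if y: "y \<in> simple_extension N \<beta>" for y
    using y
  proof (induct rule: simple_extension.induct)
    case zero
    show ?case using WE(2) p by (intro exI[of _ 0]) simp
  next
    case (lin k1 k2)
    then obtain k where k: "p [^] (k::nat) \<otimes> k1 \<in> W" by blast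
    have c: "k1 \<in> carrier L" "k2 \<in> carrier L"
      using lin simple_extension_in_carrier[OF NE(1) \<beta>c] NE(1) by blast+
    have "\<exists>m. p [^] (m::nat) \<otimes> k2 \<in> ?O"
    proof (cases "k2 = \<zero>")
      case True
      then show ?thesis using OE(2) p by simp
    next
      case False
      then obtain m l u where u: "vunit V u" "k2 \<otimes> p [^] (m::nat) = p [^] (l::nat) \<otimes> u"
        using uN lin(3) unfolding uniformized_def by blast
      have "p [^] m \<otimes> k2 \<in> N" using NE(6) subring_pow[OF subfieldE(1)[OF N(1)]] pO lin(3) by blast
      moreover have "p [^] m \<otimes> k2 = p [^] l \<otimes> u" using u(2) c p m_comm[of k2 "p [^] m"] by simp
      moreover have "\<dots> \<in> V" using VE'(6) subring_pow[OF V'(2)] pO u(1) by (simp add: vunit_def)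
      ultimately show ?thesis by (intro exI[of _ m]) simp
    qed
    then obtain m where m: "p [^] (m::nat) \<otimes> k2 \<in> ?O" by blast
    have "p [^] (k + m) \<otimes> (k1 \<otimes> \<beta> \<oplus> k2)
      = p [^] m \<otimes> (p [^] k \<otimes> k1) \<otimes> \<beta> \<oplus> p [^] k \<otimes> (p [^] m \<otimes> k2)"
    proof -
      have "P \<otimes> M \<otimes> (k1 \<otimes> \<beta> \<oplus> k2) = M \<otimes> (P \<otimes> k1) \<otimes> \<beta> \<oplus> P \<otimes> (M \<otimes> k2)"
        if "P \<in> carrier L" "M \<in> carrier L" for P M using that c \<beta>c by algebra
      then show ?thesis unfolding nat_pow_mult[OF p(1), of k m, symmetric] using p by simp
    qed
    also have "\<dots> \<in> W"
      using k m W(2,3) WE(6,7) subring_pow[OF W(1), of p] pO by (simp add: subset_iff)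
    finally show ?case by blast
  qed
  have "uniformized V p (simple_extension N \<beta>)"
    unfolding uniformized_def
  proof (intro ballI impI)
    fix y assume y: "y \<in> simple_extension N \<beta>" "y \<noteq> \<zero>"
    have yc: "y \<in> carrier L" using y(1) simple_extension_in_carrier[OF NE(1) \<beta>c] by blast
    obtain k where k: "p [^] (k::nat) \<otimes> y \<in> W" using claim3[OF y(1)] by blast
    have "p [^] k \<otimes> y \<noteq> \<zero>" using integral' nat_pow_nonzero[OF p] p yc y(2) by simp
    then obtain l s r where s: "s \<in> W" "vunit V s" "vunit V r" "s \<otimes> (p [^] k \<otimes> y) = p [^] (l::nat) \<otimes> r"
      using claim2[OF k] by blast
    have c: "s \<in> carrier L" "s \<noteq> \<zero>" "r \<in> carrier L" using s VE'(1) by (auto simp: vunit_def)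
    note i = field_inv[OF c(1,2)]
    have "y \<otimes> p [^] k = (inv s \<otimes> s) \<otimes> (p [^] k \<otimes> y)" using i yc p by (simp add: m_comm)
    also have "\<dots> = inv s \<otimes> (p [^] l \<otimes> r)" unfolding s(4)[symmetric] using i(1) yc p c by (intro m_assoc) auto
    also have "\<dots> = p [^] l \<otimes> (r \<otimes> inv s)" using i c p by (simp add: m_ac)
    finally show "\<exists>k l u. vunit V u \<and> y \<otimes> p [^] (k::nat) = p [^] (l::nat) \<otimes> u"
      using vunit_mult[OF V'(2) s(3) vunit_inv[OF V'(2) s(2)]] by blast
  qed
  moreover have "insert \<beta> N \<subseteq> simple_extension N \<beta>"
    using simple_extension_incl[OF NE(1) \<beta>c] simple_extension_mem[OF subfieldE(1)[OF N(1)] \<beta>c] by simp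
  ultimately show ?thesis
    using uniformized_fractions[OF V'(2) p simple_extension_is_subring[OF subfieldE(1)[OF N(1)] \<beta>c]] by blast
qed

end

lemma eventually_vunit_finite:
  assumes "finite Y" "Y \<subseteq> carrier L"
  shows "\<exists>B. finite B \<and> (\<forall>d\<in>C - B. \<forall>V. place d V \<longrightarrow> (\<forall>y\<in>Y. y \<noteq> \<zero> \<longrightarrow> vunit V y))"
  using assms
proof (induct Y rule: finite_induct)
  case (insert y Y)
  then obtain B where B: "finite B" "\<forall>d\<in>C - B. \<forall>V. place d V \<longrightarrow> (\<forall>y\<in>Y. y \<noteq> \<zero> \<longrightarrow> vunit V y)" by auto
  show ?case
  proof (cases "y = \<zero>")
    case True
    then show ?thesis using B by (intro exI[of _ B]) auto
  next
    case False
    then obtain B' where B': "finite B'" "\<forall>d\<in>C - B'. \<forall>V. place d V \<longrightarrow> vunit V y"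
      using eventually_vunit[of y] insert(4) by auto
    show ?thesis using B B' by (intro exI[of _ "B \<union> B'"]) auto
  qed
qed auto

text \<open>Starting from C(\<alpha>), a Frobenius power of each generator is adjoined for which
  some relation has a simple root; the generators themselves end up in the purely inseparable
  closure. Such an adjunction is unramified wherever the coefficients are integral and the
  derivative at the root is a unit, which fails at finitely many points only.\<close>

lemma exists_uniformized_field:
  assumes "finite S" "S \<subseteq> carrier L"
  shows "\<exists>N B. subfield N L \<and> C \<subseteq> N \<and> \<alpha> \<in> N \<and> S \<subseteq> perfect_closure_in N \<and> finite B
    \<and> (\<forall>d\<in>C - B. \<forall>V. place d V \<longrightarrow> uniformized V (\<alpha> \<ominus> d) N)"
  using assms
proof (induct S rule: finite_induct)
  case empty
  let ?A = "simple_extension C \<alpha>" and ?N = "generate_field L (insert \<alpha> C)"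
  have A: "subring ?A L" "insert \<alpha> C \<subseteq> ?A"
    using simple_extension_is_subring[OF subfieldE(1)[OF C] \<alpha>(1)] simple_extension_incl[OF CE(1) \<alpha>(1)]
      simple_extension_mem[OF subfieldE(1)[OF C] \<alpha>(1)] by auto
  have aC: "insert \<alpha> C \<subseteq> carrier L" using \<alpha>(1) CE(1) by blast
  have "uniformized V (\<alpha> \<ominus> d) ?N" if d: "d \<in> C" and pl: "place d V" for d V
  proof (rule uniformized_fractions[OF V(2)[OF d pl] \<alpha>_minus_nonzero[OF d] A])
    show "uniformized V (\<alpha> \<ominus> d) ?A"
      unfolding uniformized_def
    proof (intro ballI impI)
      fix h assume h: "h \<in> ?A" "h \<noteq> \<zero>"
      obtain k u c where u: "h = (\<alpha> \<ominus> d) [^] (k::nat) \<otimes> u" "u \<in> V" "c \<in> C" "c \<noteq> \<zero>" "small V (u \<ominus> c)"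
        using simple_extension_order[OF d pl h] by blast
      have "h \<in> carrier L" using h A(1) subringE(1) by blast
      then have "h \<otimes> (\<alpha> \<ominus> d) [^] (0::nat) = (\<alpha> \<ominus> d) [^] k \<otimes> u" using u(1) by simp
      then show "\<exists>k l u. vunit V u \<and> h \<otimes> (\<alpha> \<ominus> d) [^] (k::nat) = (\<alpha> \<ominus> d) [^] (l::nat) \<otimes> u"
        using vunit_of_residue[OF d pl u(3,4,2,5)] by blast
    qed
  qed
  then show ?case using generate_field_is_subfield[OF aC] generate_fieldE(2)[OF aC refl]
    by (intro exI[of _ ?N] exI[of _ "{}"]) auto
next
  case (insert \<beta> S)
  then obtain N B where N: "subfield N L" "C \<subseteq> N" "\<alpha> \<in> N" "S \<subseteq> perfect_closure_in N" "finite B"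
    "\<forall>d\<in>C - B. \<forall>V. place d V \<longrightarrow> uniformized V (\<alpha> \<ominus> d) N" by auto
  note NE = subringE[OF subfieldE(1)[OF N(1)]]
  have \<beta>: "\<beta> \<in> carrier L" using insert by simp
  have "simple_extension C \<alpha> \<subseteq> N" by (rule simple_extension_subring_incl[OF subfieldE(1)[OF N(1)] N(2,3)])
  then have rel: "alg_rel N \<beta>" using exchange[OF \<beta>] by (rule alg_rel_mono)
  obtain e f n q where f: "\<And>i. f i \<in> N" "f n \<noteq> \<zero>" "0 < n" and q: "\<And>i. q i \<in> carrier L"
    and fq: "\<And>x. x \<in> carrier L \<Longrightarrow> peval f (Suc n) x = (x \<ominus> \<beta> [^] (char_exp ^ e)) \<otimes> peval q n x"
    and nz: "peval q n (\<beta> [^] (char_exp ^ e)) \<noteq> \<zero>"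
    by (rule exists_separable_power[OF N(1) \<beta> rel]) (rule that)
  define \<gamma> where "\<gamma> = \<beta> [^] (char_exp ^ e)"
  have \<gamma>: "\<gamma> \<in> carrier L" using \<beta> by (simp add: \<gamma>_def)
  have fc: "\<And>i. f i \<in> carrier L" using f NE(1) by blast
  \<comment> \<open>Integrality at a place will be known for the finitely many coefficients in
    \<open>Y\<close>, hence the cut-off.\<close>
  let ?f = "\<lambda>i. if i < Suc n then f i else \<zero>" and ?q = "\<lambda>i. if i < n then q i else \<zero>"
  have pf: "peval ?f (Suc n) x = peval f (Suc n) x" for x by (rule lincomb_cong) auto
  have pq: "peval ?q n x = peval q n x" for x by (rule lincomb_cong) auto
  define Y where "Y = {\<gamma>, peval q n \<gamma>} \<union> f ` {..<Suc n} \<union> q ` {..<n}"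
  have Y: "finite Y" "Y \<subseteq> carrier L" using \<gamma> q fc by (auto simp: Y_def)
  obtain B' where B': "finite B'" "\<forall>d\<in>C - B'. \<forall>V. place d V \<longrightarrow> (\<forall>y\<in>Y. y \<noteq> \<zero> \<longrightarrow> vunit V y)"
    using eventually_vunit_finite[OF Y] by blast
  let ?N = "generate_field L (insert \<gamma> N)"
  have gN: "insert \<gamma> N \<subseteq> carrier L" using \<gamma> NE(1) by blast
  have N': "subfield ?N L" "insert \<gamma> N \<subseteq> ?N"
    using generate_field_is_subfield[OF gN] generate_fieldE(2)[OF gN refl] by auto
  have "uniformized V (\<alpha> \<ominus> d) ?N" if d: "d \<in> C - (B \<union> B')" and pl: "place d V" for d V
  proof -
    have dC: "d \<in> C" using d by blast
    note V = V[OF dC pl] and VE = VE[OF dC pl]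
    have yV: "y \<in> V" if "y \<in> Y" for y
    proof (cases "y = \<zero>")
      case False
      then have "vunit V y" using B'(2) d pl that by blast
      then show ?thesis by (simp add: vunit_def)
    qed (use VE(2) in simp)
    show ?thesis
    proof (rule uniformized_adjoin[OF dC pl N(1,2,3), of \<gamma> ?f ?q n])
      show "uniformized V (\<alpha> \<ominus> d) N" using N(6) d pl by blast
      show "\<gamma> \<in> V" using yV by (simp add: Y_def)
      show "?f i \<in> N" for i using f NE(2) by simp
      show "?f i \<in> V" for i using yV VE(2) by (auto simp: Y_def)
      show "?q i \<in> V" for i using yV VE(2) by (auto simp: Y_def)
      show "peval ?f (Suc n) x = (x \<ominus> \<gamma>) \<otimes> peval ?q n x" if "x \<in> carrier L" for x
        unfolding pf pq using fq[OF that] by (simp add: \<gamma>_def)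
      have "peval q n \<gamma> \<in> Y" by (simp add: Y_def)
      then show "vunit V (peval ?q n \<gamma>)" unfolding pq using B'(2) d pl nz unfolding \<gamma>_def by blast
    qed
  qed
  moreover have "insert \<beta> S \<subseteq> perfect_closure_in ?N"
  proof -
    have "\<beta> \<in> perfect_closure_in ?N" using \<beta> N'(2) unfolding perfect_closure_in_def \<gamma>_def by auto
    moreover have "perfect_closure_in N \<subseteq> perfect_closure_in ?N" using N'(2) unfolding perfect_closure_in_def by auto
    ultimately show ?thesis using N(4) by blast
  qed
  ultimately show ?case using N(2,3,5) N' B'(1)
    by (intro exI[of _ ?N] exI[of _ "B \<union> B'"]) auto
qed

text \<open>For some odd \<open>Q\<close> the power z^Q lies in the field \<open>N\<close>
  uniformized by \<alpha> - d, and there z^2 = (\<alpha> - d) u would lead to Q + 2 m = 2 l. The set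
  \<open>Y\<close> is carried along so that one and the same place serves for both
  conclusions.\<close>

lemma eventually_not_square:
  assumes two: "\<one> \<oplus> \<one> \<noteq> \<zero>" and S: "finite S" "S \<subseteq> carrier L" and Y: "finite Y" "Y \<subseteq> carrier L"
  shows "\<exists>B. finite B \<and> (\<forall>d\<in>C - B. \<exists>V. place d V \<and> (\<forall>y\<in>Y. y \<noteq> \<zero> \<longrightarrow> vunit V y)
    \<and> (\<forall>z\<in>generate_field L (C \<union> S). \<forall>u. vunit V u \<longrightarrow> z \<otimes> z \<noteq> (\<alpha> \<ominus> d) \<otimes> u))"
proof -
  obtain N B where N: "subfield N L" "C \<subseteq> N" "\<alpha> \<in> N" "S \<subseteq> perfect_closure_in N" "finite B"
    "\<And>d V. d\<in>C - B \<Longrightarrow> place d V \<Longrightarrow> uniformized V (\<alpha> \<ominus> d) N" using exists_uniformized_field[OF S] by metis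
  obtain B' where B': "finite B'" "\<forall>d\<in>C - B'. \<forall>V. place d V \<longrightarrow> (\<forall>y\<in>Y. y \<noteq> \<zero> \<longrightarrow> vunit V y)"
    using eventually_vunit_finite[OF Y] by blast
  have "\<exists>V. place d V \<and> (\<forall>y\<in>Y. y \<noteq> \<zero> \<longrightarrow> vunit V y)
    \<and> (\<forall>z\<in>generate_field L (C \<union> S). \<forall>u. vunit V u \<longrightarrow> z \<otimes> z \<noteq> (\<alpha> \<ominus> d) \<otimes> u)"
    if d: "d \<in> C - (B \<union> B')" for d
  proof -
    have dC: "d \<in> C" using d by blast
    obtain V where pl: "place d V" using exists_place[OF dC] by blast
    note V = V[OF dC pl] and VE = VE[OF dC pl] and p = \<alpha>_minus_nonzero[OF dC]
    let ?p = "\<alpha> \<ominus> d"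
    have "z \<otimes> z \<noteq> ?p \<otimes> u" if z: "z \<in> generate_field L (C \<union> S)" and u: "vunit V u" for z u
    proof
      assume e: "z \<otimes> z = ?p \<otimes> u"
      have "generate_field L (C \<union> S) \<subseteq> perfect_closure_in N"
        using subfield_perfect_closure_in[OF N(1)] N(2,4) S(2) CE(1)
        by (intro generate_field_min_subfield1) auto
      then obtain k where k: "z [^] (char_exp ^ k) \<in> N" "z \<in> carrier L"
        using z unfolding perfect_closure_in_def by blast
      define Q where "Q = char_exp ^ k"
      have Q: "odd Q" using odd_char_exp[OF two] by (simp add: Q_def)
      have uc: "u \<in> carrier L" "u \<noteq> \<zero>" using u VE(1) by (auto simp: vunit_def)
      have "z \<noteq> \<zero>" using e integral'[OF p uc] by auto
      then have "z [^] Q \<noteq> \<zero>" using nat_pow_nonzero[OF k(2)] by blast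
      then obtain m l w where w: "vunit V w" "z [^] Q \<otimes> ?p [^] (m::nat) = ?p [^] (l::nat) \<otimes> w"
        using N(6)[of d V] d pl k(1) unfolding uniformized_def Q_def by blast
      have wc: "w \<in> carrier L" using w VE(1) by (auto simp: vunit_def)
      \<comment> \<open>Two computations of the square of z^Q p^m, one from the equation for z^2 and
        one from the uniformizer.\<close>
      have "?p [^] (Q + 2 * m) \<otimes> u [^] Q = (?p [^] Q \<otimes> u [^] Q) \<otimes> (?p [^] m \<otimes> ?p [^] m)"
        using p uc by (simp add: nat_pow_mult[symmetric] mult_2 m_ac)
      also have "?p [^] Q \<otimes> u [^] Q = z [^] Q \<otimes> z [^] Q"
        using e nat_pow_distrib[OF p(1) uc(1), of Q] nat_pow_distrib[OF k(2,2), of Q] by simp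
      also have "(z [^] Q \<otimes> z [^] Q) \<otimes> (?p [^] m \<otimes> ?p [^] m) = (z [^] Q \<otimes> ?p [^] m) \<otimes> (z [^] Q \<otimes> ?p [^] m)"
        using k p by (simp add: m_ac)
      also have "\<dots> = (?p [^] l \<otimes> ?p [^] l) \<otimes> (w \<otimes> w)" unfolding w(2) using p wc by (simp add: m_ac)
      also have "?p [^] l \<otimes> ?p [^] l = ?p [^] (2 * l)" using p by (simp add: nat_pow_mult mult_2)
      finally have "?p [^] (Q + 2 * m) \<otimes> u [^] Q = ?p [^] (2 * l) \<otimes> (w \<otimes> w)" .
      then have "Q + 2 * m = 2 * l"
        by (rule vunit_pow_eq_imp_eq[OF V(2,5) p(2) vunit_pow[OF V(2) u] vunit_mult[OF V(2) w(1) w(1)]])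
      then have "even (Q + 2 * m)" by simp
      then show False using Q by simp
    qed
    then show ?thesis using pl B'(2) d by blast
  qed
  then show ?thesis using N(5) B'(1) by (intro exI[of _ "B \<union> B'"]) auto
qed

end

section \<open>Quadratic towers\<close>

context field
begin

definition quad_ext :: "'a set \<Rightarrow> 'a \<Rightarrow> 'a set" where
  "quad_ext F c = {u \<oplus> v \<otimes> c | u v. u \<in> F \<and> v \<in> F}"

context
  fixes F c assumes F: "subfield F R" and c: "c \<in> carrier R" "c \<notin> F" "c \<otimes> c \<in> F"
begin

lemmas FE = subringE[OF subfieldE(1)[OF F]]

lemma quad_ext_unique_zero:
  assumes uv: "u \<in> F" "v \<in> F" "u \<oplus> v \<otimes> c = \<zero>" shows "u = \<zero>" "v = \<zero>"
proof -
  have cc: "u \<in> carrier R" "v \<in> carrier R" using uv FE(1) by blast+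
  show v: "v = \<zero>"
  proof (rule ccontr)
    assume "v \<noteq> \<zero>"
    then have "v \<in> F - {\<zero>}" using uv by blast
    moreover have "u = \<ominus> (v \<otimes> c)" using uv(3) cc c(1) minus_equality[of u "v \<otimes> c"] by simp
    then have "v \<otimes> c = \<ominus> u" using cc c(1) by simp
    then have "v \<otimes> c \<in> F" using uv FE(5) by simp
    ultimately show False using subfield_m_inv_simprule[OF F _ c(1)] c(2) by blast
  qed
  show "u = \<zero>" using uv(3) v cc c(1) by simp
qed

lemma quad_ext_unique:
  assumes "u \<in> F" "v \<in> F" "u' \<in> F" "v' \<in> F" "u \<oplus> v \<otimes> c = u' \<oplus> v' \<otimes> c"
  shows "u = u'" "v = v'"
proof -
  have cc: "u \<in> carrier R" "v \<in> carrier R" "u' \<in> carrier R" "v' \<in> carrier R" using assms FE(1) by blast+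
  have e: "(u \<ominus> u') \<oplus> (v \<ominus> v') \<otimes> c = (u \<oplus> v \<otimes> c) \<ominus> (u' \<oplus> v' \<otimes> c)"
    using cc c(1) by algebra
  have "(u \<ominus> u') \<oplus> (v \<ominus> v') \<otimes> c = \<zero>" unfolding e assms(5) using cc c(1) by simp
  then have "u \<ominus> u' = \<zero>" "v \<ominus> v' = \<zero>"
    using quad_ext_unique_zero[of "u \<ominus> u'" "v \<ominus> v'"]
      subring_minus[OF subfieldE(1)[OF F] assms(1,3)] subring_minus[OF subfieldE(1)[OF F] assms(2,4)] by simp_all
  then show "u = u'" "v = v'" using cc by simp_all
qed

lemma quad_ext_incl: "F \<subseteq> quad_ext F c" "c \<in> quad_ext F c"
proof -
  show "F \<subseteq> quad_ext F c"
  proof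
    fix u assume "u \<in> F"
    then show "u \<in> quad_ext F c" unfolding quad_ext_def using FE(1,2) c(1)
      by (intro CollectI exI[of _ u] exI[of _ \<zero>]) auto
  qed
  show "c \<in> quad_ext F c" unfolding quad_ext_def using FE(2,3) c(1)
    by (intro CollectI exI[of _ \<zero>] exI[of _ \<one>]) auto
qed

text \<open>Inverses come from the conjugate u - v c: the norm lies in \<open>F\<close> and is
  nonzero because \<one> and \<open>c\<close> are independent over \<open>F\<close>.\<close>

lemma subfield_quad_ext: "subfield (quad_ext F c) R"
proof (rule subfieldI'[OF subringI])
  show "quad_ext F c \<subseteq> carrier R" unfolding quad_ext_def using FE(1) c(1) by auto
  show "\<one> \<in> quad_ext F c" using quad_ext_incl(1) FE(3) by blast
  fix x assume "x \<in> quad_ext F c"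
  then obtain u v where x: "u \<in> F" "v \<in> F" "x = u \<oplus> v \<otimes> c" unfolding quad_ext_def by blast
  then have cc: "u \<in> carrier R" "v \<in> carrier R" using FE(1) by blast+
  have "\<ominus> x = \<ominus> u \<oplus> (\<ominus> v) \<otimes> c" unfolding x(3) using cc c(1) by algebra
  then show "\<ominus> x \<in> quad_ext F c" unfolding quad_ext_def using x FE(5) by blast
next
  fix x y assume "x \<in> quad_ext F c" "y \<in> quad_ext F c"
  then obtain u v u' v' where x: "u \<in> F" "v \<in> F" "x = u \<oplus> v \<otimes> c" "u' \<in> F" "v' \<in> F" "y = u' \<oplus> v' \<otimes> c"
    unfolding quad_ext_def by blast
  then have cc: "u \<in> carrier R" "v \<in> carrier R" "u' \<in> carrier R" "v' \<in> carrier R" using FE(1) by blast+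
  have "x \<otimes> y = (u \<otimes> u' \<oplus> v \<otimes> v' \<otimes> (c \<otimes> c)) \<oplus> (u \<otimes> v' \<oplus> v \<otimes> u') \<otimes> c"
    unfolding x using cc c(1) by algebra
  moreover have "u \<otimes> u' \<oplus> v \<otimes> v' \<otimes> (c \<otimes> c) \<in> F" "u \<otimes> v' \<oplus> v \<otimes> u' \<in> F" using x c(3) FE(6,7) by simp_all
  ultimately show "x \<otimes> y \<in> quad_ext F c" unfolding quad_ext_def by blast
  have "x \<oplus> y = (u \<oplus> u') \<oplus> (v \<oplus> v') \<otimes> c" unfolding x using cc c(1) by algebra
  then show "x \<oplus> y \<in> quad_ext F c" unfolding quad_ext_def using x FE(7) by blast
next
  fix x assume x0: "x \<in> quad_ext F c - {\<zero>}"
  then obtain u v where x: "u \<in> F" "v \<in> F" "x = u \<oplus> v \<otimes> c" unfolding quad_ext_def by blast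
  then have cc: "u \<in> carrier R" "v \<in> carrier R" "\<ominus> v \<in> F" using FE(1,5) by blast+
  define y where "y = u \<oplus> (\<ominus> v) \<otimes> c"
  have xc: "x \<in> carrier R" "y \<in> carrier R" unfolding x(3) y_def using cc c(1) by auto
  have "y \<noteq> \<zero>"
  proof
    assume "y = \<zero>"
    then have "u = \<zero>" "\<ominus> v = \<zero>" using quad_ext_unique_zero[OF x(1) cc(3)] unfolding y_def by auto
    then have "x = \<zero>" unfolding x(3) using cc c(1) minus_minus[OF cc(2)] by simp
    then show False using x0 by blast
  qed
  then have nz: "x \<otimes> y \<noteq> \<zero>" using integral' xc x0 by blast
  have "x \<otimes> y = u \<otimes> u \<ominus> v \<otimes> v \<otimes> (c \<otimes> c)" unfolding x(3) y_def using cc c(1) by algebra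
  also have "\<dots> \<in> F" using x c(3) FE(6) by (intro subring_minus[OF subfieldE(1)[OF F]]) simp_all
  finally have i: "inv (x \<otimes> y) \<in> F" using subfield_m_inv(1)[OF F] nz by blast
  then have ic: "inv (x \<otimes> y) \<in> carrier R" using FE(1) by blast
  have "x \<otimes> (y \<otimes> inv (x \<otimes> y)) = (x \<otimes> y) \<otimes> inv (x \<otimes> y)" using xc ic by (simp add: m_assoc)
  also have "\<dots> = \<one>" using field_inv(3)[of "x \<otimes> y"] xc nz by simp
  finally have "inv x = y \<otimes> inv (x \<otimes> y)" using inv_unique_nonzero[of x] xc ic by simp
  also have "\<dots> = (u \<otimes> inv (x \<otimes> y)) \<oplus> ((\<ominus> v) \<otimes> inv (x \<otimes> y)) \<otimes> c"
  proof -
    have "y \<otimes> I = (u \<otimes> I) \<oplus> ((\<ominus> v) \<otimes> I) \<otimes> c" if "I \<in> carrier R" for I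
      unfolding y_def using that cc c(1) by algebra
    then show ?thesis using ic by blast
  qed
  finally show "inv x \<in> quad_ext F c" unfolding quad_ext_def using x(1) cc(3) i FE(6) by blast
qed

lemma generate_field_insert_eq_quad_ext: "generate_field R (insert c F) = quad_ext F c"
proof
  have i: "insert c F \<subseteq> carrier R" using c(1) FE(1) by blast
  show "generate_field R (insert c F) \<subseteq> quad_ext F c"
    using generate_field_min_subfield1[OF i subfield_quad_ext] quad_ext_incl by blast
  note G = generate_field_is_subfield[OF i] and GI = generate_fieldE(2)[OF i refl]
  show "quad_ext F c \<subseteq> generate_field R (insert c F)"
    unfolding quad_ext_def using subringE(6,7)[OF subfieldE(1)[OF G]] GI by blast
qed

end

lemma quadratic_tower_subfield:
  assumes "quadratic_tower R rad E F" "subfield E R" shows "subfield F R \<and> E \<subseteq> F"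
  using assms
proof (induct rule: quadratic_tower.induct)
  case (step F c)
  then have "insert c F \<subseteq> carrier R" using subfieldE(3) by blast
  then show ?case using generate_field_is_subfield generate_fieldE(2)[OF _ refl] step by blast
qed auto

lemma quadratic_tower_trans:
  "\<lbrakk> quadratic_tower R rad F G; quadratic_tower R rad E F \<rbrakk> \<Longrightarrow> quadratic_tower R rad E G"
  by (induct rule: quadratic_tower.induct) (auto intro: quadratic_tower.step)

text \<open>The steps of the second tower are repeated on top of the first, leaving out those whose
  root is already present, since steps of a tower are proper. Monotonicity of \<open>rad\<close>
  keeps the radicands admissible.\<close>

lemma quadratic_tower_directed:
  assumes E: "subfield E R" and mono: "\<And>F G. F \<subseteq> G \<Longrightarrow> rad F \<subseteq> rad G"
    and F1: "quadratic_tower R rad E F1" and F2: "quadratic_tower R rad E F2"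
  shows "\<exists>F. quadratic_tower R rad F1 F \<and> F2 \<subseteq> F"
  using F2
proof (induct rule: quadratic_tower.induct)
  case base
  show ?case using quadratic_tower_subfield[OF F1 E] quadratic_tower.base by blast
next
  case (step F2 c)
  then obtain F where F: "quadratic_tower R rad F1 F" "F2 \<subseteq> F" by blast
  have Fs: "subfield F R" using quadratic_tower_subfield[OF F(1)] quadratic_tower_subfield[OF F1 E] by blast
  have i: "insert c F2 \<subseteq> carrier R" "insert c F \<subseteq> carrier R" using step(3) F(2) subfieldE(3)[OF Fs] by blast+
  show ?case
  proof (cases "c \<in> F")
    case True
    then show ?thesis using F generate_field_min_subfield1[OF i(1) Fs] by blast
  next
    case False
    have "quadratic_tower R rad F1 (generate_field R (insert c F))"
      using quadratic_tower.step[OF F(1) step(3) False] step(5) mono[OF F(2)] by blast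
    moreover have "generate_field R (insert c F2) \<subseteq> generate_field R (insert c F)"
      using F(2) i by (intro mono_generate_field) auto
    ultimately show ?thesis by blast
  qed
qed

section \<open>The two closures as unions of quadratic towers\<close>

definition tower_closure :: "('a set \<Rightarrow> 'a set) \<Rightarrow> 'a set \<Rightarrow> 'a set" where
  "tower_closure rad E = \<Union>{F. quadratic_tower R rad E F}"

lemma tower_closure_finite:
  assumes E: "subfield E R" and mono: "\<And>F G. F \<subseteq> G \<Longrightarrow> rad F \<subseteq> rad G"
    and S: "finite S" "S \<subseteq> tower_closure rad E"
  shows "\<exists>F. quadratic_tower R rad E F \<and> S \<subseteq> F"
  using S
proof (induct S rule: finite_induct)
  case empty
  show ?case using quadratic_tower.base by blast
next
  case (insert x S)
  then obtain F where F: "quadratic_tower R rad E F" "S \<subseteq> F" by blast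
  obtain F' where F': "quadratic_tower R rad E F'" "x \<in> F'" using insert(4) by (auto simp: tower_closure_def)
  obtain G where G: "quadratic_tower R rad F G" "F' \<subseteq> G"
    using quadratic_tower_directed[OF E mono F(1) F'(1)] by blast
  then have "F \<subseteq> G" using quadratic_tower_subfield[OF G(1)] quadratic_tower_subfield[OF F(1) E] by blast
  then show ?case using quadratic_tower_trans[OF G(1) F(1)] F F' G by blast
qed

lemma subfield_tower_closure:
  assumes E: "subfield E R" and mono: "\<And>F G. F \<subseteq> G \<Longrightarrow> rad F \<subseteq> rad G"
  shows "subfield (tower_closure rad E) R" "E \<subseteq> tower_closure rad E"
proof -
  note fin = tower_closure_finite[where rad=rad, OF E mono]
  have sub: "subfield F R" if "quadratic_tower R rad E F" for F
    using quadratic_tower_subfield[OF that E] by blast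
  have incl: "F \<subseteq> tower_closure rad E" if "quadratic_tower R rad E F" for F
    using that by (auto simp: tower_closure_def)
  show EU: "E \<subseteq> tower_closure rad E" using incl quadratic_tower.base by blast
  show "subfield (tower_closure rad E) R"
  proof (rule subfieldI'[OF subringI])
    show "tower_closure rad E \<subseteq> carrier R" using sub subfieldE(3) unfolding tower_closure_def by blast
    show "\<one> \<in> tower_closure rad E" using EU subringE(3)[OF subfieldE(1)[OF E]] by blast
    fix x assume "x \<in> tower_closure rad E"
    then obtain F where F: "quadratic_tower R rad E F" "{x} \<subseteq> F" using fin[of "{x}"] by auto
    then show "\<ominus> x \<in> tower_closure rad E" using subringE(5)[OF subfieldE(1)[OF sub[OF F(1)]]] incl[OF F(1)] by blast
  next
    fix x y assume "x \<in> tower_closure rad E" "y \<in> tower_closure rad E"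
    then obtain F where F: "quadratic_tower R rad E F" "{x, y} \<subseteq> F" using fin[of "{x, y}"] by auto
    note FE = subringE[OF subfieldE(1)[OF sub[OF F(1)]]]
    show "x \<otimes> y \<in> tower_closure rad E" using FE(6)[of x y] F incl[OF F(1)] by blast
    show "x \<oplus> y \<in> tower_closure rad E" using FE(7)[of x y] F incl[OF F(1)] by blast
  next
    fix x assume x: "x \<in> tower_closure rad E - {\<zero>}"
    then obtain F where F: "quadratic_tower R rad E F" "{x} \<subseteq> F" using fin[of "{x}"] by auto
    then show "inv x \<in> tower_closure rad E" using subfield_m_inv(1)[OF sub[OF F(1)], of x] x incl[OF F(1)] by blast
  qed
qed

text \<open>Induction along a tower. Inclusions between closures follow from this leastness instead
  of a comparison of towers.\<close>

lemma tower_closure_least: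
  assumes mono: "\<And>F G. F \<subseteq> G \<Longrightarrow> rad F \<subseteq> rad G"
    and P: "subfield P R" "E \<subseteq> P" "\<And>c. \<lbrakk> c \<in> carrier R; c \<otimes> c \<in> rad P \<rbrakk> \<Longrightarrow> c \<in> P"
  shows "tower_closure rad E \<subseteq> P"
proof -
  have "F \<subseteq> P" if "quadratic_tower R rad E F" for F
    using that
  proof (induct rule: quadratic_tower.induct)
    case (step F c)
    then have "c \<in> P" using P(3) mono[OF step(2)] by blast
    then have "insert c F \<subseteq> P" using step(2) by blast
    moreover from this have "insert c F \<subseteq> carrier R" using subfieldE(3)[OF P(1)] by blast
    ultimately show ?case by (intro generate_field_min_subfield1 P(1))
  qed (rule P)
  then show ?thesis by (auto simp: tower_closure_def)
qed

lemma pyth_closure_eq_tower_closure: "pyth_closure R E = tower_closure (sums_of_two_squares R) E"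
  by (simp add: pyth_closure_def tower_closure_def)

lemma quad_closure_eq_tower_closure: "quad_closure R E = tower_closure (\<lambda>F. F) E"
  by (simp add: quad_closure_def tower_closure_def)

lemma sums_of_two_squares_mono: "F \<subseteq> G \<Longrightarrow> sums_of_two_squares R F \<subseteq> sums_of_two_squares R G"
  unfolding sums_of_two_squares_def by blast

lemma subfield_pyth_closure: "subfield E R \<Longrightarrow> subfield (pyth_closure R E) R"
  and pyth_closure_incl: "subfield E R \<Longrightarrow> E \<subseteq> pyth_closure R E"
  unfolding pyth_closure_eq_tower_closure
  using subfield_tower_closure[of E "sums_of_two_squares R", OF _ sums_of_two_squares_mono] by auto

lemma pyth_closure_finite:
  "\<lbrakk> subfield E R; finite S; S \<subseteq> pyth_closure R E \<rbrakk>
    \<Longrightarrow> \<exists>F. quadratic_tower R (sums_of_two_squares R) E F \<and> S \<subseteq> F"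
  unfolding pyth_closure_eq_tower_closure
  using tower_closure_finite[of E "sums_of_two_squares R", OF _ sums_of_two_squares_mono] by auto

lemma pyth_closure_closed:
  assumes E: "subfield E R" and c: "c \<in> carrier R" "a \<in> pyth_closure R E" "b \<in> pyth_closure R E"
    and e: "c \<otimes> c = a \<otimes> a \<oplus> b \<otimes> b"
  shows "c \<in> pyth_closure R E"
proof -
  obtain F where F: "quadratic_tower R (sums_of_two_squares R) E F" "{a, b} \<subseteq> F"
    using pyth_closure_finite[OF E, of "{a, b}"] c by auto
  have cs: "c \<otimes> c \<in> sums_of_two_squares R F" unfolding e sums_of_two_squares_def using F(2) by blast
  show ?thesis
  proof (cases "c \<in> F")
    case True
    then show ?thesis using F by (auto simp: pyth_closure_def)
  next
    case False
    have "insert c F \<subseteq> carrier R"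
      using c(1) quadratic_tower_subfield[OF F(1) E] subfieldE(3) by blast
    then have "c \<in> generate_field R (insert c F)" using generate_fieldE(2)[OF _ refl] by blast
    then show ?thesis using quadratic_tower.step[OF F(1) c(1) False cs] by (auto simp: pyth_closure_def)
  qed
qed

lemma pyth_closure_least:
  assumes P: "subfield P R" "E \<subseteq> P"
    and "\<And>c a b. \<lbrakk> c \<in> carrier R; a \<in> P; b \<in> P; c \<otimes> c = a \<otimes> a \<oplus> b \<otimes> b \<rbrakk> \<Longrightarrow> c \<in> P"
  shows "pyth_closure R E \<subseteq> P"
  unfolding pyth_closure_eq_tower_closure
  using assms(3) by (intro tower_closure_least[OF sums_of_two_squares_mono P]) (auto simp: sums_of_two_squares_def)

text \<open>Both inclusions are leastness. This permits enlarging the base field to a finite stage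
  over which the structure constants of an extension are defined.\<close>

lemma pyth_closure_between:
  assumes E: "subfield E R" and G: "subfield G R" "E \<subseteq> G" "G \<subseteq> pyth_closure R E"
  shows "pyth_closure R G = pyth_closure R E"
proof
  show "pyth_closure R G \<subseteq> pyth_closure R E"
    by (rule pyth_closure_least[OF subfield_pyth_closure[OF E] G(3)]) (rule pyth_closure_closed[OF E])
  have "E \<subseteq> pyth_closure R G" using G(2) pyth_closure_incl[OF G(1)] by blast
  then show "pyth_closure R E \<subseteq> pyth_closure R G"
    by (rule pyth_closure_least[OF subfield_pyth_closure[OF G(1)]]) (rule pyth_closure_closed[OF G(1)])
qed

lemma quad_closure_closed:
  assumes E: "subfield E R" and c: "c \<in> carrier R" "c \<otimes> c \<in> quad_closure R E"
  shows "c \<in> quad_closure R E"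
proof -
  obtain F where F: "quadratic_tower R (\<lambda>F. F) E F" "c \<otimes> c \<in> F" using c(2) by (auto simp: quad_closure_def)
  show ?thesis
  proof (cases "c \<in> F")
    case True
    then show ?thesis using F by (auto simp: quad_closure_def)
  next
    case False
    have "insert c F \<subseteq> carrier R"
      using c(1) quadratic_tower_subfield[OF F(1) E] subfieldE(3) by blast
    then have "c \<in> generate_field R (insert c F)" using generate_fieldE(2)[OF _ refl] by blast
    then show ?thesis using quadratic_tower.step[OF F(1) c(1) False F(2)] by (auto simp: quad_closure_def)
  qed
qed

text \<open>y = ((y + 1)/2)^2 - ((y - 1)/2)^2, and -1 is the square of \<open>i\<close>.\<close>

lemma square_half_sum_diff:
  assumes two: "\<one> \<oplus> \<one> \<noteq> \<zero>" and i: "i \<in> carrier R" "i \<otimes> i = \<ominus> \<one>" and y: "y \<in> carrier R"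
    and h: "h = inv (\<one> \<oplus> \<one>)"
  shows "y = (h \<otimes> (y \<oplus> \<one>)) \<otimes> (h \<otimes> (y \<oplus> \<one>)) \<oplus> (i \<otimes> h \<otimes> (y \<ominus> \<one>)) \<otimes> (i \<otimes> h \<otimes> (y \<ominus> \<one>))"
proof -
  have hc: "h \<in> carrier R" and h1: "(\<one> \<oplus> \<one>) \<otimes> h = \<one>" using field_inv[OF _ two] h by auto
  have hh: "h \<oplus> h = \<one>" using h1 hc by (simp add: l_distr)
  define P where "P = h \<otimes> y"
  have P: "P \<in> carrier R" using hc y by (simp add: P_def)
  have PP: "P \<oplus> P = y" using hh l_distr[OF hc hc y] y by (simp add: P_def)
  have a: "h \<otimes> (y \<oplus> \<one>) = P \<oplus> h" unfolding P_def using hc y by algebra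
  have b: "i \<otimes> h \<otimes> (y \<ominus> \<one>) = i \<otimes> (P \<ominus> h)" unfolding P_def using hc y i(1) by algebra
  have c: "(i \<otimes> (P \<ominus> h)) \<otimes> (i \<otimes> (P \<ominus> h)) = (i \<otimes> i) \<otimes> ((P \<ominus> h) \<otimes> (P \<ominus> h))"
    using i(1) P hc by (simp add: m_ac)
  have "(P \<oplus> h) \<otimes> (P \<oplus> h) \<ominus> (P \<ominus> h) \<otimes> (P \<ominus> h) = (P \<oplus> P) \<otimes> (h \<oplus> h)"
    using P hc by algebra
  then have "(P \<oplus> h) \<otimes> (P \<oplus> h) \<oplus> (\<ominus> \<one>) \<otimes> ((P \<ominus> h) \<otimes> (P \<ominus> h)) = (P \<oplus> P) \<otimes> (h \<oplus> h)"
    using P hc by (simp add: l_minus minus_eq[of "(P \<oplus> h) \<otimes> (P \<oplus> h)"])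
  then show ?thesis unfolding a b c i(2) PP hh using y by simp
qed

lemma quad_closure_eq_pyth_closure:
  assumes E: "subfield E R" and two: "\<one> \<oplus> \<one> \<noteq> \<zero>" and i: "i \<in> carrier R" "i \<otimes> i = \<ominus> \<one>"
  shows "quad_closure R E = pyth_closure R (generate_field R (insert i E))"
proof
  let ?G = "generate_field R (insert i E)" and ?Q = "quad_closure R E"
  have iE: "insert i E \<subseteq> carrier R" using i(1) subfieldE(3)[OF E] by blast
  have G: "subfield ?G R" "insert i E \<subseteq> ?G"
    using generate_field_is_subfield[OF iE] generate_fieldE(2)[OF iE refl] by auto
  have Q: "subfield ?Q R" "E \<subseteq> ?Q"
    unfolding quad_closure_eq_tower_closure using subfield_tower_closure[of E "\<lambda>F. F", OF E] by auto
  have "\<ominus> \<one> \<in> ?Q" using subringE(3,5)[OF subfieldE(1)[OF Q(1)]] by blast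
  then have "i \<in> ?Q" using quad_closure_closed[OF E i(1)] i(2) by simp
  then have GQ: "?G \<subseteq> ?Q" using Q by (intro generate_field_min_subfield1[OF iE]) auto
  show "pyth_closure R ?G \<subseteq> ?Q"
  proof (rule pyth_closure_least[OF Q(1) GQ])
    fix c a b assume c: "c \<in> carrier R" "a \<in> ?Q" "b \<in> ?Q" "c \<otimes> c = a \<otimes> a \<oplus> b \<otimes> b"
    then have "c \<otimes> c \<in> ?Q" using subringE(6,7)[OF subfieldE(1)[OF Q(1)]] by simp
    then show "c \<in> ?Q" using quad_closure_closed[OF E c(1)] by blast
  qed
  let ?K = "pyth_closure R ?G"
  note K = subfield_pyth_closure[OF G(1)]
  note KE = subringE[OF subfieldE(1)[OF K]]
  have GK: "?G \<subseteq> ?K" by (rule pyth_closure_incl[OF G(1)])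
  show "?Q \<subseteq> ?K"
    unfolding quad_closure_eq_tower_closure
  proof (rule tower_closure_least)
    fix c assume c: "c \<in> carrier R" "c \<otimes> c \<in> ?K"
    define h where "h = inv (\<one> \<oplus> \<one>)"
    have "\<one> \<oplus> \<one> \<in> ?K - {\<zero>}" using KE(3,7) two by simp
    then have hK: "h \<in> ?K" unfolding h_def using subfield_m_inv(1)[OF K] by blast
    have iK: "i \<in> ?K" using G(2) GK by blast
    have "h \<otimes> (c \<otimes> c \<oplus> \<one>) \<in> ?K" "i \<otimes> h \<otimes> (c \<otimes> c \<ominus> \<one>) \<in> ?K"
      using hK iK c(2) KE(3,6,7) subring_minus[OF subfieldE(1)[OF K]] by simp_all
    then show "c \<in> ?K"
      using pyth_closure_closed[OF G(1) c(1)] square_half_sum_diff[OF two i _ h_def, of "c \<otimes> c"] c(1) by simp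
  qed (use K G GK in auto)
qed

section \<open>Sums of squares along a quadratic tower\<close>

inductive_set sum_of_squares :: "'a set \<Rightarrow> 'a set" for F where
  zero: "\<zero> \<in> sum_of_squares F"
| add: "\<lbrakk> a \<in> F; s \<in> sum_of_squares F \<rbrakk> \<Longrightarrow> a \<otimes> a \<oplus> s \<in> sum_of_squares F"

lemma sum_of_squares_mono:
  assumes "F \<subseteq> G" shows "s \<in> sum_of_squares F \<Longrightarrow> s \<in> sum_of_squares G"
  by (induct rule: sum_of_squares.induct) (use assms in \<open>auto intro: sum_of_squares.intros\<close>)

lemma square_in_sum_of_squares:
  assumes "F \<subseteq> carrier R" "a \<in> F" shows "a \<otimes> a \<in> sum_of_squares F"
  using sum_of_squares.add[OF assms(2) sum_of_squares.zero] assms by (simp add: subset_iff)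

text \<open>One square is absorbed at a time, each partial sum being replaced by the square of its
  root.\<close>

lemma sum_of_squares_in_pyth_closure_is_square:
  assumes E: "subfield E R" and sqrt: "\<And>x. x \<in> carrier R \<Longrightarrow> \<exists>c\<in>carrier R. c \<otimes> c = x"
    and s: "s \<in> sum_of_squares (pyth_closure R E)"
  shows "\<exists>t\<in>pyth_closure R E. t \<otimes> t = s"
  using s
proof (induct rule: sum_of_squares.induct)
  case zero
  show ?case using subringE(2)[OF subfieldE(1)[OF subfield_pyth_closure[OF E]]] by (intro bexI[of _ \<zero>]) auto
next
  case (add a s)
  then obtain t where t: "t \<in> pyth_closure R E" "t \<otimes> t = s" by blast
  then have c: "a \<in> carrier R" "t \<in> carrier R" using add(1) t subfieldE(3)[OF subfield_pyth_closure[OF E]] by blast+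
  have "a \<otimes> a \<oplus> t \<otimes> t \<in> carrier R" using c by simp
  from sqrt[OF this] obtain d where d: "d \<in> carrier R" "d \<otimes> d = a \<otimes> a \<oplus> t \<otimes> t" by blast
  then have "d \<in> pyth_closure R E" using pyth_closure_closed[OF E d(1) add(1) t(1)] by blast
  then show ?case using d(2) t(2) by (intro bexI[of _ d]) simp
qed

text \<open>Since v^2 c^2 = (v a)^2 + (v b)^2, the part of (u + v c)^2 without \<open>c\<close> is a
  sum of squares in \<open>F\<close>. The last conjunct concerns the conjugate under c -> -c,
  expressed by coordinates rather than by an automorphism.\<close>

lemma sum_of_squares_quad_ext:
  assumes F: "subfield F R" and c: "c \<in> carrier R" "c \<notin> F" "c \<otimes> c = a \<otimes> a \<oplus> b \<otimes> b" "a \<in> F" "b \<in> F"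
    and y: "y \<in> sum_of_squares (quad_ext F c)"
  shows "\<exists>A B. A \<in> sum_of_squares F \<and> A \<in> F \<and> B \<in> F \<and> y = A \<oplus> B \<otimes> c
    \<and> A \<ominus> B \<otimes> c \<in> sum_of_squares (quad_ext F c)"
  using y
proof (induct rule: sum_of_squares.induct)
  case zero
  show ?case using c(1) subringE(2)[OF subfieldE(1)[OF F]] sum_of_squares.zero
    by (intro exI[of _ \<zero>]) (auto simp: minus_eq)
next
  case (add t s)
  note FE = subringE[OF subfieldE(1)[OF F]]
  obtain A B where AB: "A \<in> sum_of_squares F" "A \<in> F" "B \<in> F" "s = A \<oplus> B \<otimes> c"
    "A \<ominus> B \<otimes> c \<in> sum_of_squares (quad_ext F c)" using add by blast
  obtain u v where uv: "u \<in> F" "v \<in> F" "t = u \<oplus> v \<otimes> c" using add(1) unfolding quad_ext_def by blast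
  have cc: "u \<in> carrier R" "v \<in> carrier R" "A \<in> carrier R" "B \<in> carrier R" "a \<in> carrier R" "b \<in> carrier R"
    using uv AB c(4,5) FE(1) by blast+
  define A' where "A' = u \<otimes> u \<oplus> ((v \<otimes> a) \<otimes> (v \<otimes> a) \<oplus> ((v \<otimes> b) \<otimes> (v \<otimes> b) \<oplus> A))"
  define B' where "B' = (u \<otimes> v \<oplus> u \<otimes> v) \<oplus> B"
  have A': "A' \<in> sum_of_squares F" "A' \<in> F" "B' \<in> F" unfolding A'_def B'_def
    using uv AB c(4,5) FE(6,7) by (auto intro!: sum_of_squares.add)
  have A'e: "A' = u \<otimes> u \<oplus> v \<otimes> v \<otimes> (c \<otimes> c) \<oplus> A" unfolding A'_def c(3) using cc by algebra
  have e1: "t \<otimes> t \<oplus> s = A' \<oplus> B' \<otimes> c" unfolding A'e B'_def uv(3) AB(4) using cc c(1) by algebra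
  have e2: "A' \<ominus> B' \<otimes> c = (u \<oplus> (\<ominus> v) \<otimes> c) \<otimes> (u \<oplus> (\<ominus> v) \<otimes> c) \<oplus> (A \<ominus> B \<otimes> c)"
    unfolding A'e B'_def using cc c(1) by algebra
  have "u \<oplus> (\<ominus> v) \<otimes> c \<in> quad_ext F c" unfolding quad_ext_def using uv FE(5) by blast
  then have "A' \<ominus> B' \<otimes> c \<in> sum_of_squares (quad_ext F c)" unfolding e2 using AB(5) by (rule sum_of_squares.add)
  then show ?case using A' e1 by blast
qed

text \<open>Unlike being a square, being a sum of squares descends: for an element of the smaller
  field the coefficient of \<open>c\<close> vanishes, and the remaining part is a sum of squares
  there.\<close>

lemma sum_of_squares_descend:
  assumes "quadratic_tower R (sums_of_two_squares R) G H" "subfield G R" "y \<in> sum_of_squares H" "y \<in> G"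
  shows "y \<in> sum_of_squares G"
  using assms
proof (induct rule: quadratic_tower.induct)
  case (step F c)
  have F: "subfield F R" "G \<subseteq> F" using quadratic_tower_subfield[OF step(1,6)] by auto
  note FE = subringE[OF subfieldE(1)[OF F(1)]]
  obtain a b where ab: "c \<otimes> c = a \<otimes> a \<oplus> b \<otimes> b" "a \<in> F" "b \<in> F"
    using step(5) by (auto simp: sums_of_two_squares_def)
  have cF: "c \<otimes> c \<in> F" unfolding ab using ab FE(6,7) by simp
  have "y \<in> sum_of_squares (quad_ext F c)"
    using step(7) generate_field_insert_eq_quad_ext[OF F(1) step(3,4) cF] by simp
  then obtain A B where AB: "A \<in> sum_of_squares F" "A \<in> F" "B \<in> F" "y = A \<oplus> B \<otimes> c"
    using sum_of_squares_quad_ext[OF F(1) step(3,4) ab] by blast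
  have yF: "y \<in> F" using step(8) F by blast
  then have yc: "y \<in> carrier R" "A \<in> carrier R" using FE(1) AB by auto
  have "y \<oplus> \<zero> \<otimes> c = A \<oplus> B \<otimes> c" using AB(4) yc step(3) by simp
  then have "y = A" using quad_ext_unique(1)[OF F(1) step(3,4) cF yF FE(2) AB(2,3)] by blast
  then show ?case using step AB(1) by blast
qed auto

end

section \<open>Descent of squares\<close>

context field
begin

lemma lincomb_in_module:
  assumes "\<zero> \<in> S" "\<And>x y. \<lbrakk> x \<in> S; y \<in> S \<rbrakk> \<Longrightarrow> x \<oplus> y \<in> S" "\<And>i. i < n \<Longrightarrow> f i \<otimes> u i \<in> S"
  shows "lincomb f u n \<in> S"
  using assms(3) by (induct n) (auto intro: assms(1,2))

text \<open>\<open>G\<close> varies over subrings while the vectors \<open>u\<close> stay fixed, so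
  that descent of an element means descent of its coordinates.\<close>

definition lspan :: "'a set \<Rightarrow> (nat \<Rightarrow> 'a) \<Rightarrow> nat \<Rightarrow> 'a set" where
  "lspan G u n = {lincomb \<kappa> u n | \<kappa>. \<forall>i. \<kappa> i \<in> G}"

lemma lspanI: "(\<And>i. \<kappa> i \<in> G) \<Longrightarrow> lincomb \<kappa> u n \<in> lspan G u n"
  unfolding lspan_def by blast

lemma lspan_mono: "G \<subseteq> H \<Longrightarrow> lspan G u n \<subseteq> lspan H u n"
  unfolding lspan_def by blast

context
  fixes u :: "nat \<Rightarrow> 'a" and n :: nat assumes u: "\<And>i. u i \<in> carrier R"
begin

lemma lspan_closed:
  assumes G: "subring G R"
  shows "lspan G u n \<subseteq> carrier R" "\<zero> \<in> lspan G u n"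
    "\<And>x y. \<lbrakk> x \<in> lspan G u n; y \<in> lspan G u n \<rbrakk> \<Longrightarrow> x \<oplus> y \<in> lspan G u n"
    "\<And>a x. \<lbrakk> a \<in> G; x \<in> lspan G u n \<rbrakk> \<Longrightarrow> a \<otimes> x \<in> lspan G u n"
proof -
  note GE = subringE[OF G]
  show "lspan G u n \<subseteq> carrier R" unfolding lspan_def using u GE(1) by (auto intro!: lincomb_closed)
  have "lincomb (\<lambda>_. \<zero>) u n = \<zero>" using u by (intro lincomb_zero) auto
  then show "\<zero> \<in> lspan G u n" using lspanI[of "\<lambda>_. \<zero>" G u n] GE(2) by simp
  fix x y assume "x \<in> lspan G u n" "y \<in> lspan G u n"
  then obtain \<kappa> \<mu> where k: "\<And>i. \<kappa> i \<in> G" "x = lincomb \<kappa> u n" "\<And>i. \<mu> i \<in> G" "y = lincomb \<mu> u n"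
    unfolding lspan_def by blast
  have kc: "\<And>i. \<kappa> i \<in> carrier R" "\<And>i. \<mu> i \<in> carrier R" using k(1,3) GE(1) by blast+
  have "x \<oplus> y = lincomb (\<lambda>i. \<kappa> i \<oplus> \<mu> i) u n" unfolding k(2,4) using kc u by (simp add: lincomb_add)
  then show "x \<oplus> y \<in> lspan G u n" using lspanI[of "\<lambda>i. \<kappa> i \<oplus> \<mu> i" G u n] k(1,3) GE(7) by simp
next
  note GE = subringE[OF G]
  fix a x assume a: "a \<in> G" and "x \<in> lspan G u n"
  then obtain \<kappa> where k: "\<And>i. \<kappa> i \<in> G" "x = lincomb \<kappa> u n" unfolding lspan_def by blast
  have kc: "\<And>i. \<kappa> i \<in> carrier R" "a \<in> carrier R" using k(1) a GE(1) by blast+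
  have "a \<otimes> x = lincomb (\<lambda>i. a \<otimes> \<kappa> i) u n" unfolding k(2) using kc u by (simp add: lincomb_smult)
  then show "a \<otimes> x \<in> lspan G u n" using lspanI[of "\<lambda>i. a \<otimes> \<kappa> i" G u n] k(1) a GE(6) by simp
qed

text \<open>By bilinearity it suffices that the structure constants of the vectors lie in
  \<open>G\<close>.\<close>

lemma lspan_mult:
  assumes G: "subring G R" and uu: "\<And>i j. \<lbrakk> i < n; j < n \<rbrakk> \<Longrightarrow> u i \<otimes> u j \<in> lspan G u n"
    and x: "x \<in> lspan G u n" and y: "y \<in> lspan G u n"
  shows "x \<otimes> y \<in> lspan G u n"
proof -
  note GE = subringE[OF G] and S = lspan_closed[OF G]
  obtain \<kappa> \<mu> where k: "\<And>i. \<kappa> i \<in> G" "x = lincomb \<kappa> u n" "\<And>i. \<mu> i \<in> G" "y = lincomb \<mu> u n"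
    using x y unfolding lspan_def by blast
  have kc: "\<And>i. \<kappa> i \<in> carrier R" "\<And>i. \<mu> i \<in> carrier R" "y \<in> carrier R" using k(1,3) GE(1) y S(1) by blast+
  have uy: "y \<otimes> u i \<in> lspan G u n" if i: "i < n" for i
  proof -
    have "y \<otimes> u i = u i \<otimes> y" using kc u by (simp add: m_comm)
    also have "\<dots> = lincomb \<mu> (\<lambda>j. u i \<otimes> u j) n" unfolding k(4) using kc u by (simp add: lincomb_mult_right)
    also have "\<dots> \<in> lspan G u n" by (intro lincomb_in_module S(2,3,4) k(3) uu i)
    finally show ?thesis .
  qed
  have "x \<otimes> y = y \<otimes> x" using x S(1) kc(3) m_comm by blast
  also have "\<dots> = lincomb \<kappa> (\<lambda>i. y \<otimes> u i) n" unfolding k(2) using kc u by (simp add: lincomb_mult_right)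
  also have "\<dots> \<in> lspan G u n" by (intro lincomb_in_module S(2,3,4) k(1) uy)
  finally show ?thesis .
qed

context
  fixes E :: "'a set" and x :: 'a
  assumes two: "\<one> \<oplus> \<one> \<noteq> \<zero>" and sqrt: "\<And>x. x \<in> carrier R \<Longrightarrow> \<exists>c\<in>carrier R. c \<otimes> c = x"
    and E: "subfield E R"
    and indep: "\<And>\<kappa> i. \<lbrakk> \<And>i. \<kappa> i \<in> pyth_closure R E; lincomb \<kappa> u n = \<zero>; i < n \<rbrakk> \<Longrightarrow> \<kappa> i = \<zero>"
    and uu: "\<And>i j. \<lbrakk> i < n; j < n \<rbrakk> \<Longrightarrow> u i \<otimes> u j \<in> lspan E u n"
    and x: "x \<in> lspan E u n" "x \<noteq> \<zero>"
begin

text \<open>The coefficient \<open>y\<close> is recovered from \<open>x\<close> up to squares; normalizing one coordinate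
  of \<open>\<kappa>\<close> makes the representation unique and hence fixed by the conjugations of the tower.\<close>

definition square_repr :: "nat \<Rightarrow> 'a set \<Rightarrow> bool" where
  "square_repr i0 G \<longleftrightarrow> (\<exists>y \<kappa>. y \<in> G \<and> (\<forall>i. \<kappa> i \<in> G) \<and> \<kappa> i0 = \<one> \<and>
     x = y \<otimes> (lincomb \<kappa> u n \<otimes> lincomb \<kappa> u n) \<and> (\<exists>s\<in>pyth_closure R E. s \<otimes> s = y))"

text \<open>Let v be the vector with coordinates \<kappa>, and let conjugation of G(c) over
  \<open>G\<close> act on \<open>y\<close> and on the coordinates. It fixes \<open>x\<close>, so
  besides x = y v^2 there is x = y' v'^2. As y = s^2 is a sum of squares, so is y', which therefore
  has a root \<open>r\<close> in the closure, and s v = r v' for a suitable sign. The coordinate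
  \<open>i0\<close> gives s = r; then all coordinates of v agree with their conjugates, and so does
  \<open>y\<close>.\<close>

lemma square_repr_descend_step:
  assumes G: "quadratic_tower R (sums_of_two_squares R) E G"
    and c: "c \<in> carrier R" "c \<notin> G" "c \<otimes> c \<in> sums_of_two_squares R G"
    and i0: "i0 < n" and sr: "square_repr i0 (generate_field R (insert c G))"
  shows "square_repr i0 G"
proof -
  let ?K = "pyth_closure R E"
  note K = subfield_pyth_closure[OF E]
  note KE = subringE[OF subfieldE(1)[OF K]]
  have Gs: "subfield G R" "E \<subseteq> G" using quadratic_tower_subfield[OF G E] by auto
  note GE = subringE[OF subfieldE(1)[OF Gs(1)]]
  obtain a b where ab: "c \<otimes> c = a \<otimes> a \<oplus> b \<otimes> b" "a \<in> G" "b \<in> G"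
    using c(3) by (auto simp: sums_of_two_squares_def)
  have cG: "c \<otimes> c \<in> G" unfolding ab using ab GE(6,7) by simp
  define H where "H = quad_ext G c"
  have Hg: "generate_field R (insert c G) = H"
    unfolding H_def by (rule generate_field_insert_eq_quad_ext[OF Gs(1) c(1,2) cG])
  have Hs: "subfield H R" unfolding H_def by (rule subfield_quad_ext[OF Gs(1) c(1,2) cG])
  have GH: "G \<subseteq> H" "c \<in> H" unfolding H_def using quad_ext_incl[OF Gs(1) c(1,2) cG] by auto
  have H: "quadratic_tower R (sums_of_two_squares R) E H"
    unfolding Hg[symmetric] by (rule quadratic_tower.step[OF G c])
  have HK: "H \<subseteq> ?K" using H by (auto simp: pyth_closure_def)
  have KH: "pyth_closure R H = ?K" using pyth_closure_between[OF E Hs _ HK] Gs(2) GH by blast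
  note uniq = quad_ext_unique[OF Gs(1) c(1,2) cG]
  obtain y \<kappa> s where y: "y \<in> H" "\<And>i. \<kappa> i \<in> H" "\<kappa> i0 = \<one>"
    "x = y \<otimes> (lincomb \<kappa> u n \<otimes> lincomb \<kappa> u n)" "s \<in> ?K" "s \<otimes> s = y"
    using sr unfolding square_repr_def Hg by blast
  obtain y0 y1 where y01: "y0 \<in> G" "y1 \<in> G" "y = y0 \<oplus> y1 \<otimes> c" using y(1) unfolding H_def quad_ext_def by blast
  have "\<forall>i. \<exists>A B. A \<in> G \<and> B \<in> G \<and> \<kappa> i = A \<oplus> B \<otimes> c" using y(2) unfolding H_def quad_ext_def by blast
  then obtain A B where AB: "\<And>i. A i \<in> G" "\<And>i. B i \<in> G" "\<And>i. \<kappa> i = A i \<oplus> B i \<otimes> c" by metis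
  have cc: "y0 \<in> carrier R" "y1 \<in> carrier R" "\<And>i. A i \<in> carrier R" "\<And>i. B i \<in> carrier R"
    "s \<in> carrier R" using y01 AB GE(1) y(5) KE(1) by blast+
  have AB0: "A i0 = \<one>" "B i0 = \<zero>"
  proof -
    have "A i0 \<oplus> B i0 \<otimes> c = \<one> \<oplus> \<zero> \<otimes> c" using y(3) AB(3)[of i0] c(1) by simp
    then show "A i0 = \<one>" "B i0 = \<zero>" using uniq[OF AB(1,2) GE(3,2)] by blast+
  qed
  define v0 v1 where "v0 = lincomb A u n" and "v1 = lincomb B u n"
  have vS: "v0 \<in> lspan G u n" "v1 \<in> lspan G u n" unfolding v0_def v1_def using AB by (auto intro: lspanI)
  note S = lspan_closed[OF subfieldE(1)[OF Gs(1)]]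
  have vc: "v0 \<in> carrier R" "v1 \<in> carrier R" using vS S(1) by blast+
  have k: "lincomb \<kappa> u n = v0 \<oplus> c \<otimes> v1"
  proof -
    have "lincomb \<kappa> u n = lincomb (\<lambda>i. A i \<oplus> c \<otimes> B i) u n"
      using AB(3) cc c(1) by (intro lincomb_cong) (auto simp: m_comm)
    then show ?thesis unfolding v0_def v1_def using cc c(1) u by (simp add: lincomb_add lincomb_smult)
  qed
  have uuG: "u i \<otimes> u j \<in> lspan G u n" if "i < n" "j < n" for i j
    using uu[OF that] lspan_mono[OF Gs(2)] by blast
  have mult: "p \<otimes> q \<in> lspan G u n" if "p \<in> lspan G u n" "q \<in> lspan G u n" for p q
    by (rule lspan_mult[OF subfieldE(1)[OF Gs(1)] _ that]) (rule uuG)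
  \<comment> \<open>The expansion of y v^2 as P + c Q; both parts have coordinates in
    \<open>G\<close> because the structure constants do.\<close>
  define P where "P = y0 \<otimes> (v0 \<otimes> v0 \<oplus> (c \<otimes> c) \<otimes> (v1 \<otimes> v1)) \<oplus> (y1 \<otimes> (c \<otimes> c)) \<otimes> (v0 \<otimes> v1 \<oplus> v0 \<otimes> v1)"
  define Q where "Q = y1 \<otimes> (v0 \<otimes> v0 \<oplus> (c \<otimes> c) \<otimes> (v1 \<otimes> v1)) \<oplus> y0 \<otimes> (v0 \<otimes> v1 \<oplus> v0 \<otimes> v1)"
  have PQ: "P \<in> lspan G u n" "Q \<in> lspan G u n"
  proof -
    have t1: "v0 \<otimes> v0 \<oplus> (c \<otimes> c) \<otimes> (v1 \<otimes> v1) \<in> lspan G u n"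
      by (rule S(3)[OF mult[OF vS(1,1)] S(4)[OF cG mult[OF vS(2,2)]]])
    have t2: "v0 \<otimes> v1 \<oplus> v0 \<otimes> v1 \<in> lspan G u n"
      by (rule S(3)[OF mult[OF vS(1,2)] mult[OF vS(1,2)]])
    show "P \<in> lspan G u n" unfolding P_def
      by (rule S(3)[OF S(4)[OF y01(1) t1] S(4)[OF GE(6)[OF y01(2) cG] t2]])
    show "Q \<in> lspan G u n" unfolding Q_def by (rule S(3)[OF S(4)[OF y01(2) t1] S(4)[OF y01(1) t2]])
  qed
  then have PQc: "P \<in> carrier R" "Q \<in> carrier R" using S(1) by blast+
  define T U where "T = v0 \<otimes> v0 \<oplus> (c \<otimes> c) \<otimes> (v1 \<otimes> v1)" and "U = v0 \<otimes> v1 \<oplus> v0 \<otimes> v1"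
  have TU: "T \<in> carrier R" "U \<in> carrier R" unfolding T_def U_def using vc c(1) by auto
  have sq1: "(v0 \<oplus> c \<otimes> v1) \<otimes> (v0 \<oplus> c \<otimes> v1) = T \<oplus> c \<otimes> U"
    and sq2: "(v0 \<ominus> c \<otimes> v1) \<otimes> (v0 \<ominus> c \<otimes> v1) = T \<ominus> c \<otimes> U"
    unfolding T_def U_def using vc c(1) by algebra+
  have P: "P = y0 \<otimes> T \<oplus> (y1 \<otimes> (c \<otimes> c)) \<otimes> U" and Q: "Q = y1 \<otimes> T \<oplus> y0 \<otimes> U"
    by (simp_all only: P_def Q_def T_def U_def)
  have xPQ: "x = P \<oplus> c \<otimes> Q" unfolding y(4) k y01(3) sq1 P Q using cc(1,2) TU c(1) by algebra
  have xS: "x \<in> lspan G u n" using x(1) lspan_mono[OF Gs(2)] by blast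
  then obtain \<xi> where \<xi>: "\<And>i. \<xi> i \<in> G" "x = lincomb \<xi> u n" unfolding lspan_def by blast
  obtain \<pi> \<theta> where \<pi>: "\<And>i. \<pi> i \<in> G" "P = lincomb \<pi> u n" "\<And>i. \<theta> i \<in> G" "Q = lincomb \<theta> u n"
    using PQ unfolding lspan_def by blast
  have \<pi>c: "\<And>i. \<pi> i \<in> carrier R" "\<And>i. \<theta> i \<in> carrier R" "\<And>i. \<xi> i \<in> carrier R" using \<pi> \<xi> GE(1) by blast+
  let ?\<delta> = "\<lambda>i. (\<pi> i \<oplus> \<ominus> \<xi> i) \<oplus> c \<otimes> \<theta> i"
  have "lincomb ?\<delta> u n = (P \<oplus> \<ominus> x) \<oplus> c \<otimes> Q"
    unfolding \<pi>(2,4) \<xi>(2) using \<pi>c c(1) u by (simp add: lincomb_add lincomb_smult lincomb_minus)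
  also have "\<dots> = \<zero>" unfolding xPQ using PQc c(1) by algebra
  finally have \<delta>0: "lincomb ?\<delta> u n = \<zero>" .
  have \<delta>K: "?\<delta> i \<in> ?K" for i
    using \<pi>(1,3)[of i] \<xi>(1)[of i] GH HK KE(5,6,7) by (simp add: subset_iff)
  \<comment> \<open>\<open>x\<close> has coordinates in \<open>G\<close> as well. Comparing
    coordinates over the closure, and then the parts with and without \<open>c\<close>, makes those
    of \<open>Q\<close> vanish.\<close>
  have \<theta>0: "\<theta> i = \<zero>" if "i < n" for i
  proof -
    have "?\<delta> i = \<zero>" by (rule indep[OF \<delta>K \<delta>0 that])
    then have "(\<pi> i \<oplus> \<ominus> \<xi> i) \<oplus> \<theta> i \<otimes> c = \<zero>" using \<pi>c c(1) by (simp add: m_comm)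
    then show ?thesis
      using quad_ext_unique_zero(2)[OF Gs(1) c(1,2) cG _ \<pi>(3)] \<pi>(1) \<xi>(1) GE(5,7) by blast
  qed
  have Q0: "Q = \<zero>" unfolding \<pi>(4) by (rule lincomb_zero[OF \<theta>0 u])
  define y' where "y' = y0 \<ominus> y1 \<otimes> c"
  define v' where "v' = v0 \<ominus> c \<otimes> v1"
  have y'c: "y' \<in> carrier R" "v' \<in> carrier R" unfolding y'_def v'_def using cc vc c(1) by auto
  have "y' \<otimes> (v' \<otimes> v') = P \<ominus> c \<otimes> Q"
    unfolding y'_def v'_def sq2 P Q using cc(1,2) TU c(1) by algebra
  then have x': "x = y' \<otimes> (v' \<otimes> v')" using xPQ Q0 PQc c(1) by (simp add: minus_eq)
  obtain W where W: "quadratic_tower R (sums_of_two_squares R) H W" "s \<in> W"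
    using pyth_closure_finite[OF Hs, of "{s}"] y(5) KH by auto
  have Ws: "subfield W R" using quadratic_tower_subfield[OF W(1) Hs] by blast
  have "y \<in> sum_of_squares W"
    unfolding y(6)[symmetric] by (rule square_in_sum_of_squares[OF subfieldE(3)[OF Ws] W(2)])
  \<comment> \<open>The root \<open>s\<close> may lie higher in the tower than \<open>H\<close>; the
    property of being a sum of squares descends to \<open>H\<close>, where conjugation makes
    sense.\<close>
  then have "y \<in> sum_of_squares H" using sum_of_squares_descend[OF W(1) Hs _ y(1)] by blast
  then obtain A' B' where A'B': "A' \<in> G" "B' \<in> G" "y = A' \<oplus> B' \<otimes> c" "A' \<ominus> B' \<otimes> c \<in> sum_of_squares H"
    using sum_of_squares_quad_ext[OF Gs(1) c(1,2) ab] unfolding H_def by blast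
  have "y0 = A'" "y1 = B'" using uniq[OF y01(1,2) A'B'(1,2)] y01(3) A'B'(3) by metis+
  then have "y' \<in> sum_of_squares ?K" using A'B'(4) sum_of_squares_mono[OF HK] unfolding y'_def by blast
  then obtain s' where s': "s' \<in> ?K" "s' \<otimes> s' = y'"
    using sum_of_squares_in_pyth_closure_is_square[OF E sqrt] by blast
  have s'c: "s' \<in> carrier R" using s'(1) KE(1) by blast
  let ?v = "v0 \<oplus> c \<otimes> v1"
  have vvc: "?v \<in> carrier R" using vc c(1) by simp
  have sq: "(s \<otimes> ?v) \<otimes> (s \<otimes> ?v) = (s' \<otimes> v') \<otimes> (s' \<otimes> v')"
  proof -
    have "(s \<otimes> ?v) \<otimes> (s \<otimes> ?v) = (s \<otimes> s) \<otimes> (?v \<otimes> ?v)" using cc vvc by (simp add: m_ac del: a_closed)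
    also have "\<dots> = x" unfolding y(6) y(4) k ..
    also have "\<dots> = (s' \<otimes> s') \<otimes> (v' \<otimes> v')" unfolding s'(2) by (rule x')
    also have "\<dots> = (s' \<otimes> v') \<otimes> (s' \<otimes> v')" using s'c y'c by (simp add: m_ac)
    finally show ?thesis .
  qed
  \<comment> \<open>By equality of their squares, \<open>s v\<close> and \<open>s' v'\<close> agree
    up to sign, and the sign is absorbed into the root.\<close>
  have "\<exists>r\<in>?K. r \<otimes> r = y' \<and> s \<otimes> ?v = r \<otimes> v'"
  proof -
    have "(s \<otimes> ?v \<ominus> s' \<otimes> v') \<otimes> (s \<otimes> ?v \<oplus> s' \<otimes> v') = \<zero>"
    proof -
      have "(p \<ominus> q) \<otimes> (p \<oplus> q) = p \<otimes> p \<ominus> q \<otimes> q" if "p \<in> carrier R" "q \<in> carrier R" for p q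
        using that by algebra
      then show ?thesis using sq cc(5) vvc s'c y'c by simp
    qed
    then have "s \<otimes> ?v \<ominus> s' \<otimes> v' = \<zero> \<or> s \<otimes> ?v \<oplus> s' \<otimes> v' = \<zero>"
      by (rule integral) (use cc(5) vvc s'c y'c in auto)
    then show ?thesis
    proof
      assume "s \<otimes> ?v \<ominus> s' \<otimes> v' = \<zero>"
      then show ?thesis using s' cc(5) vvc s'c y'c by auto
    next
      assume "s \<otimes> ?v \<oplus> s' \<otimes> v' = \<zero>"
      then have "s \<otimes> ?v = \<ominus> (s' \<otimes> v')" using minus_equality[of "s \<otimes> ?v" "s' \<otimes> v'"] cc(5) vvc s'c y'c by simp
      then have "s \<otimes> ?v = (\<ominus> s') \<otimes> v'" using s'c y'c by (simp add: l_minus)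
      moreover have "(\<ominus> s') \<otimes> (\<ominus> s') = y'" using s'c s'(2) y'c by (simp add: l_minus r_minus)
      ultimately show ?thesis using s'(1) KE(5) by blast
    qed
  qed
  then obtain r where r: "r \<in> ?K" "r \<otimes> r = y'" "s \<otimes> ?v = r \<otimes> v'" by blast
  have rc: "r \<in> carrier R" using r(1) KE(1) by blast
  let ?\<epsilon> = "\<lambda>i. s \<otimes> (A i \<oplus> c \<otimes> B i) \<oplus> \<ominus> (r \<otimes> (A i \<oplus> \<ominus> (c \<otimes> B i)))"
  have "lincomb ?\<epsilon> u n = s \<otimes> ?v \<oplus> \<ominus> (r \<otimes> (v0 \<oplus> \<ominus> (c \<otimes> v1)))"
    unfolding v0_def v1_def using cc rc c(1) u by (simp add: lincomb_add lincomb_smult lincomb_minus)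
  also have "\<dots> = \<zero>" unfolding r(3) v'_def using rc vc c(1) by (simp add: minus_eq r_neg)
  finally have \<epsilon>0: "lincomb ?\<epsilon> u n = \<zero>" .
  have \<epsilon>K: "?\<epsilon> i \<in> ?K" for i
    using AB(1,2)[of i] GH HK KE(5,6,7) y(5) r(1) by (simp add: subset_iff)
  have \<epsilon>: "s \<otimes> (A i \<oplus> c \<otimes> B i) = r \<otimes> (A i \<oplus> \<ominus> (c \<otimes> B i))" if "i < n" for i
  proof -
    have "?\<epsilon> i = \<zero>" by (rule indep[OF \<epsilon>K \<epsilon>0 that])
    then show ?thesis using cc rc c(1) r_right_minus_eq[of "s \<otimes> (A i \<oplus> c \<otimes> B i)" "r \<otimes> (A i \<oplus> \<ominus> (c \<otimes> B i))"]
      by (simp add: minus_eq)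
  qed
  \<comment> \<open>In the normalized coordinate \<open>A i0\<close> is \<one> and
    \<open>B i0\<close> is \<zero>, so that only the two roots remain.\<close>
  have sr': "s = r" using \<epsilon>[OF i0] AB0 cc rc c(1) by simp
  have sz: "s \<noteq> \<zero>"
  proof
    assume "s = \<zero>"
    then have "y = \<zero>" using y(6) by auto
    then show False using y(4) x(2) k vvc by simp
  qed
  have cz: "c \<noteq> \<zero>" using c(2) GE(2) by blast
  \<comment> \<open>The coefficient of \<open>c\<close> in an element equal to its conjugate
    vanishes, as the characteristic is not 2.\<close>
  have dbl: "t = \<zero>" if t: "t \<in> carrier R" "p \<in> carrier R" "p \<oplus> t \<otimes> c = p \<oplus> \<ominus> (t \<otimes> c)" for t p
  proof -
    have "t \<otimes> c = \<ominus> (t \<otimes> c)" using add.l_cancel[of p "t \<otimes> c" "\<ominus> (t \<otimes> c)"] t c(1) by simp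
    then have "t \<otimes> c \<oplus> t \<otimes> c = \<ominus> (t \<otimes> c) \<oplus> t \<otimes> c" by (rule arg_cong)
    then have "t \<otimes> c \<oplus> t \<otimes> c = \<zero>" using t c(1) by (simp add: l_neg)
    moreover have "t \<otimes> c \<oplus> t \<otimes> c = (\<one> \<oplus> \<one>) \<otimes> (t \<otimes> c)" using t c(1) by (simp add: l_distr)
    ultimately have "(\<one> \<oplus> \<one>) \<otimes> (t \<otimes> c) = \<zero>" by simp
    then have "t \<otimes> c = \<zero>" using integral[of "\<one> \<oplus> \<one>" "t \<otimes> c"] two t c(1) by auto
    then show ?thesis using integral[of t c] cz t c(1) by auto
  qed
  have Bz: "B i = \<zero>" if i: "i < n" for i
  proof (rule dbl)
    have "s \<otimes> (A i \<oplus> c \<otimes> B i) = s \<otimes> (A i \<oplus> \<ominus> (c \<otimes> B i))" using \<epsilon>[OF i] sr' by simp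
    then have "A i \<oplus> c \<otimes> B i = A i \<oplus> \<ominus> (c \<otimes> B i)" using m_lcancel[OF sz cc(5)] cc c(1) by simp
    then show "A i \<oplus> B i \<otimes> c = A i \<oplus> \<ominus> (B i \<otimes> c)" using cc(4) c(1) by (simp add: m_comm)
  qed (use cc in auto)
  have "y1 = \<zero>"
  proof (rule dbl)
    show "y0 \<oplus> y1 \<otimes> c = y0 \<oplus> \<ominus> (y1 \<otimes> c)" using r(2) y(6) sr' y01(3) by (simp add: y'_def minus_eq)
  qed (use cc in auto)
  then have "y = y0" using y01(3) cc c(1) by simp
  moreover have "lincomb \<kappa> u n = lincomb A u n"
    using AB(3) Bz cc c(1) by (intro lincomb_cong) auto
  ultimately show ?thesis unfolding square_repr_def using y y01(1) AB(1) AB0(1) by (intro exI[of _ y0] exI[of _ A]) auto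
qed

lemma square_repr_descend:
  assumes "quadratic_tower R (sums_of_two_squares R) E G" "i0 < n" "square_repr i0 G"
  shows "square_repr i0 E"
  using assms by (induct rule: quadratic_tower.induct) (auto dest: square_repr_descend_step)

text \<open>Initially the coefficient is a^2 for a nonzero coordinate \<open>a\<close> of
  \<open>w\<close>, and w/a has a coordinate equal to \<one>. All of this lives in a finite stage of
  the tower, from which it descends to \<open>E\<close>.\<close>

lemma square_descends:
  assumes w: "w \<in> lspan (pyth_closure R E) u n" "w \<otimes> w = x"
  shows "\<exists>e m. e \<in> E \<and> m \<in> lspan E u n \<and> x = e \<otimes> (m \<otimes> m)"
proof -
  let ?K = "pyth_closure R E"
  note K = subfield_pyth_closure[OF E]
  note KE = subringE[OF subfieldE(1)[OF K]]
  obtain \<kappa> where k: "\<And>i. \<kappa> i \<in> ?K" "w = lincomb \<kappa> u n" using w(1) unfolding lspan_def by blast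
  have kc: "\<And>i. \<kappa> i \<in> carrier R" using k(1) KE(1) by blast
  have "\<exists>i<n. \<kappa> i \<noteq> \<zero>"
  proof (rule ccontr)
    assume "\<not> ?thesis"
    then have "w = \<zero>" unfolding k(2) using u by (intro lincomb_zero) auto
    then show False using w(2) x(2) by simp
  qed
  then obtain i0 where i0: "i0 < n" "\<kappa> i0 \<noteq> \<zero>" by blast
  let ?a = "\<kappa> i0"
  have a: "inv ?a \<in> ?K" "inv ?a \<in> carrier R" "?a \<otimes> inv ?a = \<one>" "?a \<otimes> ?a \<in> ?K"
    using subfield_m_inv(1)[OF K, of ?a] k(1)[of i0] i0(2) field_inv[OF kc i0(2)] KE(6) by auto
  \<comment> \<open>From \<open>n\<close> on, the value \<one> keeps \<mu> inside the finite set
    \<open>T\<close>, so that one stage \<open>G\<close> of the tower contains every value.\<close>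
  define \<mu> where "\<mu> = (\<lambda>i. if i < n then inv ?a \<otimes> \<kappa> i else \<one>)"
  have \<mu>K: "\<mu> i \<in> ?K" for i unfolding \<mu>_def using a k(1) KE(3,6) by simp
  have m: "lincomb \<mu> u n = inv ?a \<otimes> w"
  proof -
    have "lincomb \<mu> u n = lincomb (\<lambda>i. inv ?a \<otimes> \<kappa> i) u n" by (rule lincomb_cong) (auto simp: \<mu>_def)
    then show ?thesis unfolding k(2) using a kc u by (simp add: lincomb_smult)
  qed
  have wc: "w \<in> carrier R" unfolding k(2) using kc u by blast
  have "(?a \<otimes> ?a) \<otimes> ((inv ?a \<otimes> w) \<otimes> (inv ?a \<otimes> w)) = ((?a \<otimes> inv ?a) \<otimes> (?a \<otimes> inv ?a)) \<otimes> (w \<otimes> w)"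
    using kc[of i0] a(2) wc by (simp add: m_ac)
  then have xe: "x = (?a \<otimes> ?a) \<otimes> (lincomb \<mu> u n \<otimes> lincomb \<mu> u n)" unfolding m a(3) using w(2) wc by auto
  define T where "T = insert \<one> (insert (?a \<otimes> ?a) (\<mu> ` {..<n}))"
  have "finite T" "T \<subseteq> ?K" unfolding T_def using a \<mu>K KE(3) by auto
  then obtain G where G: "quadratic_tower R (sums_of_two_squares R) E G" "T \<subseteq> G"
    using pyth_closure_finite[OF E] by blast
  have "\<mu> i \<in> G" for i
  proof (cases "i < n")
    case True
    then show ?thesis using G(2) unfolding T_def by auto
  next
    case False
    then show ?thesis using G(2) unfolding T_def \<mu>_def by auto
  qed
  moreover have "\<mu> i0 = \<one>" using i0 field_inv(4)[OF kc i0(2)] by (simp add: \<mu>_def)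
  moreover have "?a \<otimes> ?a \<in> G" using G(2) unfolding T_def by blast
  ultimately have "square_repr i0 G"
    unfolding square_repr_def using xe k(1)[of i0] by (intro exI[of _ "?a \<otimes> ?a"] exI[of _ \<mu>]) blast
  then have "square_repr i0 E" using square_repr_descend[OF G(1) i0(1)] by blast
  then show ?thesis unfolding square_repr_def using lspanI[of _ E u n] by blast
qed

end
end

text \<open>An embedding of a subfield into the ambient field, as a function of which only the
  values on \<open>D\<close> matter. Conjugations are obtained by extending such maps one element at
  a time.\<close>

definition partial_hom :: "'a set \<Rightarrow> ('a \<Rightarrow> 'a) \<Rightarrow> bool" where
  "partial_hom D \<phi> \<longleftrightarrow> subfield D R \<and> \<phi> ` D \<subseteq> carrier R \<and> \<phi> \<one> = \<one> \<and>
     (\<forall>x\<in>D. \<forall>y\<in>D. \<phi> (x \<oplus> y) = \<phi> x \<oplus> \<phi> y \<and> \<phi> (x \<otimes> y) = \<phi> x \<otimes> \<phi> y)"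

lemma partial_hom_props:
  assumes h: "partial_hom D \<phi>"
  shows "subfield D R" "\<And>x. x \<in> D \<Longrightarrow> \<phi> x \<in> carrier R" "\<phi> \<one> = \<one>" "\<phi> \<zero> = \<zero>"
    "\<And>x y. \<lbrakk> x \<in> D; y \<in> D \<rbrakk> \<Longrightarrow> \<phi> (x \<oplus> y) = \<phi> x \<oplus> \<phi> y"
    "\<And>x y. \<lbrakk> x \<in> D; y \<in> D \<rbrakk> \<Longrightarrow> \<phi> (x \<otimes> y) = \<phi> x \<otimes> \<phi> y"
    "\<And>x. x \<in> D \<Longrightarrow> \<phi> (\<ominus> x) = \<ominus> \<phi> x"
    "\<And>x. \<lbrakk> x \<in> D; x \<noteq> \<zero> \<rbrakk> \<Longrightarrow> \<phi> x \<noteq> \<zero>"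
proof -
  show D: "subfield D R" and c: "\<And>x. x \<in> D \<Longrightarrow> \<phi> x \<in> carrier R" and one: "\<phi> \<one> = \<one>"
    and add: "\<And>x y. \<lbrakk> x \<in> D; y \<in> D \<rbrakk> \<Longrightarrow> \<phi> (x \<oplus> y) = \<phi> x \<oplus> \<phi> y"
    and mult: "\<And>x y. \<lbrakk> x \<in> D; y \<in> D \<rbrakk> \<Longrightarrow> \<phi> (x \<otimes> y) = \<phi> x \<otimes> \<phi> y"
    using h unfolding partial_hom_def by auto
  note DE = subringE[OF subfieldE(1)[OF D]]
  have "\<phi> \<zero> \<oplus> \<phi> \<zero> = \<phi> \<zero>" using add[OF DE(2,2)] by simp
  then show z: "\<phi> \<zero> = \<zero>" using c[OF DE(2)] by (metis add.r_cancel_one)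
  show "\<phi> (\<ominus> x) = \<ominus> \<phi> x" if x: "x \<in> D" for x
  proof -
    have xc: "x \<in> carrier R" using x DE(1) by blast
    have "\<phi> (\<ominus> x) \<oplus> \<phi> x = \<zero>" using add[OF DE(5)[OF x] x] z xc by (simp add: l_neg)
    then show ?thesis using minus_equality c x DE(5) by metis
  qed
  show "\<phi> x \<noteq> \<zero>" if x: "x \<in> D" "x \<noteq> \<zero>" for x
  proof
    assume s: "\<phi> x = \<zero>"
    have i: "inv x \<in> D" "x \<otimes> inv x = \<one>" using subfield_m_inv[OF D, of x] x by auto
    have "\<one> = \<phi> x \<otimes> \<phi> (inv x)" using mult[OF x(1) i(1)] i(2) one by simp
    then show False unfolding s using c[OF i(1)] by simp
  qed
qed

section \<open>Extending an embedding to a simple algebraic extension\<close>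

context
  fixes D :: "'a set" and \<phi> :: "'a \<Rightarrow> 'a" and c b :: 'a and f :: "nat \<Rightarrow> 'a" and n :: nat
  assumes h: "partial_hom D \<phi>" and c: "c \<in> carrier R" and b: "b \<in> carrier R"
    and f: "\<And>i. f i \<in> D" "f n \<noteq> \<zero>" "peval f (Suc n) c = \<zero>"
    and least: "\<And>g m. \<lbrakk> \<And>i. g i \<in> D; g m \<noteq> \<zero>; peval g (Suc m) c = \<zero> \<rbrakk> \<Longrightarrow> n \<le> m"
    and root: "peval (\<lambda>i. \<phi> (f i)) (Suc n) b = \<zero>"
begin

lemmas hp = partial_hom_props[OF h]
lemmas DE = subringE[OF subfieldE(1)[OF hp(1)]]

text \<open>Division by \<open>f\<close>, the relation of least degree for \<open>c\<close>: every
  relation is cut down by multiples of shifts of \<open>f\<close>, and the image of \<open>f\<close>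
  vanishes at \<open>b\<close>. This makes the substitution of \<open>b\<close> for \<open>c\<close>
  well defined.\<close>

lemma peval_kernel:
  assumes "\<And>i. g i \<in> D" "peval g m c = \<zero>"
  shows "peval (\<lambda>i. \<phi> (g i)) m b = \<zero>"
  using assms
proof (induct m arbitrary: g)
  case (Suc k)
  have gc: "\<And>i. g i \<in> carrier R" "\<And>i. \<phi> (g i) \<in> carrier R" using Suc(2) DE(1) hp(2) by blast+
  show ?case
  proof (cases "g k = \<zero>")
    case True
    then have "peval g k c = \<zero>" using Suc(3) gc c by simp
    then show ?thesis using Suc(1)[of g] Suc(2) True hp(4) b by simp
  next
    case False
    then have nk: "n \<le> k" using least[of g k] Suc(2,3) by blast
    define a where "a = g k \<otimes> inv (f n)"
    have fn: "f n \<in> carrier R" "inv (f n) \<in> D" "inv (f n) \<in> carrier R" "inv (f n) \<otimes> f n = \<one>"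
      using f(1,2) DE(1) subfield_m_inv(1)[OF hp(1), of "f n"] field_inv[of "f n"] by auto
    have aD: "a \<in> D" unfolding a_def using Suc(2) fn DE(6) by blast
    then have ac: "a \<in> carrier R" "\<phi> a \<in> carrier R" using DE(1) hp(2) by blast+
    define s where "s = k - n"
    have ks: "Suc k = s + Suc n" using nk by (simp add: s_def)
    \<comment> \<open>The coefficients of X^s f(X); \<open>a\<close> times it has the same top
      coefficient as \<open>g\<close>, so that subtraction shortens \<open>g\<close>.\<close>
    define F where "F = (\<lambda>i. if s \<le> i then f (i - s) else \<zero>)"
    have FD: "F i \<in> D" for i using f(1) DE(2) by (simp add: F_def)
    have Fc: "\<And>i. F i \<in> carrier R" "\<And>i. \<phi> (F i) \<in> carrier R" using FD DE(1) hp(2) by blast+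
    have F1: "peval F (Suc k) c = \<zero>"
    proof -
      have "peval F s c = \<zero>" using c by (intro lincomb_zero) (auto simp: F_def)
      moreover have "peval (\<lambda>i. F (i + s)) (Suc n) c = \<zero>" using f(3) by (simp add: F_def)
      ultimately show ?thesis unfolding ks using peval_split[of F c s "Suc n", OF Fc(1) c] c
        by (simp del: lincomb.simps)
    qed
    have F2: "peval (\<lambda>i. \<phi> (F i)) (Suc k) b = \<zero>"
    proof -
      have "peval (\<lambda>i. \<phi> (F i)) s b = \<zero>" using b hp(4) by (intro lincomb_zero) (auto simp: F_def)
      moreover have "peval (\<lambda>i. \<phi> (F (i + s))) (Suc n) b = \<zero>" using root by (simp add: F_def)
      ultimately show ?thesis unfolding ks using peval_split[of "\<lambda>i. \<phi> (F i)" b s "Suc n", OF Fc(2) b] b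
        by (simp del: lincomb.simps)
    qed
    define G where "G = (\<lambda>i. g i \<oplus> \<ominus> (a \<otimes> F i))"
    have GD: "G i \<in> D" for i unfolding G_def using Suc(2)[of i] aD FD[of i] DE(5,6,7) by simp
    have Gc: "\<And>i. G i \<in> carrier R" using GD DE(1) by blast
    have "F k = f n" using nk by (simp add: F_def s_def)
    then have Gk: "G k = \<zero>" unfolding G_def a_def using fn gc by (simp add: m_assoc r_neg)
    have "peval G (Suc k) c = peval g (Suc k) c \<oplus> \<ominus> (a \<otimes> peval F (Suc k) c)"
      unfolding G_def using gc ac Fc c by (simp add: lincomb_add lincomb_smult lincomb_minus del: lincomb.simps)
    then have "peval G (Suc k) c = \<zero>" using Suc(3) F1 ac by simp
    then have "peval G k c = \<zero>" using Gk Gc c by simp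
    then have 1: "peval (\<lambda>i. \<phi> (G i)) (Suc k) b = \<zero>" using Suc(1)[of G] GD Gk hp(4) b by simp
    have "\<phi> (G i) = \<phi> (g i) \<oplus> \<ominus> (\<phi> a \<otimes> \<phi> (F i))" for i
      unfolding G_def using Suc(2) aD FD DE(5,6) hp(5,6,7) by simp
    then have "peval (\<lambda>i. \<phi> (G i)) (Suc k) b = peval (\<lambda>i. \<phi> (g i)) (Suc k) b \<oplus> \<ominus> (\<phi> a \<otimes> peval (\<lambda>i. \<phi> (F i)) (Suc k) b)"
      using gc ac Fc b by (simp add: lincomb_add lincomb_smult lincomb_minus del: lincomb.simps)
    then show ?thesis using 1 F2 ac gc b by (simp del: lincomb.simps add: lincomb_closed)
  qed
qed simp

text \<open>The graph of the extension, kept as a relation because an element of D[c] has many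
  polynomial representations; that it is a function is shown afterwards.\<close>

definition ext_graph :: "'a \<Rightarrow> 'a \<Rightarrow> bool" where
  "ext_graph y z \<longleftrightarrow> (\<exists>g m. (\<forall>i. g i \<in> D) \<and> y = peval g m c \<and> z = peval (\<lambda>i. \<phi> (g i)) m b)"

lemma ext_graph_truncate:
  assumes g: "\<And>i. g i \<in> D" and mN: "m \<le> N"
  obtains g' where "\<And>i. g' i \<in> D" "peval g m c = peval g' N c"
    "peval (\<lambda>i. \<phi> (g i)) m b = peval (\<lambda>i. \<phi> (g' i)) N b"
proof -
  let ?g = "\<lambda>i. if i < m then g i else \<zero>"
  have D: "?g i \<in> D" for i using g DE(2) by simp
  have cc: "?g i \<in> carrier R" "\<phi> (?g i) \<in> carrier R" for i using D[of i] DE(1) hp(2) by blast+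
  have "peval ?g N c = peval ?g m c" using mN cc(1) c by (intro lincomb_extend) auto
  also have "\<dots> = peval g m c" by (rule lincomb_cong) auto
  finally have 1: "peval g m c = peval ?g N c" ..
  have "peval (\<lambda>i. \<phi> (?g i)) N b = peval (\<lambda>i. \<phi> (?g i)) m b" using mN cc(2) b hp(4) by (intro lincomb_extend) auto
  also have "\<dots> = peval (\<lambda>i. \<phi> (g i)) m b" by (rule lincomb_cong) auto
  finally show ?thesis using that[OF D 1] by simp
qed

lemma ext_graph_add:
  assumes "ext_graph y z" "ext_graph y' z'" shows "ext_graph (y \<oplus> y') (z \<oplus> z')"
proof -
  obtain g m where g: "\<And>i. g i \<in> D" "y = peval g m c" "z = peval (\<lambda>i. \<phi> (g i)) m b"
    using assms(1) unfolding ext_graph_def by blast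
  obtain g' m' where g': "\<And>i. g' i \<in> D" "y' = peval g' m' c" "z' = peval (\<lambda>i. \<phi> (g' i)) m' b"
    using assms(2) unfolding ext_graph_def by blast
  define N where "N = max m m'"
  obtain k where k: "\<And>i. k i \<in> D" "y = peval k N c" "z = peval (\<lambda>i. \<phi> (k i)) N b"
    using ext_graph_truncate[of g m N] g by (auto simp: N_def)
  obtain k' where k': "\<And>i. k' i \<in> D" "y' = peval k' N c" "z' = peval (\<lambda>i. \<phi> (k' i)) N b"
    using ext_graph_truncate[of g' m' N] g' by (auto simp: N_def)
  have cc: "\<And>i. k i \<in> carrier R" "\<And>i. k' i \<in> carrier R" "\<And>i. \<phi> (k i) \<in> carrier R" "\<And>i. \<phi> (k' i) \<in> carrier R"
    using k(1) k'(1) DE(1) hp(2) by blast+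
  have "y \<oplus> y' = peval (\<lambda>i. k i \<oplus> k' i) N c" unfolding k k' using cc c by (simp add: lincomb_add)
  moreover have "z \<oplus> z' = peval (\<lambda>i. \<phi> (k i \<oplus> k' i)) N b"
    unfolding k k' using cc b k(1) k'(1) hp(5) by (simp add: lincomb_add)
  ultimately show ?thesis unfolding ext_graph_def using k(1) k'(1) DE(7)
    by (intro exI[of _ "\<lambda>i. k i \<oplus> k' i"] exI[of _ N]) simp
qed

lemma ext_graph_smult:
  assumes a: "a \<in> D" and "ext_graph y z" shows "ext_graph (a \<otimes> y) (\<phi> a \<otimes> z)"
proof -
  obtain g m where g: "\<And>i. g i \<in> D" "y = peval g m c" "z = peval (\<lambda>i. \<phi> (g i)) m b"
    using assms(2) unfolding ext_graph_def by blast
  have cc: "\<And>i. g i \<in> carrier R" "\<And>i. \<phi> (g i) \<in> carrier R" "a \<in> carrier R" "\<phi> a \<in> carrier R"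
    using g(1) a DE(1) hp(2) by blast+
  have "a \<otimes> y = peval (\<lambda>i. a \<otimes> g i) m c" unfolding g using cc c by (simp add: lincomb_smult)
  moreover have "\<phi> a \<otimes> z = peval (\<lambda>i. \<phi> (a \<otimes> g i)) m b"
    unfolding g using cc b g(1) a hp(6) by (simp add: lincomb_smult)
  ultimately show ?thesis unfolding ext_graph_def using g(1) a DE(6)
    by (intro exI[of _ "\<lambda>i. a \<otimes> g i"] exI[of _ m]) simp
qed

lemma ext_graph_shift:
  assumes "ext_graph y z" shows "ext_graph (c \<otimes> y) (b \<otimes> z)"
proof -
  obtain g m where g: "\<And>i. g i \<in> D" "y = peval g m c" "z = peval (\<lambda>i. \<phi> (g i)) m b"
    using assms unfolding ext_graph_def by blast
  let ?k = "\<lambda>i. case i of 0 \<Rightarrow> \<zero> | Suc j \<Rightarrow> g j"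
  have D: "?k i \<in> D" for i using g(1) DE(2) by (simp split: nat.splits)
  have cc: "?k i \<in> carrier R" "\<phi> (?k i) \<in> carrier R" for i using D[of i] DE(1) hp(2) by blast+
  have gc: "\<And>i. g i \<in> carrier R" "\<And>i. \<phi> (g i) \<in> carrier R" using g(1) DE(1) hp(2) by blast+
  have "c \<otimes> y = peval ?k (Suc m) c" unfolding g(2) using peval_Suc[of ?k c m, OF cc(1) c] gc c by simp
  moreover have "b \<otimes> z = peval (\<lambda>i. \<phi> (?k i)) (Suc m) b"
    unfolding g(3) using peval_Suc[of "\<lambda>i. \<phi> (?k i)" b m, OF cc(2) b] hp(4) gc b by simp
  ultimately show ?thesis unfolding ext_graph_def using D by (intro exI[of _ ?k] exI[of _ "Suc m"]) blast
qed

lemma ext_graph_closed: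
  assumes "ext_graph y z" shows "y \<in> carrier R \<and> z \<in> carrier R"
proof -
  obtain g m where g: "\<And>i. g i \<in> D" "y = peval g m c" "z = peval (\<lambda>i. \<phi> (g i)) m b"
    using assms unfolding ext_graph_def by blast
  have "\<And>i. g i \<in> carrier R" "\<And>i. \<phi> (g i) \<in> carrier R" using g(1) DE(1) hp(2) by blast+
  then show ?thesis unfolding g using c b by auto
qed

lemma ext_graph_mult:
  assumes 1: "ext_graph y z" and 2: "ext_graph y' z'" shows "ext_graph (y \<otimes> y') (z \<otimes> z')"
proof -
  note cl = ext_graph_closed
  have sh: "ext_graph (c [^] j \<otimes> y) (b [^] j \<otimes> z)" for j :: nat
  proof (induct j)
    case 0
    then show ?case using 1 cl[OF 1] by simp
  next
    case (Suc j)
    have "c [^] Suc j \<otimes> y = c \<otimes> (c [^] j \<otimes> y)" "b [^] Suc j \<otimes> z = b \<otimes> (b [^] j \<otimes> z)"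
      using c b cl[OF 1] by (simp_all add: m_ac)
    then show ?case using ext_graph_shift[OF Suc] by simp
  qed
  obtain g m where g: "\<And>i. g i \<in> D" "y' = peval g m c" "z' = peval (\<lambda>i. \<phi> (g i)) m b"
    using 2 unfolding ext_graph_def by blast
  have gc: "\<And>i. g i \<in> carrier R" "\<And>i. \<phi> (g i) \<in> carrier R" using g(1) DE(1) hp(2) by blast+
  have "ext_graph (y \<otimes> peval g m c) (z \<otimes> peval (\<lambda>i. \<phi> (g i)) m b)" for m
  proof (induct m)
    case 0
    have "ext_graph \<zero> \<zero>" unfolding ext_graph_def using DE(2) by (intro exI[of _ "\<lambda>_. \<zero>"] exI[of _ 0]) simp
    then show ?case using cl[OF 1] by simp
  next
    case (Suc m)
    have "y \<otimes> peval g (Suc m) c = y \<otimes> peval g m c \<oplus> g m \<otimes> (c [^] m \<otimes> y)"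
      using cl[OF 1] gc c by (simp add: r_distr m_ac)
    moreover have "z \<otimes> peval (\<lambda>i. \<phi> (g i)) (Suc m) b = z \<otimes> peval (\<lambda>i. \<phi> (g i)) m b \<oplus> \<phi> (g m) \<otimes> (b [^] m \<otimes> z)"
      using cl[OF 1] gc b by (simp add: r_distr m_ac)
    ultimately show ?case using ext_graph_add[OF Suc ext_graph_smult[OF g(1) sh]] by simp
  qed
  then show ?thesis unfolding g(2,3) .
qed

lemma ext_graph_functional:
  assumes 1: "ext_graph y z" and 2: "ext_graph y z'" shows "z = z'"
proof -
  have "ext_graph (\<ominus> \<one> \<otimes> y) (\<phi> (\<ominus> \<one>) \<otimes> z')" by (rule ext_graph_smult[OF DE(5)[OF DE(3)] 2])
  from ext_graph_add[OF 1 this]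
  obtain g m where g: "\<And>i. g i \<in> D" "y \<oplus> \<ominus> \<one> \<otimes> y = peval g m c" "z \<oplus> \<phi> (\<ominus> \<one>) \<otimes> z' = peval (\<lambda>i. \<phi> (g i)) m b"
    unfolding ext_graph_def by blast
  note cl = ext_graph_closed
  have "peval g m c = \<zero>" using g(2) cl[OF 1] by (simp add: l_minus r_neg)
  then have "z \<oplus> \<phi> (\<ominus> \<one>) \<otimes> z' = \<zero>" using g(1,3) peval_kernel by simp
  then have "z \<ominus> z' = \<zero>" using hp(3) hp(7)[OF DE(3)] cl[OF 1] cl[OF 2] by (simp add: l_minus minus_eq)
  then show ?thesis using cl[OF 1] cl[OF 2] by simp
qed

lemma exists_partial_hom_adjoin:
  assumes "subfield (simple_extension D c) R"
  shows "\<exists>\<tau>. partial_hom (simple_extension D c) \<tau> \<and> (\<forall>x\<in>D. \<tau> x = \<phi> x) \<and> \<tau> c = b"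
proof -
  define \<tau> where "\<tau> y = (THE z. ext_graph y z)" for y
  have \<tau>: "\<tau> y = z" if "ext_graph y z" for y z
    unfolding \<tau>_def using that ext_graph_functional by blast
  have ex: "ext_graph y (\<tau> y)" if y: "y \<in> simple_extension D c" for y
  proof -
    obtain g m where "\<And>i. g i \<in> D" "y = peval g m c"
      using simple_extension_imp_peval[OF subfieldE(1)[OF hp(1)] c y] by blast
    then have "ext_graph y (peval (\<lambda>i. \<phi> (g i)) m b)" unfolding ext_graph_def by blast
    then show ?thesis using \<tau> by simp
  qed
  have D: "\<tau> x = \<phi> x" if x: "x \<in> D" for x
  proof (rule \<tau>)
    have "x \<in> carrier R" "\<phi> x \<in> carrier R" using x DE(1) hp(2) by blast+
    then show "ext_graph x (\<phi> x)" unfolding ext_graph_def using x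
      by (intro exI[of _ "\<lambda>_. x"] exI[of _ "Suc 0"]) simp
  qed
  have one: "ext_graph \<one> \<one>" unfolding ext_graph_def using DE(3) hp(3)
    by (intro exI[of _ "\<lambda>_. \<one>"] exI[of _ "Suc 0"]) simp
  have cb: "\<tau> c = b" using \<tau>[OF ext_graph_shift[OF one]] c b by simp
  have im: "\<tau> y \<in> carrier R" if y: "y \<in> simple_extension D c" for y
  proof -
    obtain g m where g: "\<And>i. g i \<in> D" "\<tau> y = peval (\<lambda>i. \<phi> (g i)) m b" using ex[OF y] unfolding ext_graph_def by blast
    have "\<And>i. \<phi> (g i) \<in> carrier R" using g(1) hp(2) by blast
    then show ?thesis unfolding g using b by auto
  qed
  have "partial_hom (simple_extension D c) \<tau>"
    unfolding partial_hom_def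
    using assms im D[OF DE(3)] hp(3) \<tau>[OF ext_graph_add[OF ex ex]] \<tau>[OF ext_graph_mult[OF ex ex]] by auto
  then show ?thesis using D cb by blast
qed

end

end

section \<open>Conjugates\<close>

context field
begin

lemma exists_minimal_relation:
  assumes D: "subring D R" and y: "y \<in> carrier R" "alg_rel D y"
  obtains f n where "\<And>i. f i \<in> D" "f n \<noteq> \<zero>" "0 < n" "peval f (Suc n) y = \<zero>"
    "\<forall>g m. (\<forall>i. g i \<in> D) \<longrightarrow> g m \<noteq> \<zero> \<longrightarrow> peval g (Suc m) y = \<zero> \<longrightarrow> n \<le> m"
proof -
  note DE = subringE[OF D]
  let ?Q = "\<lambda>n. \<exists>f. (\<forall>i. f i \<in> D) \<and> f n \<noteq> \<zero> \<and> peval f (Suc n) y = \<zero>"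
  have "\<exists>n. ?Q n"
  proof (cases "y = \<zero>")
    case True
    have "peval (\<lambda>i. if i = 0 then \<zero> else \<one>) (Suc 1) y = \<zero>" using True by simp
    then show ?thesis using DE(2,3)
      by (intro exI[of _ 1] exI[of _ "\<lambda>i. if i = 0 then \<zero> else \<one>"]) auto
  next
    case False
    obtain f n where "\<And>i. f i \<in> D" "f 0 \<noteq> \<zero>" "f n \<noteq> \<zero>" "peval f (Suc n) y = \<zero>"
      using alg_rel_trim[OF D y(1) False y(2)] by blast
    then show ?thesis by blast
  qed
  define n where "n = (LEAST n. ?Q n)"
  have "?Q n" unfolding n_def by (rule LeastI_ex) fact
  then obtain f where f: "\<And>i. f i \<in> D" "f n \<noteq> \<zero>" "peval f (Suc n) y = \<zero>" by blast
  have least: "n \<le> m" if "?Q m" for m unfolding n_def by (rule Least_le) (rule that)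
  have fc: "\<And>i. f i \<in> carrier R" using f(1) DE(1) by blast
  have "0 < n"
  proof (rule ccontr)
    assume "\<not> 0 < n"
    then show False using f(2,3) fc by simp
  qed
  show ?thesis
    by (rule that[of f n, OF f(1,2) \<open>0 < n\<close> f(3)]) (use least in blast)
qed

lemma partial_hom_lincomb:
  assumes h: "partial_hom D \<phi>" and "\<And>i. f i \<in> D" "\<And>i. u i \<in> D"
  shows "\<phi> (lincomb f u n) = lincomb (\<lambda>i. \<phi> (f i)) (\<lambda>i. \<phi> (u i)) n"
proof (induct n)
  case 0
  then show ?case using partial_hom_props(4)[OF h] by simp
next
  case (Suc n)
  have "lincomb f u n \<in> D"
    using lincomb_in_subring[OF subfieldE(1)[OF partial_hom_props(1)[OF h]]] assms(2,3) by blast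
  then show ?case
    using Suc partial_hom_props(5,6)[OF h] assms(2,3) subringE(6)[OF subfieldE(1)[OF partial_hom_props(1)[OF h]]] by simp
qed

text \<open>Finitely many elements involve finitely many coefficients. This brings the structure
  constants of an extension into a finite stage of the tower.\<close>

lemma lspan_finite:
  assumes u: "\<And>i. u i \<in> carrier R" and K: "subring K R"
    and Z: "finite Z" "Z \<subseteq> lspan K u n"
  shows "\<exists>T. finite T \<and> T \<subseteq> K \<and> (\<forall>G. subring G R \<longrightarrow> T \<subseteq> G \<longrightarrow> Z \<subseteq> lspan G u n)"
  using Z
proof (induct Z rule: finite_induct)
  case (insert z Z)
  then obtain T where T: "finite T" "T \<subseteq> K" "\<And>G. \<lbrakk> subring G R; T \<subseteq> G \<rbrakk> \<Longrightarrow> Z \<subseteq> lspan G u n" by auto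
  obtain \<kappa> where k: "\<And>i. \<kappa> i \<in> K" "z = lincomb \<kappa> u n" using insert(4) unfolding lspan_def by blast
  have "z \<in> lspan G u n" if G: "subring G R" "\<kappa> ` {..<n} \<subseteq> G" for G
  proof -
    let ?\<mu> = "\<lambda>i. if i < n then \<kappa> i else \<zero>"
    have "z = lincomb ?\<mu> u n" unfolding k(2) by (rule lincomb_cong) auto
    moreover have "\<And>i. ?\<mu> i \<in> G" using G(2) subringE(2)[OF G(1)] by auto
    ultimately show ?thesis unfolding lspan_def by blast
  qed
  then show ?case using T k(1) by (intro exI[of _ "T \<union> \<kappa> ` {..<n}"]) auto
qed auto

lemma quadratic_tower_finitely_generated:
  assumes "quadratic_tower R rad E F" "subfield E R"
  shows "\<exists>S. finite S \<and> S \<subseteq> carrier R \<and> F \<subseteq> generate_field R (E \<union> S)"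
  using assms
proof (induct rule: quadratic_tower.induct)
  case base
  show ?case using generate_field.incl by (intro exI[of _ "{}"]) auto
next
  case (step F c)
  then obtain S where S: "finite S" "S \<subseteq> carrier R" "F \<subseteq> generate_field R (E \<union> S)" by blast
  have c: "E \<union> insert c S \<subseteq> carrier R" using S(2) step(3) subfieldE(3)[OF step(6)] by blast
  have F: "F \<subseteq> carrier R" using quadratic_tower_subfield[OF step(1,6)] subfieldE(3) by blast
  have "generate_field R (E \<union> S) \<subseteq> generate_field R (E \<union> insert c S)"
    using c by (intro mono_generate_field) auto
  then have "generate_field R (insert c F) \<subseteq> generate_field R (E \<union> insert c S)"
    using S(3) F step(3) generate_field.incl[of c "E \<union> insert c S" R]
    by (intro generate_field_min_subfield1 generate_field_is_subfield c) auto
  then show ?case using S step(3) by (intro exI[of _ "insert c S"]) auto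
qed

text \<open>In a finite \<open>k\<close>, -1 would be a multiple of \<one>, hence a sum of squares
  and a square in the closure. Then every element of \<open>k\<close> is a sum of two squares there
  and has a root, algebraic over \<open>k\<close> and so in \<open>k\<close>. Squaring would be a
  bijection of \<open>k\<close>, but it identifies \<one> and -1.\<close>

lemma infinite_of_pyth_closed:
  assumes two: "\<one> \<oplus> \<one> \<noteq> \<zero>" and sqrt: "\<And>x. x \<in> carrier R \<Longrightarrow> \<exists>c\<in>carrier R. c \<otimes> c = x"
    and E: "subfield E R" and k: "subfield k R" "k \<subseteq> pyth_closure R E"
    and closed: "\<And>y. \<lbrakk> y \<in> pyth_closure R E; alg_rel k y \<rbrakk> \<Longrightarrow> y \<in> k"
  shows "infinite k"
proof
  assume fin: "finite k"
  let ?K = "pyth_closure R E"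
  note K = subfield_pyth_closure[OF E]
  note KE = subringE[OF subfieldE(1)[OF K]] and kE = subringE[OF subfieldE(1)[OF k(1)]]
  have kn: "[n] \<cdot> \<one> \<in> k" for n :: nat using kE(2,3,7) by (induct n) auto
  have "\<not> inj (\<lambda>n::nat. [n] \<cdot> \<one>)"
  proof
    assume "inj (\<lambda>n::nat. [n] \<cdot> \<one>)"
    then have "infinite (range (\<lambda>n::nat. [n] \<cdot> \<one>))" using finite_imageD infinite_UNIV_nat by blast
    moreover have "range (\<lambda>n::nat. [n] \<cdot> \<one>) \<subseteq> k" using kn by blast
    ultimately show False using fin finite_subset by blast
  qed
  then obtain a b :: nat where ab: "[a] \<cdot> \<one> = [b] \<cdot> \<one>" "a < b"
    unfolding inj_def by (metis linorder_neqE_nat)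
  then obtain m where m: "b = a + Suc m" using less_imp_Suc_add by auto
  have "[a] \<cdot> \<one> \<oplus> \<zero> = [a] \<cdot> \<one> \<oplus> [Suc m] \<cdot> \<one>" using ab m add.nat_pow_mult[of \<one> a "Suc m"] by simp
  then have "[Suc m] \<cdot> \<one> = \<zero>" using add.l_cancel[of "[a] \<cdot> \<one>" \<zero> "[Suc m] \<cdot> \<one>"] by simp
  then have m1: "[m] \<cdot> \<one> = \<ominus> \<one>" using minus_equality[of "[m] \<cdot> \<one>" \<one>] by simp
  have "[n] \<cdot> \<one> \<in> sum_of_squares ?K" for n :: nat
  proof (induct n)
    case (Suc n)
    have "\<one> \<otimes> \<one> \<oplus> [n] \<cdot> \<one> \<in> sum_of_squares ?K" by (rule sum_of_squares.add[OF KE(3) Suc])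
    then show ?case by (simp add: a_comm)
  qed (simp add: sum_of_squares.zero)
  then obtain i where i: "i \<in> ?K" "i \<otimes> i = \<ominus> \<one>"
    using sum_of_squares_in_pyth_closure_is_square[OF E sqrt, of "\<ominus> \<one>"] m1 by metis
  have ic: "i \<in> carrier R" using i KE(1) by blast
  define h where "h = inv (\<one> \<oplus> \<one>)"
  have "\<one> \<oplus> \<one> \<in> ?K - {\<zero>}" using KE(3,7) two by simp
  then have hK: "h \<in> ?K" unfolding h_def using subfield_m_inv(1)[OF K] by blast
  have surj: "\<exists>c\<in>k. c \<otimes> c = x" if x: "x \<in> k" for x
  proof -
    have xc: "x \<in> carrier R" "x \<in> ?K" using x k(2) kE(1) by blast+
    obtain c where c: "c \<in> carrier R" "c \<otimes> c = x" using sqrt[OF xc(1)] by blast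
    have "h \<otimes> (x \<oplus> \<one>) \<in> ?K" "i \<otimes> h \<otimes> (x \<ominus> \<one>) \<in> ?K"
      using hK i(1) xc(2) KE(3,6,7) subring_minus[OF subfieldE(1)[OF K]] by simp_all
    then have cK: "c \<in> ?K"
      using pyth_closure_closed[OF E c(1)] square_half_sum_diff[OF two ic i(2) xc(1) h_def] c(2) by simp
    let ?f = "\<lambda>j::nat. if j = 0 then \<ominus> x else if j = 1 then \<zero> else \<one>"
    have "peval ?f 3 c = \<zero>" using c xc by (simp add: numeral_3_eq_3 l_neg)
    then have "alg_rel k c" using x kE(2,3,5) by (intro alg_relI[of ?f k 2 3]) auto
    then show ?thesis using closed[OF cK] c(2) by blast
  qed
  have "k \<subseteq> (\<lambda>c. c \<otimes> c) ` k" using surj by blast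
  moreover have "(\<lambda>c. c \<otimes> c) ` k \<subseteq> k" using kE(6) by blast
  ultimately have "inj_on (\<lambda>c. c \<otimes> c) k" using fin eq_card_imp_inj_on[of k "\<lambda>c. c \<otimes> c"] by (metis subset_antisym)
  moreover have "\<ominus> \<one> \<otimes> \<ominus> \<one> = \<one> \<otimes> \<one>" by (simp add: l_minus)
  ultimately have "\<ominus> \<one> = \<one>" using kE(3,5) by (meson inj_onD)
  then have "\<one> \<oplus> \<one> = \<zero>" using r_neg[OF one_closed] by simp
  then show False using two by blast
qed

end

section \<open>Conjugates inside an algebraically closed field, and the contradiction\<close>

context algebraically_closed
begin

lemma exists_square_root:
  assumes x: "x \<in> carrier L" shows "\<exists>c\<in>carrier L. c \<otimes> c = x"
proof -
  let ?f = "\<lambda>j::nat. if j = 0 then \<ominus> x else if j = 1 then \<zero> else \<one>"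
  have f: "\<And>i. ?f i \<in> carrier L" "?f 2 \<noteq> \<zero>" "0 < (2::nat)" using x by simp_all
  obtain c where c: "c \<in> carrier L" "peval ?f (Suc 2) c = \<zero>"
    by (rule exists_peval_root[of ?f 2, OF f]) (rule that)
  have "peval ?f (Suc 2) c = \<ominus> x \<oplus> c \<otimes> c" using x c(1) by (simp add: numeral_2_eq_2)
  then have "\<ominus> x \<oplus> c \<otimes> c = \<zero>" using c(2) by simp
  then have "c \<otimes> c = x" using x c(1) minus_equality[of "\<ominus> x" "c \<otimes> c"]
    by (metis a_inv_closed m_closed minus_equality minus_minus r_neg a_comm)
  then show ?thesis using c(1) by blast
qed

text \<open>At each step the image of a minimal relation has a root in \<open>L\<close>, which
  becomes the image of the new element.\<close>

lemma extend_partial_hom: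
  assumes Y: "finite Y" "Y \<subseteq> carrier L" and h: "partial_hom D \<phi>" and alg: "\<And>y. y \<in> Y \<Longrightarrow> alg_rel D y"
  shows "\<exists>D' \<psi>. partial_hom D' \<psi> \<and> D \<subseteq> D' \<and> Y \<subseteq> D' \<and> (\<forall>x\<in>D. \<psi> x = \<phi> x)"
  using Y alg
proof (induct Y rule: finite_induct)
  case empty
  then show ?case using h by blast
next
  case (insert y Y)
  then obtain D' \<psi> where D': "partial_hom D' \<psi>" "D \<subseteq> D'" "Y \<subseteq> D'" "\<And>x. x \<in> D \<Longrightarrow> \<psi> x = \<phi> x" by auto
  note hp = partial_hom_props[OF D'(1)]
  have y: "y \<in> carrier L" "alg_rel D' y" using insert alg_rel_mono[OF D'(2)] by auto
  obtain f n where f: "\<And>i. f i \<in> D'" "f n \<noteq> \<zero>" "0 < n" "peval f (Suc n) y = \<zero>"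
    "\<forall>g m. (\<forall>i. g i \<in> D') \<longrightarrow> g m \<noteq> \<zero> \<longrightarrow> peval g (Suc m) y = \<zero> \<longrightarrow> n \<le> m"
    by (rule exists_minimal_relation[OF subfieldE(1)[OF hp(1)] y]) (rule that)
  obtain b where b: "b \<in> carrier L" "peval (\<lambda>i. \<psi> (f i)) (Suc n) b = \<zero>"
    using exists_peval_root[of "\<lambda>i. \<psi> (f i)" n] hp(2,8) f(1,2,3) by metis
  have sf: "subfield (simple_extension D' y) L"
    using simple_extension_is_subfield[OF hp(1) y(1)] alg_rel_iff_algebraic[OF subfieldE(1)[OF hp(1)] y(1)] y(2) by simp
  have "\<exists>\<tau>. partial_hom (simple_extension D' y) \<tau> \<and> (\<forall>x\<in>D'. \<tau> x = \<psi> x) \<and> \<tau> y = b"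
    by (rule exists_partial_hom_adjoin[OF D'(1) y(1) b(1) f(1,2,4) _ b(2) sf]) (use f(5) in blast)
  then obtain \<tau> where \<tau>: "partial_hom (simple_extension D' y) \<tau>" "\<And>x. x \<in> D' \<Longrightarrow> \<tau> x = \<psi> x"
    by metis
  have "D' \<subseteq> simple_extension D' y" "y \<in> simple_extension D' y"
    using simple_extension_incl[OF subfieldE(3)[OF hp(1)] y(1)] simple_extension_mem[OF subfieldE(1)[OF hp(1)] y(1)] by auto
  then show ?case using \<tau> D' by (intro exI[of _ "simple_extension D' y"] exI[of _ \<tau>]) auto
qed

text \<open>Some Frobenius power of \<open>x\<close> is a simple root of a minimal relation, whose
  degree is at least 2 because that power is not in \<open>K\<close>. The quotient by the known
  linear factor has a root, different from the power since the quotient does not vanish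
  there.\<close>

lemma exists_conjugate:
  assumes K: "subfield K L" and x: "x \<in> carrier L" "alg_rel K x" and insep: "\<And>e. x [^] (char_exp ^ e) \<notin> K"
  shows "\<exists>e D \<tau>. partial_hom D \<tau> \<and> K \<subseteq> D \<and> x [^] (char_exp ^ e) \<in> D \<and> (\<forall>y\<in>K. \<tau> y = y)
    \<and> \<tau> (x [^] (char_exp ^ e)) \<noteq> x [^] (char_exp ^ e)"
proof -
  note KE = subringE[OF subfieldE(1)[OF K]]
  obtain e f n q where f: "\<And>i. f i \<in> K" "f n \<noteq> \<zero>" "0 < n" and q: "\<And>i. q i \<in> carrier L" "q (n - 1) \<noteq> \<zero>"
    and fq: "\<And>y. y \<in> carrier L \<Longrightarrow> peval f (Suc n) y = (y \<ominus> x [^] (char_exp ^ e)) \<otimes> peval q n y"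
    and nz: "peval q n (x [^] (char_exp ^ e)) \<noteq> \<zero>"
    and least: "\<forall>g m. (\<forall>i. g i \<in> K) \<longrightarrow> g m \<noteq> \<zero> \<longrightarrow> peval g (Suc m) (x [^] (char_exp ^ e)) = \<zero> \<longrightarrow> n \<le> m"
    by (rule exists_separable_power[OF K x]) (rule that)
  define \<gamma> where "\<gamma> = x [^] (char_exp ^ e)"
  have \<gamma>: "\<gamma> \<in> carrier L" "\<gamma> \<notin> K" using x insep by (auto simp: \<gamma>_def)
  have fc: "\<And>i. f i \<in> carrier L" using f(1) KE(1) by blast
  have f\<gamma>: "peval f (Suc n) \<gamma> = \<zero>" using fq[OF \<gamma>(1)] q(1) \<gamma>(1) by (simp add: \<gamma>_def[symmetric] minus_eq r_neg del: lincomb.simps)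
  have "n \<noteq> 1"
  proof
    assume n: "n = 1"
    have "f 0 \<oplus> f 1 \<otimes> \<gamma> = \<zero>" using f\<gamma> n fc \<gamma> by simp
    then have "f 0 = \<ominus> (f 1 \<otimes> \<gamma>)" using minus_equality[of "f 0" "f 1 \<otimes> \<gamma>"] fc \<gamma>(1) by simp
    then have "f 1 \<otimes> \<gamma> = \<ominus> f 0" using fc \<gamma>(1) by simp
    then have "f 1 \<otimes> \<gamma> \<in> K" using f(1) KE(5) by simp
    then show False using subfield_m_inv_simprule[OF K _ \<gamma>(1), of "f 1"] f(1,2) n \<gamma>(2) by blast
  qed
  then have n2: "0 < n - 1" "n = Suc (n - 1)" using f(3) by auto
  obtain b where b: "b \<in> carrier L" "peval q (Suc (n - 1)) b = \<zero>"
    using exists_peval_root[of q "n - 1"] q n2 by blast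
  then have qb: "peval q n b = \<zero>" using n2(2) by metis
  have fb: "peval f (Suc n) b = \<zero>" using fq[OF b(1)] qb b(1) x(1) by simp
  have b\<gamma>: "b \<noteq> \<gamma>" using qb nz by (auto simp: \<gamma>_def)
  have id: "partial_hom K (\<lambda>y. y)" unfolding partial_hom_def using K KE(1) by auto
  have "alg_rel K \<gamma>" using alg_relI[of f K n "Suc n" \<gamma>] f f\<gamma> by blast
  then have sf: "subfield (simple_extension K \<gamma>) L"
    using simple_extension_is_subfield[OF K \<gamma>(1)] alg_rel_iff_algebraic[OF subfieldE(1)[OF K] \<gamma>(1)] by simp
  have "\<exists>\<tau>. partial_hom (simple_extension K \<gamma>) \<tau> \<and> (\<forall>y\<in>K. \<tau> y = y) \<and> \<tau> \<gamma> = b"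
    by (rule exists_partial_hom_adjoin[OF id \<gamma>(1) b(1) f(1,2) f\<gamma> _ fb sf]) (use least in \<open>unfold \<gamma>_def, blast\<close>)
  then obtain \<tau> where \<tau>: "partial_hom (simple_extension K \<gamma>) \<tau>" "\<And>y. y \<in> K \<Longrightarrow> \<tau> y = y" "\<tau> \<gamma> = b"
    by metis
  have "K \<subseteq> simple_extension K \<gamma>" "\<gamma> \<in> simple_extension K \<gamma>"
    using simple_extension_incl[OF KE(1) \<gamma>(1)] simple_extension_mem[OF subfieldE(1)[OF K] \<gamma>(1)] by auto
  then show ?thesis using \<tau> b\<gamma> unfolding \<gamma>_def by blast
qed

lemma algebraics_subfield:
  assumes k: "subfield k L" shows "subfield {x \<in> carrier L. alg_rel k x} L"
proof -
  have "{x \<in> carrier L. alg_rel k x} = {x \<in> carrier L. (algebraic over k) x}"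
    using alg_rel_iff_algebraic[OF subfieldE(1)[OF k]] by blast
  then show ?thesis using subfield_of_algebraics[OF k] by simp
qed

text \<open>Everything lives in one algebraically closed field, so that \<phi>, the constants and
  the places can be compared. The structure of \<open>F\<close> over the closure is given by
  coordinates with respect to the basis \<open>u\<close>.\<close>

lemma no_pythagorean_extension:
  assumes two: "\<one> \<oplus> \<one> \<noteq> \<zero>" and k: "subfield k L" "k \<subseteq> E" and E: "subfield E L"
    and S: "finite S" "S \<subseteq> carrier L" "E \<subseteq> generate_field L (k \<union> S)"
    and t: "t \<in> E" "\<not> alg_rel k t"
    and F: "subfield F L" "pyth_closure L E \<subseteq> F"
    and u: "\<And>i. u i \<in> F" "F = lspan (pyth_closure L E) u n"
    and indep: "\<And>\<kappa> i. \<lbrakk> \<And>i. \<kappa> i \<in> pyth_closure L E; lincomb \<kappa> u n = \<zero>; i < n \<rbrakk> \<Longrightarrow> \<kappa> i = \<zero>"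
    and algF: "\<And>y. y \<in> F \<Longrightarrow> alg_rel (pyth_closure L E) y"
    and pyth: "\<And>a b. \<lbrakk> a \<in> F; b \<in> F \<rbrakk> \<Longrightarrow> \<exists>w\<in>F. w \<otimes> w = a \<otimes> a \<oplus> b \<otimes> b"
    and x: "x \<in> F" "\<And>e. x [^] (char_exp ^ e) \<notin> pyth_closure L E"
  shows False
proof -
  define K where "K = pyth_closure L E"
  have K: "subfield K L" "E \<subseteq> K" unfolding K_def using subfield_pyth_closure[OF E] pyth_closure_incl[OF E] by auto
  note KE = subringE[OF subfieldE(1)[OF K(1)]] and FE = subringE[OF subfieldE(1)[OF F(1)]]
  have tc: "t \<in> carrier L" "t \<in> K" using t K KE(1) by blast+
  have kK: "k \<subseteq> K" using k K by blast
  \<comment> \<open>The constants of \<open>K\<close>: a maximal subring over which \<open>t\<close>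
    stays transcendental is a field, relatively algebraically closed in \<open>K\<close> and hence
    infinite. The element \<open>c\<close> is taken from it, so \<phi> fixes
    \<open>c\<close>.\<close>
  obtain k' where k': "subring k' L" "k \<subseteq> k'" "k' \<subseteq> K" "\<not> alg_rel k' t"
    "\<And>B. \<lbrakk> subring B L; k' \<subset> B; B \<subseteq> K \<rbrakk> \<Longrightarrow> alg_rel B t"
    using exists_maximal_transcendental_subring[OF subfieldE(1)[OF k(1)] kK t(2)] by blast
  have k's: "subfield k' L" by (rule maximal_transcendental_subfield[OF k'(1,3) K(1) tc(1) k'(4,5)])
  have inf: "infinite k'"
  proof (rule infinite_of_pyth_closed[OF two exists_square_root E k's])
    show "k' \<subseteq> pyth_closure L E" using k'(3) by (simp add: K_def)
    show "y \<in> k'" if "y \<in> pyth_closure L E" "alg_rel k' y" for y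
      by (rule maximal_transcendental_closed[OF k's k'(3) K(1) tc(1) k'(4,5) that[folded K_def]])
  qed
  have k'E: "k' \<union> E \<subseteq> carrier L" "k' \<union> E \<subseteq> K" using k'(3) K KE(1) by blast+
  \<comment> \<open>With the constants \<open>k'\<close> in the base, all candidates for
    \<open>c\<close> lie in one field. It has the same pythagorean closure, so descent can be
    carried out over it.\<close>
  define E2 where "E2 = generate_field L (k' \<union> E)"
  have E2: "subfield E2 L" "k' \<union> E \<subseteq> E2" "E2 \<subseteq> K" unfolding E2_def
    using generate_field_is_subfield[OF k'E(1)] generate_fieldE(2)[OF k'E(1) refl]
      generate_field_min_subfield1[OF k'E(1) K(1) k'E(2)] by auto
  have K2: "pyth_closure L E2 = K" unfolding K_def
    using pyth_closure_between[OF E E2(1)] E2(2,3) unfolding K_def by blast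
  obtain e D0 \<tau> where \<tau>: "partial_hom D0 \<tau>" "K \<subseteq> D0" "x [^] (char_exp ^ e) \<in> D0"
    "\<And>y. y \<in> K \<Longrightarrow> \<tau> y = y" "\<tau> (x [^] (char_exp ^ e)) \<noteq> x [^] (char_exp ^ e)"
    using exists_conjugate[OF K(1), of x] x algF FE(1) unfolding K_def by blast
  define \<gamma> where "\<gamma> = x [^] (char_exp ^ e)"
  have \<gamma>F: "\<gamma> \<in> F" unfolding \<gamma>_def by (rule subring_pow[OF subfieldE(1)[OF F(1)] x(1)])
  have uY: "finite (u ` {..<n})" "u ` {..<n} \<subseteq> carrier L" using u(1) FE(1) by auto
  have ualg: "alg_rel D0 y" if y: "y \<in> u ` {..<n}" for y
    using algF[folded K_def] u(1) y alg_rel_mono[OF \<tau>(2)] by blast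
  have "\<exists>D \<phi>. partial_hom D \<phi> \<and> D0 \<subseteq> D \<and> u ` {..<n} \<subseteq> D \<and> (\<forall>x\<in>D0. \<phi> x = \<tau> x)"
    by (rule extend_partial_hom[OF uY \<tau>(1)]) (rule ualg)
  then obtain D \<phi> where D\<phi>: "partial_hom D \<phi> \<and> D0 \<subseteq> D \<and> u ` {..<n} \<subseteq> D \<and> (\<forall>x\<in>D0. \<phi> x = \<tau> x)"
    by (elim exE) (rule that)
  then have \<phi>: "partial_hom D \<phi>" "D0 \<subseteq> D" "u ` {..<n} \<subseteq> D" by simp_all
  have \<phi>4: "\<phi> x = \<tau> x" if "x \<in> D0" for x using D\<phi> that by simp
  note hp = partial_hom_props[OF \<phi>(1)]
  note DE = subringE[OF subfieldE(1)[OF hp(1)]]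
  have KD: "K \<subseteq> D" using \<tau>(2) \<phi>(2) by blast
  have FD: "F \<subseteq> D"
  proof
    fix y assume "y \<in> F"
    then obtain \<kappa> where \<kappa>: "\<And>i. \<kappa> i \<in> K" "y = lincomb \<kappa> u n" using u(2) unfolding K_def lspan_def by blast
    show "y \<in> D" unfolding \<kappa>(2)
      using \<kappa>(1) KD \<phi>(3) DE(2,6,7) by (intro lincomb_in_module) (simp_all add: subset_iff image_subset_iff)
  qed
  have \<phi>K: "\<phi> y = y" if "y \<in> K" for y using \<phi>4 \<tau>(2,4) that by auto
  have \<phi>\<gamma>: "\<phi> \<gamma> \<noteq> \<gamma>" using \<phi>4[OF \<tau>(3)] \<tau>(5) unfolding \<gamma>_def by simp
  obtain i where i: "i \<in> carrier L" "i \<otimes> i = \<ominus> \<one>" using exists_square_root[of "\<ominus> \<one>"] by auto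
  define ii where "ii = i \<oplus> i"
  have iinz: "ii \<noteq> \<zero>"
  proof
    assume "ii = \<zero>"
    then have "(\<one> \<oplus> \<one>) \<otimes> i = \<zero>" using i(1) by (simp add: ii_def l_distr)
    then have "i = \<zero>" using integral[of "\<one> \<oplus> \<one>" i] two i(1) by auto
    then have "\<ominus> \<one> = \<zero>" using i(2) by simp
    then have "\<one> = \<zero>" using minus_minus[OF one_closed] by simp
    then show False by simp
  qed
  have iic: "ii \<in> carrier L" using i(1) by (simp add: ii_def)
  note algs = algebraics_subfield[OF k's]
  note algsE = subringE[OF subfieldE(1)[OF algs]]
  \<comment> \<open>If \<gamma> is algebraic over the constants, adding \<open>t\<close> makes it
    transcendental without changing the difference to its conjugate, as \<phi> fixes
    \<open>t\<close>.\<close>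
  obtain \<alpha>0 where \<alpha>0: "\<alpha>0 \<in> F" "\<phi> \<alpha>0 \<noteq> \<alpha>0" "\<not> alg_rel k' \<alpha>0"
  proof (cases "alg_rel k' \<gamma>")
    case False
    then show ?thesis using that \<gamma>F \<phi>\<gamma> by blast
  next
    case True
    have c: "\<gamma> \<in> carrier L" "t \<in> F" using \<gamma>F FE(1) tc(2) F(2) unfolding K_def by blast+
    have "\<phi> (\<gamma> \<oplus> t) = \<phi> \<gamma> \<oplus> t" using hp(5)[of \<gamma> t] subsetD[OF FD \<gamma>F] subsetD[OF FD c(2)] \<phi>K[OF tc(2)] by simp
    moreover have "\<phi> \<gamma> \<oplus> t \<noteq> \<gamma> \<oplus> t" using \<phi>\<gamma> hp(2)[OF subsetD[OF FD \<gamma>F]] c(1) tc(1) by simp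
    moreover have "\<not> alg_rel k' (\<gamma> \<oplus> t)"
    proof
      assume a: "alg_rel k' (\<gamma> \<oplus> t)"
      have "\<gamma> \<in> {x \<in> carrier L. alg_rel k' x}" "\<gamma> \<oplus> t \<in> {x \<in> carrier L. alg_rel k' x}" using True a c(1) tc(1) by auto
      from subring_minus[OF subfieldE(1)[OF algs] this(2,1)]
      have "alg_rel k' ((\<gamma> \<oplus> t) \<ominus> \<gamma>)" by blast
      moreover have "(\<gamma> \<oplus> t) \<ominus> \<gamma> = t" using c(1) tc(1) by algebra
      ultimately show False using k'(4) by simp
    qed
    ultimately show ?thesis using that[of "\<gamma> \<oplus> t"] FE(7)[OF \<gamma>F c(2)] by simp
  qed
  have \<alpha>0c: "\<alpha>0 \<in> carrier L" "\<phi> \<alpha>0 \<in> carrier L" using \<alpha>0 FE(1) FD hp(2) by blast+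
  \<comment> \<open>With \<delta> = \<phi>(\<alpha>) - \<alpha> and p = \<alpha> - c + i, the
    factors of y \<phi>(y) are p, p - 2i, \<delta> + p and \<delta> - 2i + p; the last can be a unit
    where \<open>p\<close> vanishes only if \<delta> \<noteq> 2i. In the exceptional case \<alpha>
    is doubled, which changes \<delta> from 2i to 4i.\<close>
  obtain \<alpha> where \<alpha>: "\<alpha> \<in> F" "\<phi> \<alpha> \<noteq> \<alpha>" "\<not> alg_rel k' \<alpha>" "\<phi> \<alpha> \<ominus> \<alpha> \<noteq> ii"
  proof (cases "\<phi> \<alpha>0 \<ominus> \<alpha>0 = ii")
    case False
    then show ?thesis using that \<alpha>0 by blast
  next
    case True
    have "\<phi> (\<alpha>0 \<oplus> \<alpha>0) = \<phi> \<alpha>0 \<oplus> \<phi> \<alpha>0" using hp(5)[OF subsetD[OF FD \<alpha>0(1)] subsetD[OF FD \<alpha>0(1)]] .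
    moreover have "(\<phi> \<alpha>0 \<oplus> \<phi> \<alpha>0) \<ominus> (\<alpha>0 \<oplus> \<alpha>0) = (\<phi> \<alpha>0 \<ominus> \<alpha>0) \<oplus> (\<phi> \<alpha>0 \<ominus> \<alpha>0)" using \<alpha>0c by algebra
    ultimately have d: "\<phi> (\<alpha>0 \<oplus> \<alpha>0) \<ominus> (\<alpha>0 \<oplus> \<alpha>0) = ii \<oplus> ii" using True by simp
    have dd: "ii \<oplus> ii = (\<one> \<oplus> \<one>) \<otimes> ii" using iic by (simp add: l_distr)
    have "ii \<oplus> ii \<noteq> \<zero>" unfolding dd using integral'[of "\<one> \<oplus> \<one>" ii] two iinz iic by simp
    then have 1: "\<phi> (\<alpha>0 \<oplus> \<alpha>0) \<noteq> \<alpha>0 \<oplus> \<alpha>0" using d \<alpha>0c by (auto simp: minus_eq r_neg)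
    have 2: "ii \<oplus> ii \<noteq> ii" using iinz iic by (metis add.r_cancel_one)
    have "\<not> alg_rel k' (\<alpha>0 \<oplus> \<alpha>0)"
    proof
      assume "alg_rel k' (\<alpha>0 \<oplus> \<alpha>0)"
      then have "(\<one> \<oplus> \<one>) \<otimes> \<alpha>0 \<in> {x \<in> carrier L. alg_rel k' x}" using \<alpha>0c by (simp add: l_distr)
      moreover have "\<one> \<oplus> \<one> \<in> {x \<in> carrier L. alg_rel k' x} - {\<zero>}" using algsE(3,7) two by blast
      ultimately have "\<alpha>0 \<in> {x \<in> carrier L. alg_rel k' x}"
        using subfield_m_inv_simprule[OF algs _ \<alpha>0c(1)] by blast
      then show False using \<alpha>0 by blast
    qed
    then show ?thesis using that[of "\<alpha>0 \<oplus> \<alpha>0"] FE(7)[OF \<alpha>0(1,1)] 1 2 d by simp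
  qed
  have \<alpha>c: "\<alpha> \<in> carrier L" "\<phi> \<alpha> \<in> carrier L" using \<alpha>(1) FE(1) FD hp(2) by blast+
  \<comment> \<open>The constants of \<open>L\<close> are larger than those of \<open>K\<close>:
    \<open>L\<close> has to be algebraic over C(\<alpha>), whatever its transcendence degree over
    \<open>k'\<close>.\<close>
  obtain C where C: "subring C L" "k' \<subseteq> C" "C \<subseteq> carrier L" "\<not> alg_rel C \<alpha>"
    "\<And>B. \<lbrakk> subring B L; C \<subset> B; B \<subseteq> carrier L \<rbrakk> \<Longrightarrow> alg_rel B \<alpha>"
    using exists_maximal_transcendental_subring[OF k'(1) _ \<alpha>(3), of "carrier L"] subringE(1)[OF k'(1)] by blast
  have Cs: "subfield C L" by (rule maximal_transcendental_subfield[OF C(1,3) carrier_is_subfield \<alpha>c(1) C(4,5)])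
  interpret PL: constants L C \<alpha>
  proof (intro constants.intro constants_axioms.intro)
    show "algebraically_closed L" by (rule algebraically_closed_axioms)
    show "subfield C L" "\<alpha> \<in> carrier L" "\<not> alg_rel C \<alpha>" by (rule Cs, rule \<alpha>c, rule C)
    show "y \<in> C" if "y \<in> carrier L" "alg_rel C y" for y
      by (rule maximal_transcendental_closed[OF Cs C(3) carrier_is_subfield \<alpha>c(1) C(4,5) that])
    show "alg_rel (simple_extension C \<alpha>) y" if "y \<in> carrier L" for y
      by (rule maximal_transcendental_exchange[OF C(1,3) carrier_is_subfield \<alpha>c(1) C(4,5) that])
  qed
  have iC: "i \<in> C"
  proof (rule PL.C_closed[OF i(1)])
    let ?f = "\<lambda>j::nat. if j = 1 then \<zero> else \<one>"
    have "peval ?f 3 i = \<one> \<oplus> i \<otimes> i" using i by (simp add: numeral_3_eq_3)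
    then have "peval ?f 3 i = \<zero>" using i(2) by (simp add: r_neg)
    then show "alg_rel C i" using PL.CE(2,3) by (intro alg_relI[of ?f C 2 3]) auto
  qed
  \<comment> \<open>Everything that must have coordinates in a finite stage: \<one> and \<alpha>,
    from which \<open>y\<close> is formed, and the products of basis vectors, whose coordinates are
    the structure constants.\<close>
  define Z where "Z = {\<one>, \<alpha>} \<union> (\<lambda>(i, j). u i \<otimes> u j) ` ({..<n} \<times> {..<n})"
  have Z: "finite Z" "Z \<subseteq> lspan K u n"
    using \<alpha>(1) FE(3,6) u(1) unfolding Z_def K_def u(2)[symmetric] by auto
  have uc: "\<And>i. u i \<in> carrier L" using u(1) FE(1) by blast
  obtain T where T: "finite T" "T \<subseteq> K" "\<And>G. \<lbrakk> subring G L; T \<subseteq> G \<rbrakk> \<Longrightarrow> Z \<subseteq> lspan G u n"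
    using lspan_finite[OF uc subfieldE(1)[OF K(1)] Z] by blast
  obtain E' where E': "quadratic_tower L (sums_of_two_squares L) E2 E'" "T \<subseteq> E'"
    using pyth_closure_finite[OF E2(1) T(1)] T(2) K2 by blast
  have E's: "subfield E' L" "E2 \<subseteq> E'" using quadratic_tower_subfield[OF E'(1) E2(1)] by auto
  have E'K: "E' \<subseteq> K" using E'(1) K2 by (auto simp: pyth_closure_def)
  have KE': "pyth_closure L E' = K" using pyth_closure_between[OF E2(1) E's] E'K K2 by blast
  note E'r = subfieldE(1)[OF E's(1)]
  have ZE': "Z \<subseteq> lspan E' u n" by (rule T(3)[OF E'r E'(2)])
  have uu: "u i \<otimes> u j \<in> lspan E' u n" if "i < n" "j < n" for i j
    using ZE' that unfolding Z_def by auto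
  note spc = lspan_closed[OF uc E'r, where n=n]
  have mult: "p \<otimes> q \<in> lspan E' u n" if "p \<in> lspan E' u n" "q \<in> lspan E' u n" for p q
    by (rule lspan_mult[OF uc E'r _ that]) (rule uu)
  obtain S' where S': "finite S'" "S' \<subseteq> carrier L" "E' \<subseteq> generate_field L (E2 \<union> S')"
    using quadratic_tower_finitely_generated[OF E'(1) E2(1)] by blast
  \<comment> \<open>Together with \<open>C\<close> these generate a field containing
    \<open>E'\<close>, the basis and its conjugates, hence also \<open>m\<close> and \<phi>(m) for
    every \<open>m\<close> in the \<open>E'\<close>-span. Nothing here depends on
    \<open>c\<close>.\<close>
  define W where "W = S \<union> S' \<union> u ` {..<n} \<union> \<phi> ` (u ` {..<n})"
  have W: "finite W" "W \<subseteq> carrier L" unfolding W_def using S S' uc \<phi>(3) hp(2) by auto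
  have CW: "C \<union> W \<subseteq> carrier L" using C(3) W by blast
  define N where "N = generate_field L (C \<union> W)"
  have N: "subfield N L" "C \<union> W \<subseteq> N" unfolding N_def
    using generate_field_is_subfield[OF CW] generate_fieldE(2)[OF CW refl] by auto
  note NE = subringE[OF subfieldE(1)[OF N(1)]]
  have gen: "generate_field L H \<subseteq> N" if "H \<subseteq> N" for H
    using generate_field_min_subfield1[OF subset_trans[OF that NE(1)] N(1) that] .
  have E'N: "E' \<subseteq> N"
  proof -
    have "k \<union> S \<subseteq> N" using k'(2) C(2) N(2) unfolding W_def by blast
    then have "generate_field L (k \<union> S) \<subseteq> N" by (rule gen)
    then have "k' \<union> E \<subseteq> N" using S(3) C(2) N(2) by blast
    then have "E2 \<subseteq> N" unfolding E2_def by (rule gen)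
    then have "E2 \<union> S' \<subseteq> N" using N(2) unfolding W_def by blast
    then have "generate_field L (E2 \<union> S') \<subseteq> N" by (rule gen)
    then show ?thesis using S'(3) by blast
  qed
  have spN: "m \<in> N \<and> \<phi> m \<in> N" if "m \<in> lspan E' u n" for m
  proof -
    obtain \<kappa> where \<kappa>: "\<And>i. \<kappa> i \<in> E'" "m = lincomb \<kappa> u n" using \<open>m \<in> lspan E' u n\<close> unfolding lspan_def by blast
    have 1: "m \<in> N" unfolding \<kappa>(2) using \<kappa>(1) E'N N(2) NE(2,6,7) unfolding W_def
      by (intro lincomb_in_module) (simp_all add: subset_iff)
    have "\<phi> m = lincomb (\<lambda>i. \<phi> (\<kappa> i)) (\<lambda>i. \<phi> (u i)) n"
      unfolding \<kappa>(2) using \<kappa>(1) E'K KD u(1) FD by (intro partial_hom_lincomb[OF \<phi>(1)]) auto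
    also have "\<dots> \<in> N" using \<kappa>(1) E'K E'N \<phi>K N(2) NE(2,6,7) unfolding W_def
      by (intro lincomb_in_module) (simp_all add: subset_iff)
    finally show ?thesis using 1 by blast
  qed
  define \<delta> where "\<delta> = \<phi> \<alpha> \<ominus> \<alpha>"
  have \<delta>c: "\<delta> \<in> carrier L" "\<delta> \<noteq> \<zero>" "\<delta> \<ominus> ii \<in> carrier L" "\<delta> \<ominus> ii \<noteq> \<zero>"
    unfolding \<delta>_def using \<alpha>c \<alpha>(2,4) iic by simp_all
  \<comment> \<open>Modulo the place, the factors other than \<open>p\<close> reduce to -2i,
    \<delta> and \<delta> - 2i. The first is a nonzero constant; the other two are made units by
    this choice.\<close>
  obtain B where B: "finite B" "\<forall>d\<in>C - B. \<exists>V. PL.place d V \<and> (\<forall>y\<in>{\<delta>, \<delta> \<ominus> ii}. y \<noteq> \<zero> \<longrightarrow> vunit V y)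
    \<and> (\<forall>z\<in>N. \<forall>u. vunit V u \<longrightarrow> z \<otimes> z \<noteq> (\<alpha> \<ominus> d) \<otimes> u)"
    using PL.eventually_not_square[OF two W, of "{\<delta>, \<delta> \<ominus> ii}"] \<delta>c unfolding N_def by auto
  have "\<exists>c\<in>k'. c \<ominus> i \<notin> B"
  proof (rule ccontr)
    assume "\<not> ?thesis"
    then have "(\<lambda>c. c \<ominus> i) ` k' \<subseteq> B" by blast
    moreover have "inj_on (\<lambda>c. c \<ominus> i) k'"
    proof (rule inj_onI)
      fix a b assume ab: "a \<in> k'" "b \<in> k'" "a \<ominus> i = b \<ominus> i"
      have "a \<in> carrier L" "b \<in> carrier L" using ab subringE(1)[OF k'(1)] by blast+
      then show "a = b" using ab(3) i(1) by (simp add: minus_eq)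
    qed
    ultimately show False using inf B(1) by (meson finite_imageD finite_subset)
  qed
  then obtain c where c: "c \<in> k'" "c \<ominus> i \<notin> B" by blast
  have cc: "c \<in> carrier L" "c \<in> C" "c \<in> E'" "c \<in> K" using c(1) C(2,3) E2(2) E's(2) k'(3) by blast+
  define d where "d = c \<ominus> i"
  have dC: "d \<in> C" unfolding d_def by (rule subring_minus[OF C(1) cc(2) iC])
  have dB: "d \<in> C - B" using dC c(2) unfolding d_def by blast
  obtain V where V1: "PL.place d V" and V2: "\<forall>y\<in>{\<delta>, \<delta> \<ominus> ii}. y \<noteq> \<zero> \<longrightarrow> vunit V y"
    and V3: "\<forall>z\<in>N. \<forall>u. vunit V u \<longrightarrow> z \<otimes> z \<noteq> (\<alpha> \<ominus> d) \<otimes> u"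
    using bspec[OF B(2) dB] by (elim exE conjE)
  have V: "PL.place d V" "vunit V \<delta>" "vunit V (\<delta> \<ominus> ii)"
    "\<And>z u. \<lbrakk> z \<in> N; vunit V u \<rbrakk> \<Longrightarrow> z \<otimes> z \<noteq> (\<alpha> \<ominus> d) \<otimes> u"
    using V1 V2 V3 \<delta>c(2,4) by simp_all
  note pl = PL.V[OF dC V(1)] and VE = PL.VE[OF dC V(1)]
  have fac: "\<one> \<otimes> \<one> \<oplus> a \<otimes> a = (a \<oplus> i) \<otimes> (a \<ominus> i)" if a: "a \<in> carrier L" for a
  proof -
    have "(a \<oplus> i) \<otimes> (a \<ominus> i) = a \<otimes> a \<ominus> i \<otimes> i" using a i(1) by algebra
    also have "\<dots> = a \<otimes> a \<oplus> \<one>" unfolding i(2) using a by (simp add: minus_eq)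
    finally show ?thesis using a by (simp add: a_comm)
  qed
  define p where "p = \<alpha> \<ominus> d"
  have pc: "p \<in> carrier L" "p \<noteq> \<zero>" "small V p" unfolding p_def using PL.\<alpha>_minus_nonzero[OF dC] pl(5) by auto
  define y where "y = \<one> \<otimes> \<one> \<oplus> (\<alpha> \<ominus> c) \<otimes> (\<alpha> \<ominus> c)"
  have y: "y = p \<otimes> (p \<ominus> ii)"
  proof -
    have "(\<alpha> \<ominus> c) \<oplus> i = p" "(\<alpha> \<ominus> c) \<ominus> i = p \<ominus> ii"
      unfolding p_def d_def ii_def using \<alpha>c(1) cc(1) i(1) by algebra+
    then show ?thesis unfolding y_def using fac[of "\<alpha> \<ominus> c"] \<alpha>c(1) cc(1) by simp
  qed
  have one_sp: "\<one> \<in> lspan E' u n" "\<alpha> \<in> lspan E' u n" using ZE' unfolding Z_def by auto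
  have "\<ominus> c \<in> E'" using subringE(5)[OF E'r cc(3)] .
  then have "\<alpha> \<oplus> (\<ominus> c) \<otimes> \<one> \<in> lspan E' u n" by (intro spc(3) spc(4) one_sp)
  then have ac_sp: "\<alpha> \<ominus> c \<in> lspan E' u n" using cc(1) by (simp add: minus_eq)
  have ysp: "y \<in> lspan E' u n" unfolding y_def by (rule spc(3)[OF mult[OF one_sp(1,1)] mult[OF ac_sp ac_sp]])
  have "\<alpha> \<ominus> (c \<oplus> i) = p \<ominus> ii" unfolding p_def d_def ii_def using \<alpha>c(1) cc(1) i(1) by algebra
  then have pii: "p \<ominus> ii \<noteq> \<zero>" using PL.\<alpha>_minus_nonzero(2)[of "c \<oplus> i"] PL.CE(7)[OF cc(2) iC] by simp
  have ynz: "y \<noteq> \<zero>" unfolding y using integral'[OF pc(1,2) _ pii] pc(1) iic by simp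
  have acF: "\<alpha> \<ominus> c \<in> F" using subring_minus[OF subfieldE(1)[OF F(1)] \<alpha>(1)] cc(4) F(2) unfolding K_def by blast
  obtain w where w: "w \<in> F" "w \<otimes> w = y" using pyth[OF FE(3) acF] unfolding y_def by blast
  have "\<exists>e m. e \<in> E' \<and> m \<in> lspan E' u n \<and> y = e \<otimes> (m \<otimes> m)"
  proof (rule square_descends[OF uc two exists_square_root E's(1) _ uu ysp ynz])
    show "w \<in> lspan (pyth_closure L E') u n" using w(1) u(2) KE' unfolding K_def by simp
    show "\<kappa> i = \<zero>" if "\<And>i. \<kappa> i \<in> pyth_closure L E'" "lincomb \<kappa> u n = \<zero>" "i < n" for \<kappa> i
      using indep[of \<kappa> i] that unfolding KE' K_def by blast
  qed (use w in auto)
  then obtain e' m where em: "e' \<in> E'" "m \<in> lspan E' u n" "y = e' \<otimes> (m \<otimes> m)" by blast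
  have mF: "m \<in> F" "e' \<in> K" using em(1,2) lspan_mono[OF E'K, of u n] u(2) E'K unfolding K_def by auto
  have c2: "m \<in> carrier L" "\<phi> m \<in> carrier L" "e' \<in> carrier L" using mF FE(1) FD hp(2) KE(1) by blast+
  have "\<phi> y = e' \<otimes> (\<phi> m \<otimes> \<phi> m)"
    unfolding em(3) using hp(6) mF FD KD \<phi>K[OF mF(2)] DE(6) by (auto simp: subset_iff)
  moreover have "\<phi> y = (\<delta> \<oplus> p) \<otimes> ((\<delta> \<ominus> ii) \<oplus> p)"
  proof -
    have nc: "\<ominus> c \<in> K" using KE(5)[OF cc(4)] .
    have \<phi>a: "\<phi> (\<alpha> \<ominus> c) = \<phi> \<alpha> \<ominus> c"
      using hp(5)[of \<alpha> "\<ominus> c"] \<alpha>(1) FD nc KD \<phi>K[OF nc] by (auto simp: minus_eq)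
    have aD: "\<alpha> \<ominus> c \<in> D" using acF FD by blast
    have "\<phi> y = \<one> \<otimes> \<one> \<oplus> (\<phi> \<alpha> \<ominus> c) \<otimes> (\<phi> \<alpha> \<ominus> c)"
      unfolding y_def using hp(5)[of "\<one> \<otimes> \<one>" "(\<alpha> \<ominus> c) \<otimes> (\<alpha> \<ominus> c)"] hp(6)[OF aD aD] hp(3) \<phi>a DE(3) DE(6)[OF aD aD] by simp
    also have "\<dots> = ((\<phi> \<alpha> \<ominus> c) \<oplus> i) \<otimes> ((\<phi> \<alpha> \<ominus> c) \<ominus> i)" using fac[of "\<phi> \<alpha> \<ominus> c"] \<alpha>c(2) cc(1) by simp
    also have "(\<phi> \<alpha> \<ominus> c) \<oplus> i = \<delta> \<oplus> p" unfolding \<delta>_def p_def d_def using \<alpha>c cc(1) i(1) by algebra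
    also have "(\<phi> \<alpha> \<ominus> c) \<ominus> i = (\<delta> \<ominus> ii) \<oplus> p" unfolding \<delta>_def p_def d_def ii_def using \<alpha>c cc(1) i(1) by algebra
    finally show ?thesis .
  qed
  ultimately have \<phi>y: "e' \<otimes> (\<phi> m \<otimes> \<phi> m) = (\<delta> \<oplus> p) \<otimes> ((\<delta> \<ominus> ii) \<oplus> p)" by simp
  \<comment> \<open>\<open>y\<close> and \<phi>(y) carry the same factor \<open>e'\<close>, because
    \<phi> fixes \<open>E'\<close>; so their product is the square of \<open>z\<close>.\<close>
  define z where "z = e' \<otimes> (m \<otimes> \<phi> m)"
  define U where "U = (p \<ominus> ii) \<otimes> ((\<delta> \<oplus> p) \<otimes> ((\<delta> \<ominus> ii) \<oplus> p))"
  have zN: "z \<in> N" unfolding z_def using spN[OF em(2)] em(1) E'N NE(6) by blast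
  have "z \<otimes> z = (e' \<otimes> (m \<otimes> m)) \<otimes> (e' \<otimes> (\<phi> m \<otimes> \<phi> m))" unfolding z_def using c2 by (simp add: m_ac)
  also have "\<dots> = (p \<otimes> (p \<ominus> ii)) \<otimes> ((\<delta> \<oplus> p) \<otimes> ((\<delta> \<ominus> ii) \<oplus> p))" unfolding em(3)[symmetric] \<phi>y y ..
  also have "\<dots> = p \<otimes> U" unfolding U_def using pc(1) iic \<delta>c by (intro m_assoc) auto
  finally have zz: "z \<otimes> z = (\<alpha> \<ominus> d) \<otimes> U" by (simp add: p_def)
  have iiC: "\<ominus> ii \<in> C" unfolding ii_def using iC PL.CE(5,7) by blast
  have "\<ominus> ii \<noteq> \<zero>"
  proof
    assume "\<ominus> ii = \<zero>"
    then have "ii = \<zero>" using minus_minus[OF iic] by simp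
    then show False using iinz by blast
  qed
  then have "vunit V (\<ominus> ii \<oplus> p)" using vunit_add_small[OF pl(1) PL.vunit_constant[OF dC V(1) iiC] pc(3)] by simp
  then have "vunit V (p \<ominus> ii)" using pc(1) iic by (simp add: minus_eq a_comm)
  then have "vunit V U" unfolding U_def
    by (intro vunit_mult[OF pl(2)] vunit_add_small[OF pl(1) _ pc(3)] V)
  then show False using V(4)[OF zN] zz by blast
qed

end

section \<open>Transport along embeddings\<close>

context field
begin

lemma lincomb_Suc_shift:
  assumes "\<And>i. f i \<in> carrier R" "\<And>i. u i \<in> carrier R"
  shows "lincomb f u (Suc n) = f 0 \<otimes> u 0 \<oplus> lincomb (\<lambda>i. f (Suc i)) (\<lambda>i. u (Suc i)) n"
  using assms by (induct n) (auto simp: a_ac)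

lemma nth_default_in: "\<lbrakk> set xs \<subseteq> A; \<zero> \<in> A \<rbrakk> \<Longrightarrow> nth_default \<zero> xs i \<in> A"
  by (auto simp: nth_default_def)

lemma combine_eq_lincomb:
  assumes "length ks = length us" "set ks \<subseteq> carrier R" "set us \<subseteq> carrier R"
  shows "combine ks us = lincomb (nth_default \<zero> ks) (nth_default \<zero> us) (length us)"
  using assms
proof (induct ks us rule: list_induct2)
  case (Cons k ks v us)
  have c: "\<And>i. nth_default \<zero> (k # ks) i \<in> carrier R" "\<And>i. nth_default \<zero> (v # us) i \<in> carrier R"
    using Cons(3,4) by (intro nth_default_in; simp)+
  have "lincomb (nth_default \<zero> (k # ks)) (nth_default \<zero> (v # us)) (length (v # us))
    = k \<otimes> v \<oplus> lincomb (nth_default \<zero> ks) (nth_default \<zero> us) (length us)"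
    using lincomb_Suc_shift[of "nth_default \<zero> (k # ks)" "nth_default \<zero> (v # us)" "length us", OF c]
    by (simp only: nth_default_Cons_0 nth_default_Cons_Suc list.size(4) add.commute[of _ 1] plus_1_eq_Suc One_nat_def add_Suc_right Nat.add_0_right)
  then show ?case using Cons by simp
qed simp

lemma exists_lspan_basis:
  assumes K: "subfield K R" and dim: "dimension n K F"
  obtains u where "\<And>i. u i \<in> F" "F = lspan K u n"
    "\<forall>\<kappa>. (\<forall>i. \<kappa> i \<in> K) \<and> lincomb \<kappa> u n = \<zero> \<longrightarrow> (\<forall>i<n. \<kappa> i = \<zero>)"
proof -
  obtain vs where vs: "set vs \<subseteq> carrier R" "independent K vs" "length vs = n" "Span K vs = F"
    using exists_base[OF K dim] by blast
  note KE = subringE[OF subfieldE(1)[OF K]]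
  let ?u = "nth_default \<zero> vs"
  have uF: "?u i \<in> F" for i
    using Span_base_incl[OF K vs(1)] Span_subgroup_props(2)[OF K vs(1)] vs(4) by (intro nth_default_in) auto
  have lc: "lincomb \<kappa> ?u n = combine (map \<kappa> [0..<n]) vs" if "\<And>i. \<kappa> i \<in> K" for \<kappa>
  proof -
    have "set (map \<kappa> [0..<n]) \<subseteq> carrier R" using that KE(1) by auto
    then have "combine (map \<kappa> [0..<n]) vs = lincomb (nth_default \<zero> (map \<kappa> [0..<n])) ?u n"
      using combine_eq_lincomb[of "map \<kappa> [0..<n]" vs] vs(1,3) by simp
    also have "\<dots> = lincomb \<kappa> ?u n" by (rule lincomb_cong) (auto simp: nth_default_def)
    finally show ?thesis ..
  qed
  have "F = lspan K ?u n"
  proof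
    show "F \<subseteq> lspan K ?u n"
    proof
      fix y assume "y \<in> F"
      then obtain ks where ks: "set ks \<subseteq> K" "length ks = length vs" "y = combine ks vs"
        using Span_mem_iff_length_version[OF K vs(1), of y] vs(4) by blast
      then have "y = lincomb (nth_default \<zero> ks) ?u n" using combine_eq_lincomb[of ks vs] KE(1) vs(1,3) by auto
      then show "y \<in> lspan K ?u n" using lspanI[of "nth_default \<zero> ks" K ?u n] nth_default_in[OF ks(1) KE(2)] by simp
    qed
    show "lspan K ?u n \<subseteq> F"
    proof
      fix y assume "y \<in> lspan K ?u n"
      then obtain \<kappa> where \<kappa>: "\<And>i. \<kappa> i \<in> K" "y = lincomb \<kappa> ?u n" unfolding lspan_def by blast
      have "set (map \<kappa> [0..<n]) \<subseteq> K" "length (map \<kappa> [0..<n]) = length vs" "y = combine (map \<kappa> [0..<n]) vs"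
        using \<kappa> lc vs(3) by auto
      then show "y \<in> F" using Span_mem_iff_length_version[OF K vs(1), of y] vs(4) by blast
    qed
  qed
  moreover have "\<kappa> i = \<zero>" if k: "\<And>i. \<kappa> i \<in> K" "lincomb \<kappa> ?u n = \<zero>" "i < n" for \<kappa> i
  proof -
    have "set (map \<kappa> [0..<n]) \<subseteq> K" using k(1) by auto
    moreover have "combine (map \<kappa> [0..<n]) vs = \<zero>" using lc[OF k(1)] k(2) by simp
    ultimately have "set (take (length vs) (map \<kappa> [0..<n])) \<subseteq> {\<zero>}"
      using independent_imp_trivial_combine[OF K vs(2)] by blast
    then have "\<kappa> ` {0..<n} \<subseteq> {\<zero>}" using vs(3) by simp
    then show ?thesis using k(3) by (simp add: image_subset_iff)
  qed
  ultimately show ?thesis using that[of ?u] uF by blast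
qed

end

text \<open>Unlike \<open>partial_hom\<close>, the map goes between fields of different types: the
  closure \<open>K\<close> lives in \<open>L\<close>, while the given extension has an algebraic
  closure of its own.\<close>

locale field_embedding = L: field L + M: field M for L (structure) and M (structure) +
  fixes K :: "'a set" and g :: "'a \<Rightarrow> 'c"
  assumes K: "subfield K L" and g_closed: "x \<in> K \<Longrightarrow> g x \<in> carrier M"
    and g_one: "g \<one>\<^bsub>L\<^esub> = \<one>\<^bsub>M\<^esub>"
    and g_add: "\<lbrakk> x \<in> K; y \<in> K \<rbrakk> \<Longrightarrow> g (x \<oplus>\<^bsub>L\<^esub> y) = g x \<oplus>\<^bsub>M\<^esub> g y"
    and g_mult: "\<lbrakk> x \<in> K; y \<in> K \<rbrakk> \<Longrightarrow> g (x \<otimes>\<^bsub>L\<^esub> y) = g x \<otimes>\<^bsub>M\<^esub> g y"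
begin

lemmas KE = subringE[OF subfieldE(1)[OF K]]

lemma g_zero: "g \<zero>\<^bsub>L\<^esub> = \<zero>\<^bsub>M\<^esub>"
proof -
  have "g \<zero>\<^bsub>L\<^esub> \<oplus>\<^bsub>M\<^esub> g \<zero>\<^bsub>L\<^esub> = g \<zero>\<^bsub>L\<^esub>" using g_add[OF KE(2,2)] by simp
  then show ?thesis using g_closed[OF KE(2)] M.add.r_cancel_one by metis
qed

lemma g_minus: "x \<in> K \<Longrightarrow> g (\<ominus>\<^bsub>L\<^esub> x) = \<ominus>\<^bsub>M\<^esub> g x"
proof -
  assume x: "x \<in> K"
  have xc: "x \<in> carrier L" using x KE(1) by blast
  have "g (\<ominus>\<^bsub>L\<^esub> x) \<oplus>\<^bsub>M\<^esub> g x = \<zero>\<^bsub>M\<^esub>" using g_add[OF KE(5)[OF x] x] g_zero xc by (simp add: L.l_neg)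
  then show ?thesis using M.minus_equality[OF _ g_closed[OF x] g_closed[OF KE(5)[OF x]]] by simp
qed

lemma g_inv:
  assumes x: "x \<in> K" "x \<noteq> \<zero>\<^bsub>L\<^esub>" shows "g x \<noteq> \<zero>\<^bsub>M\<^esub>" "g (inv\<^bsub>L\<^esub> x) = inv\<^bsub>M\<^esub> (g x)"
proof -
  have i: "inv\<^bsub>L\<^esub> x \<in> K" "x \<otimes>\<^bsub>L\<^esub> inv\<^bsub>L\<^esub> x = \<one>\<^bsub>L\<^esub>" using L.subfield_m_inv[OF K, of x] x by auto
  have e: "g x \<otimes>\<^bsub>M\<^esub> g (inv\<^bsub>L\<^esub> x) = \<one>\<^bsub>M\<^esub>" using g_mult[OF x(1) i(1)] i(2) g_one by simp
  then show "g (inv\<^bsub>L\<^esub> x) = inv\<^bsub>M\<^esub> (g x)"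
    using M.inv_unique_nonzero[OF g_closed[OF x(1)] g_closed[OF i(1)]] by simp
  show "g x \<noteq> \<zero>\<^bsub>M\<^esub>"
  proof
    assume "g x = \<zero>\<^bsub>M\<^esub>"
    then show False using e g_closed[OF i(1)] by simp
  qed
qed

text \<open>Through preimages, inclusions between images follow from the leastness of generated
  fields and of closures.\<close>

lemma preimage_subfield:
  assumes P: "subfield P M" shows "subfield {x \<in> K. g x \<in> P} L"
proof (rule L.subfieldI'[OF L.subringI])
  note PE = subringE[OF subfieldE(1)[OF P]]
  show "{x \<in> K. g x \<in> P} \<subseteq> carrier L" using KE(1) by blast
  show "\<one>\<^bsub>L\<^esub> \<in> {x \<in> K. g x \<in> P}" using KE(3) PE(3) g_one by simp
  show "\<ominus>\<^bsub>L\<^esub> x \<in> {x \<in> K. g x \<in> P}" if "x \<in> {x \<in> K. g x \<in> P}" for x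
    using that KE(5) PE(5) g_minus by simp
  show "x \<otimes>\<^bsub>L\<^esub> y \<in> {x \<in> K. g x \<in> P}" "x \<oplus>\<^bsub>L\<^esub> y \<in> {x \<in> K. g x \<in> P}"
    if "x \<in> {x \<in> K. g x \<in> P}" "y \<in> {x \<in> K. g x \<in> P}" for x y
    using that KE(6,7) PE(6,7) g_add g_mult by simp_all
  show "inv\<^bsub>L\<^esub> x \<in> {x \<in> K. g x \<in> P}" if "x \<in> {x \<in> K. g x \<in> P} - {\<zero>\<^bsub>L\<^esub>}" for x
  proof -
    have x: "x \<in> K" "x \<noteq> \<zero>\<^bsub>L\<^esub>" "g x \<in> P" using that by auto
    show ?thesis using L.subfield_m_inv(1)[OF K, of x] M.subfield_m_inv(1)[OF P, of "g x"] g_inv[OF x(1,2)] x by simp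
  qed
qed

lemma image_subfield:
  assumes A: "subfield A L" "A \<subseteq> K" shows "subfield (g ` A) M"
proof (rule M.subfieldI'[OF M.subringI])
  note AE = subringE[OF subfieldE(1)[OF A(1)]]
  show "g ` A \<subseteq> carrier M" using A(2) g_closed by blast
  show "\<one>\<^bsub>M\<^esub> \<in> g ` A" using AE(3) g_one by (metis image_eqI)
  show "\<ominus>\<^bsub>M\<^esub> x \<in> g ` A" if "x \<in> g ` A" for x
  proof -
    obtain a where a: "a \<in> A" "x = g a" using \<open>x \<in> g ` A\<close> by blast
    then have "\<ominus>\<^bsub>M\<^esub> x = g (\<ominus>\<^bsub>L\<^esub> a)" using g_minus[of a] A(2) by auto
    then show ?thesis using AE(5)[OF a(1)] by blast
  qed
  show "x \<otimes>\<^bsub>M\<^esub> y \<in> g ` A" "x \<oplus>\<^bsub>M\<^esub> y \<in> g ` A" if xy: "x \<in> g ` A" "y \<in> g ` A" for x y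
  proof -
    obtain a b where ab: "a \<in> A" "b \<in> A" "x = g a" "y = g b" using xy by blast
    then show "x \<otimes>\<^bsub>M\<^esub> y \<in> g ` A" "x \<oplus>\<^bsub>M\<^esub> y \<in> g ` A"
      using g_mult[of a b] g_add[of a b] A(2) AE(6)[OF ab(1,2)] AE(7)[OF ab(1,2)] by (metis image_eqI subsetD)+
  qed
  show "inv\<^bsub>M\<^esub> x \<in> g ` A" if x: "x \<in> g ` A - {\<zero>\<^bsub>M\<^esub>}" for x
  proof -
    obtain a where a: "a \<in> A" "x = g a" "a \<noteq> \<zero>\<^bsub>L\<^esub>" using x g_zero by auto
    then show ?thesis using g_inv(2)[of a] A(2) L.subfield_m_inv(1)[OF A(1), of a] by (metis Diff_iff image_eqI singletonD subsetD)
  qed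
qed

lemma image_generate_field:
  assumes H: "H \<subseteq> K" "A \<subseteq> K" "A \<subseteq> generate_field L H" shows "g ` A \<subseteq> generate_field M (g ` H)"
proof -
  have gH: "g ` H \<subseteq> carrier M" using H(1) g_closed by blast
  have "generate_field L H \<subseteq> {x \<in> K. g x \<in> generate_field M (g ` H)}"
    using preimage_subfield[OF M.generate_field_is_subfield[OF gH]] H(1) KE(1) M.generate_fieldE(2)[OF gH refl]
    by (intro L.generate_field_min_subfield1) auto
  then show ?thesis using H(3) by blast
qed

lemma hom_pow: "x \<in> K \<Longrightarrow> g (x [^]\<^bsub>L\<^esub> (i::nat)) = g x [^]\<^bsub>M\<^esub> i"
  using g_one g_mult L.subring_pow[OF subfieldE(1)[OF K]] by (induct i) auto

lemma hom_peval:
  assumes "\<And>i. f i \<in> K" "x \<in> K"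
  shows "g (L.peval f n x) = M.peval (\<lambda>i. g (f i)) n (g x)"
proof (induct n)
  case 0
  then show ?case by (simp add: g_zero)
next
  case (Suc n)
  have "L.peval f n x \<in> K" "x [^]\<^bsub>L\<^esub> n \<in> K"
    using L.peval_in_subring[OF subfieldE(1)[OF K] assms] L.subring_pow[OF subfieldE(1)[OF K] assms(2)] by auto
  then show ?case using Suc assms KE(6) by (simp add: g_add g_mult hom_pow)
qed

lemma alg_rel_image:
  assumes A: "A \<subseteq> K" and t: "t \<in> K" and rel: "M.alg_rel (g ` A) (g t)" shows "L.alg_rel A t"
proof -
  obtain f n i where f: "\<And>i. f i \<in> g ` A" "i < n" "f i \<noteq> \<zero>\<^bsub>M\<^esub>" "M.peval f n (g t) = \<zero>\<^bsub>M\<^esub>"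
    using rel unfolding M.alg_rel_def by blast
  have "\<forall>i. \<exists>a. a \<in> A \<and> f i = g a" using f(1) by blast
  then obtain a where a: "\<And>i. a i \<in> A" "\<And>i. f i = g (a i)" by metis
  have aK: "\<And>i. a i \<in> K" using a(1) A by blast
  have pK: "L.peval a n t \<in> K" by (rule L.peval_in_subring[OF subfieldE(1)[OF K] aK t])
  have "f = (\<lambda>i. g (a i))" using a(2) by blast
  then have "g (L.peval a n t) = \<zero>\<^bsub>M\<^esub>" using hom_peval[of a t n, OF aK t] f(4) by simp
  then have "L.peval a n t = \<zero>\<^bsub>L\<^esub>" using g_inv(1)[OF pK] by blast
  moreover have "a i \<noteq> \<zero>\<^bsub>L\<^esub>" using f(3) a(2)[of i] g_zero by auto
  ultimately show ?thesis using L.alg_relI[of a A i n t, OF a(1) f(2)] by blast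
qed

text \<open>The closure is formed inside an ambient field, and here the ambient field changes. One
  inclusion pulls the closure in \<open>M\<close> back to \<open>K\<close>; for the other, a root in
  \<open>M\<close> is, up to sign, the image of a root taken in \<open>L\<close>.\<close>

lemma image_pyth_closure:
  assumes E: "subfield E L" and KE': "K = pyth_closure L E"
    and sqrt: "\<And>x. x \<in> carrier L \<Longrightarrow> \<exists>c\<in>carrier L. c \<otimes>\<^bsub>L\<^esub> c = x"
  shows "g ` K = pyth_closure M (g ` E)"
proof
  have EK: "E \<subseteq> K" unfolding KE' by (rule L.pyth_closure_incl[OF E])
  have gE: "subfield (g ` E) M" by (rule image_subfield[OF E EK])
  let ?P = "pyth_closure M (g ` E)"
  note P = M.subfield_pyth_closure[OF gE]
  have "K \<subseteq> {x \<in> K. g x \<in> ?P}"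
    unfolding KE'
  proof (rule L.pyth_closure_least)
    show "subfield {x \<in> pyth_closure L E. g x \<in> ?P} L" using preimage_subfield[OF P] KE' by simp
    show "E \<subseteq> {x \<in> pyth_closure L E. g x \<in> ?P}" using EK KE' M.pyth_closure_incl[OF gE] by blast
    fix c a b assume c: "c \<in> carrier L" "a \<in> {x \<in> pyth_closure L E. g x \<in> ?P}"
      "b \<in> {x \<in> pyth_closure L E. g x \<in> ?P}" "c \<otimes>\<^bsub>L\<^esub> c = a \<otimes>\<^bsub>L\<^esub> a \<oplus>\<^bsub>L\<^esub> b \<otimes>\<^bsub>L\<^esub> b"
    have ab: "a \<in> K" "b \<in> K" "g a \<in> ?P" "g b \<in> ?P" using c KE' by auto
    have cK: "c \<in> K" unfolding KE' using L.pyth_closure_closed[OF E c(1) _ _ c(4)] c(2,3) by blast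
    have "g c \<otimes>\<^bsub>M\<^esub> g c = g a \<otimes>\<^bsub>M\<^esub> g a \<oplus>\<^bsub>M\<^esub> g b \<otimes>\<^bsub>M\<^esub> g b"
      using c(4) cK ab(1,2) KE(6) by (metis g_mult g_add)
    then have "g c \<in> ?P" using M.pyth_closure_closed[OF gE g_closed[OF cK] ab(3,4)] by blast
    then show "c \<in> {x \<in> pyth_closure L E. g x \<in> ?P}" using cK KE' by blast
  qed
  then show "g ` K \<subseteq> ?P" by blast
  show "?P \<subseteq> g ` K"
  proof (rule M.pyth_closure_least[OF image_subfield[OF K subset_refl]])
    show "g ` E \<subseteq> g ` K" using EK by blast
    fix c a b assume c: "c \<in> carrier M" "a \<in> g ` K" "b \<in> g ` K" "c \<otimes>\<^bsub>M\<^esub> c = a \<otimes>\<^bsub>M\<^esub> a \<oplus>\<^bsub>M\<^esub> b \<otimes>\<^bsub>M\<^esub> b"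
    obtain a' b' where ab: "a' \<in> K" "b' \<in> K" "a = g a'" "b = g b'" using c by blast
    have s: "a' \<otimes>\<^bsub>L\<^esub> a' \<oplus>\<^bsub>L\<^esub> b' \<otimes>\<^bsub>L\<^esub> b' \<in> carrier L" using ab KE(1,6,7) by (meson subsetD)
    obtain d where d: "d \<in> carrier L" "d \<otimes>\<^bsub>L\<^esub> d = a' \<otimes>\<^bsub>L\<^esub> a' \<oplus>\<^bsub>L\<^esub> b' \<otimes>\<^bsub>L\<^esub> b'" using sqrt[OF s] by blast
    have dK: "d \<in> K" unfolding KE' using L.pyth_closure_closed[OF E d(1) _ _ d(2)] ab(1,2) KE' by blast
    have gd: "g d \<in> carrier M" by (rule g_closed[OF dK])
    have "g d \<otimes>\<^bsub>M\<^esub> g d = c \<otimes>\<^bsub>M\<^esub> c" unfolding c(4) ab(3,4) using d(2) dK ab(1,2) KE(6) by (metis g_mult g_add)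
    moreover have "(c \<ominus>\<^bsub>M\<^esub> g d) \<otimes>\<^bsub>M\<^esub> (c \<oplus>\<^bsub>M\<^esub> g d) = c \<otimes>\<^bsub>M\<^esub> c \<ominus>\<^bsub>M\<^esub> g d \<otimes>\<^bsub>M\<^esub> g d" using c(1) gd by algebra
    ultimately have "(c \<ominus>\<^bsub>M\<^esub> g d) \<otimes>\<^bsub>M\<^esub> (c \<oplus>\<^bsub>M\<^esub> g d) = \<zero>\<^bsub>M\<^esub>" using c(1) by simp
    then have "c \<ominus>\<^bsub>M\<^esub> g d = \<zero>\<^bsub>M\<^esub> \<or> c \<oplus>\<^bsub>M\<^esub> g d = \<zero>\<^bsub>M\<^esub>" by (rule M.integral) (use c(1) gd in auto)
    then have "c = g d \<or> c = \<ominus>\<^bsub>M\<^esub> g d" using c(1) gd M.minus_equality[of c "g d"] by auto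
    then show "c \<in> g ` K" using dK g_minus[OF dK] KE(5)[OF dK] by (metis image_eqI)
  qed
qed

end

section \<open>From an abstract extension to its algebraic closure\<close>

lemma field_embeddingI:
  assumes "field L" "field M" "subfield K L" "h \<in> ring_hom (L\<lparr>carrier := K\<rparr>) M"
  shows "field_embedding L M K h"
  using assms(1-3) ring_hom_memE[OF assms(4)]
  by (intro field_embedding.intro field_embedding_axioms.intro) simp_all

text \<open>Pure inseparability is phrased with the characteristic of \<open>F\<close>, while
  conjugates are found in its algebraic closure; the Frobenius exponents have to match.\<close>

lemma ring_characteristic_embedding:
  assumes "field F" "field M" "j \<in> ring_hom F M"
  shows "ring_characteristic M = ring_characteristic F"
proof -
  interpret F: field F by fact
  interpret M: field M by fact
  interpret j: ring_hom_ring F M j by (rule ring_hom_ringI2[OF F.is_ring M.is_ring assms(3)])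
  have inj: "inj_on j (carrier F)"
    using j.img_is_subfield(1)[OF F.carrier_is_subfield] M.one_not_zero by blast
  have e: "j ([n] \<cdot>\<^bsub>F\<^esub> \<one>\<^bsub>F\<^esub>) = [n] \<cdot>\<^bsub>M\<^esub> \<one>\<^bsub>M\<^esub>" for n :: nat by (induct n) auto
  have iff: "[n] \<cdot>\<^bsub>M\<^esub> \<one>\<^bsub>M\<^esub> = \<zero>\<^bsub>M\<^esub> \<longleftrightarrow> [n] \<cdot>\<^bsub>F\<^esub> \<one>\<^bsub>F\<^esub> = \<zero>\<^bsub>F\<^esub>" for n :: nat
    unfolding e[symmetric] using inj_onD[OF inj, of "[n] \<cdot>\<^bsub>F\<^esub> \<one>\<^bsub>F\<^esub>" "\<zero>\<^bsub>F\<^esub>"] by auto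
  show ?thesis unfolding ring_characteristic_def iff ..
qed

lemma pythagorean_two_squares:
  assumes F: "field F" "pythagorean F" and ab: "a \<in> carrier F" "b \<in> carrier F"
  shows "\<exists>w\<in>carrier F. w \<otimes>\<^bsub>F\<^esub> w = a \<otimes>\<^bsub>F\<^esub> a \<oplus>\<^bsub>F\<^esub> b \<otimes>\<^bsub>F\<^esub> b"
proof -
  interpret F: field F by fact
  let ?x = "\<lambda>i::nat. if i = 0 then a else b"
  have "?x \<in> {..<2} \<rightarrow> carrier F" using ab by auto
  then obtain y where y: "y \<in> carrier F" "(\<Oplus>\<^bsub>F\<^esub>i\<in>{..<2}. ?x i \<otimes>\<^bsub>F\<^esub> ?x i) = y \<otimes>\<^bsub>F\<^esub> y"
    using F(2) unfolding pythagorean_def by blast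
  have "{..<2} = {0, Suc 0}" by auto
  then have "(\<Oplus>\<^bsub>F\<^esub>i\<in>{..<2}. ?x i \<otimes>\<^bsub>F\<^esub> ?x i) = a \<otimes>\<^bsub>F\<^esub> a \<oplus>\<^bsub>F\<^esub> b \<otimes>\<^bsub>F\<^esub> b"
    using ab by (simp add: F.finsum_insert)
  then show ?thesis using y by auto
qed

text \<open>The extension \<open>F\<close> is not contained in \<open>L\<close>, so its own
  algebraic closure becomes the ambient field. All data are moved there along the embedding of
  \<open>K\<close>, which is why the generators \<open>S\<close> are taken in
  \<open>E\<close>.\<close>

lemma pyth_closure_hereditarily_non_pythagorean:
  fixes L :: "('a, 'm) ring_scheme"
  assumes L: "algebraically_closed L" and two: "\<one>\<^bsub>L\<^esub> \<oplus>\<^bsub>L\<^esub> \<one>\<^bsub>L\<^esub> \<noteq> \<zero>\<^bsub>L\<^esub>"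
    and k: "subfield k L" "k \<subseteq> E" and E: "subfield E L"
    and S: "finite S" "S \<subseteq> E" "E \<subseteq> generate_field L (k \<union> S)"
    and t: "t \<in> E" "\<not> ring.alg_rel L k t"
  shows "hereditarily_non_pythagorean TYPE('b) (L\<lparr>carrier := pyth_closure L E\<rparr>)"
proof -
  interpret L: algebraically_closed L by fact
  define K where "K = pyth_closure L E"
  have K: "subfield K L" "E \<subseteq> K" unfolding K_def using L.subfield_pyth_closure[OF E] L.pyth_closure_incl[OF E] by auto
  have "\<not> pythagorean F"
    if F: "field F" and h: "h \<in> ring_hom (L\<lparr>carrier := K\<rparr>) F"
      and fd: "ring.finite_dimension F (h ` K) (carrier F)"
      and insep: "\<not> purely_inseparable F (h ` K)"
    for F :: "'b ring" and h
  proof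
    assume py: "pythagorean F"
    interpret F: field F by fact
    let ?M = "F.alg_closure" and ?j = "F.indexed_const :: 'b \<Rightarrow> (('b list \<times> nat) multiset \<Rightarrow> 'b)"
    interpret M: algebraic_closure ?M "?j ` carrier F" by (rule F.alg_closureE(1))
    have j: "?j \<in> ring_hom F ?M" by (rule F.alg_closureE(2))
    interpret j: ring_hom_ring F ?M ?j by (rule ring_hom_ringI2[OF F.is_ring M.is_ring j])
    interpret hE: field_embedding L F K h
      by (rule field_embeddingI[OF L.field_axioms F K(1) h])
    have jinj: "inj_on ?j (carrier F)" and jF: "subfield (?j ` carrier F) ?M"
      using j.img_is_subfield[OF F.carrier_is_subfield M.one_not_zero] by simp_all
    define g where "g = ?j \<circ> h"
    interpret g: field_embedding L ?M K g
      by (intro field_embedding.intro field_embedding_axioms.intro L.field_axioms M.field_axioms K(1))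
        (use hE.g_closed hE.g_one hE.g_add hE.g_mult in \<open>simp_all add: g_def\<close>)
    have hK: "subfield (h ` K) F" by (rule hE.image_subfield[OF K(1) subset_refl])
    have gK: "?j ` (h ` K) = g ` K" by (simp add: g_def image_comp)
    obtain n where "F.dimension n (h ` K) (carrier F)" using fd by (auto simp: F.finite_dimension_def)
    \<comment> \<open>The dimension is carried over first; a basis is then chosen inside the new
      ambient field.\<close>
    then have dim: "M.dimension n (g ` K) (?j ` carrier F)"
      using j.inj_hom_dimension[OF hK _ jinj] gK by simp
    have gKs: "subfield (g ` K) ?M" by (rule g.image_subfield[OF K(1) subset_refl])
    have pc: "g ` K = pyth_closure ?M (g ` E)"
      by (rule g.image_pyth_closure[OF E K_def L.exists_square_root])
    obtain u where u: "\<And>i. u i \<in> ?j ` carrier F" "?j ` carrier F = M.lspan (g ` K) u n"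
      "\<forall>\<kappa>. (\<forall>i. \<kappa> i \<in> g ` K) \<and> M.lincomb \<kappa> u n = \<zero>\<^bsub>?M\<^esub> \<longrightarrow> (\<forall>i<n. \<kappa> i = \<zero>\<^bsub>?M\<^esub>)"
      by (rule M.exists_lspan_basis[OF gKs dim]) blast
    have ce: "M.char_exp = max 1 (ring_characteristic F)"
      unfolding M.char_exp_def ring_characteristic_embedding[OF F M.field_axioms j] ..
    obtain x where x: "x \<in> carrier F" "\<And>e. x [^]\<^bsub>F\<^esub> (max 1 (ring_characteristic F) ^ e) \<notin> h ` K"
      using insep unfolding purely_inseparable_def by blast
    have xe: "?j x [^]\<^bsub>?M\<^esub> (M.char_exp ^ e) \<notin> g ` K" for e
    proof
      assume "?j x [^]\<^bsub>?M\<^esub> (M.char_exp ^ e) \<in> g ` K"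
      moreover have "?j x [^]\<^bsub>?M\<^esub> m = ?j (x [^]\<^bsub>F\<^esub> m)" for m :: nat using x(1) by (induct m) auto
      ultimately have "?j (x [^]\<^bsub>F\<^esub> (M.char_exp ^ e)) \<in> ?j ` (h ` K)" using gK by simp
      then have "x [^]\<^bsub>F\<^esub> (M.char_exp ^ e) \<in> h ` K"
        using jinj x(1) subfieldE(3)[OF hK] by (simp add: inj_on_image_mem_iff)
      then show False using x(2) ce by simp
    qed
    have KFE: "g ` K \<subseteq> ?j ` carrier F" using gK subfieldE(3)[OF hK] by blast
    show False
    proof (rule M.no_pythagorean_extension[of "g ` k" "g ` E" "g ` S" "g t" "?j ` carrier F" u n "?j x"])
      have "\<one>\<^bsub>L\<^esub> \<oplus>\<^bsub>L\<^esub> \<one>\<^bsub>L\<^esub> \<in> K" using g.KE(3,7) by blast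
      then show "\<one>\<^bsub>?M\<^esub> \<oplus>\<^bsub>?M\<^esub> \<one>\<^bsub>?M\<^esub> \<noteq> \<zero>\<^bsub>?M\<^esub>"
        using g.g_inv(1)[OF _ two] g.g_add[OF g.KE(3,3)] g.g_one by simp
      show "subfield (g ` k) ?M" by (rule g.image_subfield[OF k(1)]) (use k K in blast)
      show "g ` k \<subseteq> g ` E" using k(2) by blast
      show "subfield (g ` E) ?M" by (rule g.image_subfield[OF E K(2)])
      show "finite (g ` S)" using S(1) by blast
      show "g ` S \<subseteq> carrier ?M" using S(2) K(2) g.g_closed by blast
      show "g ` E \<subseteq> generate_field ?M (g ` k \<union> g ` S)"
        unfolding image_Un[symmetric] by (rule g.image_generate_field) (use k S K in blast)+
      show "g t \<in> g ` E" using t(1) by blast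
      show "\<not> M.alg_rel (g ` k) (g t)" using g.alg_rel_image[of k t] k K t by blast
      show "subfield (?j ` carrier F) ?M" by (rule jF)
      show "pyth_closure ?M (g ` E) \<subseteq> ?j ` carrier F" using KFE pc by simp
      show "u i \<in> ?j ` carrier F" for i by (rule u(1))
      show "?j ` carrier F = M.lspan (pyth_closure ?M (g ` E)) u n" using u(2) pc by simp
      show "\<kappa> i = \<zero>\<^bsub>?M\<^esub>" if "\<And>i. \<kappa> i \<in> pyth_closure ?M (g ` E)" "M.lincomb \<kappa> u n = \<zero>\<^bsub>?M\<^esub>" "i < n" for \<kappa> i
        using u(3) that unfolding pc by blast
      show "M.alg_rel (pyth_closure ?M (g ` E)) y" if y: "y \<in> ?j ` carrier F" for y
      proof -
        have "(M.algebraic over (g ` K)) y"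
          by (rule M.finite_dimension_imp_algebraic[OF gKs subfieldE(1)[OF jF] M.finite_dimensionI[OF dim] y])
        moreover have "y \<in> carrier ?M" using y subfieldE(3)[OF jF] by blast
        ultimately show ?thesis unfolding pc[symmetric] using M.alg_rel_iff_algebraic[OF subfieldE(1)[OF gKs]] by simp
      qed
      show "\<exists>w\<in>?j ` carrier F. w \<otimes>\<^bsub>?M\<^esub> w = a \<otimes>\<^bsub>?M\<^esub> a \<oplus>\<^bsub>?M\<^esub> b \<otimes>\<^bsub>?M\<^esub> b"
        if ab: "a \<in> ?j ` carrier F" "b \<in> ?j ` carrier F" for a b
      proof -
        obtain a' b' where a': "a' \<in> carrier F" "b' \<in> carrier F" "a = ?j a'" "b = ?j b'" using ab by blast
        obtain w where w: "w \<in> carrier F" "w \<otimes>\<^bsub>F\<^esub> w = a' \<otimes>\<^bsub>F\<^esub> a' \<oplus>\<^bsub>F\<^esub> b' \<otimes>\<^bsub>F\<^esub> b'"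
          using pythagorean_two_squares[OF F py a'(1,2)] by blast
        have "?j w \<otimes>\<^bsub>?M\<^esub> ?j w = ?j (w \<otimes>\<^bsub>F\<^esub> w)" using w(1) by simp
        also have "\<dots> = a \<otimes>\<^bsub>?M\<^esub> a \<oplus>\<^bsub>?M\<^esub> b \<otimes>\<^bsub>?M\<^esub> b" unfolding w(2) a'(3,4) using a'(1,2) by simp
        finally show ?thesis using w(1) by blast
      qed
      show "?j x \<in> ?j ` carrier F" using x(1) by blast
      show "?j x [^]\<^bsub>?M\<^esub> (M.char_exp ^ e) \<notin> pyth_closure ?M (g ` E)" for e using xe pc by simp
    qed
  qed
  moreover have "field (L\<lparr>carrier := K\<rparr>)" by (rule L.subfield_iff(2)[OF K(1)])
  ultimately show ?thesis unfolding hereditarily_non_pythagorean_def K_def[symmetric] by (simp, blast)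
qed

text \<open>A relation for \<open>t\<close> alone is a relation among the elements of
  \<open>B\<close> whose monomials have exponent zero away from \<open>t\<close>.\<close>

lemma (in field) algebraically_independent_not_alg_rel:
  assumes k: "subfield k R" and B: "algebraically_independent R k B" and t: "t \<in> B"
  shows "\<not> alg_rel k t"
proof
  assume "alg_rel k t"
  then obtain f n i where f: "\<And>i. f i \<in> k" "i < n" "f i \<noteq> \<zero>" "peval f n t = \<zero>"
    unfolding alg_rel_def by blast
  have B': "finite B" "B \<subseteq> carrier R" using B by (auto simp: algebraically_independent_def)
  have tc: "t \<in> carrier R" and fc: "\<And>i. f i \<in> carrier R"
    using t B' f(1) subfieldE(3)[OF k] by auto
  \<comment> \<open>The exponent vector of t^j, restricted to \<open>B\<close> as extensionality
    requires; its entry at \<open>t\<close> recovers \<open>j\<close>, so distinct powers give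
    distinct monomials.\<close>
  define m where "m = (\<lambda>j::nat. \<lambda>b\<in>B. if b = t then j else 0)"
  have mt: "m j t = j" for j using t by (simp add: m_def)
  have inj: "inj_on m {..<n}" by (rule inj_on_inverseI[of _ "\<lambda>m. m t"]) (simp add: mt)
  have prod: "(\<Otimes>b\<in>B. b [^] m j b) = t [^] j" for j
  proof -
    have "(\<Otimes>b\<in>B. b [^] m j b) = (\<Otimes>b\<in>B. if t = b then t [^] j else \<one>)"
      using B' tc by (intro finprod_cong') (auto simp: m_def)
    also have "\<dots> = t [^] j" using finprod_singleton[OF t B'(1), of "\<lambda>_. t [^] j"] tc by simp
    finally show ?thesis .
  qed
  have sum: "(\<Oplus>j\<in>{..<n}. f j \<otimes> t [^] j) = peval f n t" for n
  proof (induct n)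
    case (Suc n)
    have "{..<Suc n} = insert n {..<n}" by auto
    then show ?case using Suc fc tc by (simp add: a_comm)
  qed simp
  let ?c = "\<lambda>m. f (m t)"
  have "(\<Oplus>m\<in>m ` {..<n}. ?c m \<otimes> (\<Otimes>b\<in>B. b [^] m b)) = (\<Oplus>j\<in>{..<n}. ?c (m j) \<otimes> (\<Otimes>b\<in>B. b [^] m j b))"
    using inj fc B' by (intro finsum_reindex) (auto intro!: finprod_closed m_closed)
  also have "\<dots> = \<zero>" unfolding mt prod sum by (rule f(4))
  finally have z: "(\<Oplus>m\<in>m ` {..<n}. ?c m \<otimes> (\<Otimes>b\<in>B. b [^] m b)) = \<zero>" .
  have sub: "m ` {..<n} \<subseteq> (B \<rightarrow>\<^sub>E UNIV)" unfolding m_def by auto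
  have ck: "?c \<in> m ` {..<n} \<rightarrow> k" using f(1) by blast
  have fin: "finite (m ` {..<n})" by (rule finite_imageI) (rule finite_lessThan)
  have all: "\<forall>M c. finite M \<and> M \<subseteq> (B \<rightarrow>\<^sub>E (UNIV :: nat set)) \<and> c \<in> M \<rightarrow> k \<and>
      (\<Oplus>m\<in>M. c m \<otimes> (\<Otimes>b\<in>B. b [^] m b)) = \<zero> \<longrightarrow> (\<forall>m\<in>M. c m = \<zero>)"
    using B unfolding algebraically_independent_def by (elim conjE)
  have "\<forall>m'\<in>m ` {..<n}. ?c m' = \<zero>"
    by (rule mp[OF spec[OF spec[OF all, of "m ` {..<n}"], of ?c]]) (intro conjI fin sub ck z)
  then have "f (m i t) = \<zero>" using f(2) by blast
  then show False using f(3) mt by simp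
qed

theorem corollary5p4:
  fixes L :: "('a, 'm) ring_scheme" and E k :: "'a set"
  assumes "algebraic_closure L E"
    and "ring_characteristic (L\<lparr>carrier := E\<rparr>) \<noteq> 2"
    and "subfield k L" and "k \<subseteq> E"
    and "finitely_generated_over L k E"
    and "1 \<le> transcendence_degree L k E"
  shows "hereditarily_non_pythagorean TYPE('b) (L\<lparr>carrier := pyth_closure L E\<rparr>) \<and>
         hereditarily_non_pythagorean TYPE('b) (L\<lparr>carrier := quad_closure L E\<rparr>)"
proof -
  interpret L: algebraic_closure L E by fact
  have E: "subfield E L" by (rule L.subfield_axioms)
  have LC: "algebraically_closed L" by (rule L.algebraically_closed_axioms)
  have two: "\<one>\<^bsub>L\<^esub> \<oplus>\<^bsub>L\<^esub> \<one>\<^bsub>L\<^esub> \<noteq> \<zero>\<^bsub>L\<^esub>"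
  proof
    assume z: "\<one>\<^bsub>L\<^esub> \<oplus>\<^bsub>L\<^esub> \<one>\<^bsub>L\<^esub> = \<zero>\<^bsub>L\<^esub>"
    let ?E = "L\<lparr>carrier := E\<rparr>"
    interpret E: field ?E by (rule L.subfield_iff(2)[OF E])
    have 2: "[(2::nat)] \<cdot>\<^bsub>?E\<^esub> \<one>\<^bsub>?E\<^esub> = \<zero>\<^bsub>?E\<^esub>" using z subringE(1)[OF subfieldE(1)[OF E]] by (simp add: numeral_2_eq_2 E.add.nat_pow_Suc)
    let ?P = "\<lambda>n::nat. 0 < n \<and> [n] \<cdot>\<^bsub>?E\<^esub> \<one>\<^bsub>?E\<^esub> = \<zero>\<^bsub>?E\<^esub>"
    have "(LEAST n. ?P n) = 2"
    proof (rule Least_equality)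
      fix n assume n: "?P n"
      have "n \<noteq> 1"
      proof
        assume "n = 1"
        then have "\<one>\<^bsub>?E\<^esub> = \<zero>\<^bsub>?E\<^esub>" using n E.add.nat_pow_eone[OF E.one_closed] by simp
        then show False by simp
      qed
      then show "2 \<le> n" using n by auto
    qed (use 2 in simp)
    moreover have "ring_characteristic ?E = (LEAST n. ?P n)"
      unfolding ring_characteristic_def by (rule if_P) (use 2 in \<open>intro exI[of _ 2], simp\<close>)
    ultimately show False using assms(2) by simp
  qed
  obtain S where S: "finite S" "S \<subseteq> E" "E = generate_field L (k \<union> S)"
    using assms(5) unfolding finitely_generated_over_def by blast
  \<comment> \<open>If only the empty set were independent, the supremum of the cardinalities would
    be 0.\<close>
  have "\<exists>B. B \<subseteq> E \<and> algebraically_independent L k B \<and> B \<noteq> {}"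
  proof (rule ccontr)
    assume "\<not> ?thesis"
    then have "transcendence_degree L k E \<le> 0"
      unfolding transcendence_degree_def by (intro SUP_least) (auto simp: zero_enat_def)
    then show False using assms(6) by simp
  qed
  then obtain B t where B: "B \<subseteq> E" "algebraically_independent L k B" "t \<in> B" by blast
  have t: "t \<in> E" "\<not> L.alg_rel k t"
    using B L.algebraically_independent_not_alg_rel[OF assms(3) B(2,3)] by auto
  obtain i where i: "i \<in> carrier L" "i \<otimes>\<^bsub>L\<^esub> i = \<ominus>\<^bsub>L\<^esub> \<one>\<^bsub>L\<^esub>" using L.exists_square_root[of "\<ominus>\<^bsub>L\<^esub> \<one>\<^bsub>L\<^esub>"] by auto
  \<comment> \<open>E(i) lies in the field generated over \<open>k\<close> by \<open>i\<close> and
    \<open>S\<close>, so the result for pythagorean closures applies to it as it does to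
    \<open>E\<close>.\<close>
  let ?G = "generate_field L (insert i E)"
  have iE: "insert i E \<subseteq> carrier L" using i(1) subfieldE(3)[OF E] by blast
  have G: "subfield ?G L" "insert i E \<subseteq> ?G"
    using L.generate_field_is_subfield[OF iE] L.generate_fieldE(2)[OF iE refl] by auto
  have kS: "k \<union> insert i S \<subseteq> carrier L" using assms(4) S(2) iE by blast
  note H = L.generate_field_is_subfield[OF kS] L.generate_fieldE(2)[OF kS refl]
  have "E \<subseteq> generate_field L (k \<union> insert i S)"
    unfolding S(3) using kS by (intro L.mono_generate_field) auto
  then have "?G \<subseteq> generate_field L (k \<union> insert i S)"
    using H by (intro L.generate_field_min_subfield1[OF iE]) auto
  then have "hereditarily_non_pythagorean TYPE('b) (L\<lparr>carrier := pyth_closure L ?G\<rparr>)"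
    using assms(4) S(1,2) G t
    by (intro pyth_closure_hereditarily_non_pythagorean[OF LC two assms(3) _ G(1), of "insert i S" t]) auto
  moreover have "hereditarily_non_pythagorean TYPE('b) (L\<lparr>carrier := pyth_closure L E\<rparr>)"
    by (rule pyth_closure_hereditarily_non_pythagorean[OF LC two assms(3,4) E S(1,2) _ t]) (use S(3) in simp)
  ultimately show ?thesis using L.quad_closure_eq_pyth_closure[OF E two i] by simp
qed

end
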